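(* Let $\mathcal A,\mathcal C$ be $A_\infty$-categories and let $\mathcal P$ be a graded span, that is, a family of graded $\Bbbk$-modules $\mathcal P(X,Y)$, $X\in\mathrm{Ob}\,\mathcal A$, $Y\in\mathrm{Ob}\,\mathcal C$. Let $b^{\mathcal P}:Ts\mathcal A\otimes s\mathcal P\otimes Ts\mathcal C\to Ts\mathcal A\otimes s\mathcal P\otimes Ts\mathcal C$ be a $(1,1,1,b^{\mathcal A},b^{\mathcal C})$-connection of degree 1 with $(b^{\mathcal P}_{00})^2=0$, and let $\phi^{\mathcal P}:Ts\mathcal A^{\mathrm{op}}\boxtimes Ts\mathcal C\to Ts\underline{\mathsf C}_{\Bbbk}$ be the corresponding augmented coalgebra homomorphism. Then $b^{\mathcal P}$ is a flat connection, i.e. $(b^{\mathcal P})^2=0$, so that $(Ts\mathcal A\otimes s\mathcal P\otimes Ts\mathcal C,b^{\mathcal P})$ is a differential graded bicomodule, if and only if $\phi^{\mathcal P}$ is an $A_\infty$-functor $\mathcal A^{\mathrm{op}},\mathcal C\to\underline{\mathsf C}_{\Bbbk}$.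
   Context: Conventions. $\Bbbk$ is a commutative ring with unity; graded means $\mathbb Z$-graded. Maps act on the right and composition is written left to right ($fg$: first $f$, then $g$). Koszul signs: $(x\otimes y)(f\otimes g)=(-1)^{\deg y\deg f}xf\otimes yg$; $c$ is the signed flip. $sM=M[1]$, $M[n]^k=M^{k+n}$, $s:M\to sM$ is the identity map, of degree $-1$. $\underline{\mathsf C}_{\Bbbk}$ is the dg category of complexes: $\underline{\mathsf C}_{\Bbbk}(M,N)^n=\prod_i\mathrm{Hom}_{\Bbbk}(M^i,N^{i+n})$, differential $f\mapsto fd_N-(-1)^{\deg f}d_Mf$, composition $f\otimes g\mapsto fg$; $\mathrm{ev}:M\otimes\underline{\mathsf C}_{\Bbbk}(M,N)\to N$, $x\otimes f\mapsto xf$. A graded quiver $\mathcal A$ is a set of objects with graded modules $\mathcal A(X,Y)$. $Ts\mathcal A=\bigoplus_{n\ge0}T^ns\mathcal A$, $T^ns\mathcal A(X,Y)=\bigoplus s\mathcal A(X,X_1)\otimes\dots\otimes s\mathcal A(X_{n-1},Y)$, $T^0s\mathcal A(X,X)=\Bbbk$, $T^0s\mathcal A(X,Y)=0$ for $X\neq Y$; $\Delta_0$ is the cut comultiplication. An $A_\infty$-category is a graded quiver with degree 1 maps $b_n:T^ns\mathcal A(X,Y)\to s\mathcal A(X,Y)$, $n\ge1$, such that the coderivation $b=\sum1^{\otimes r}\otimes b_n\otimes1^{\otimes t}$ of $Ts\mathcal A$ satisfies $b^2=0$; $m_1=sb_1s^{-1}$, $m_2=(s\otimes s)b_2s^{-1}$;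 a dg category is an $A_\infty$-category with these $m_1,m_2$ and $b_n=0$ for $n>2$. $\mathcal A^{\mathrm{op}}(X,Y)=\mathcal A(Y,X)$, $b^{\mathrm{op}}=\gamma b\gamma$, where $\gamma:Ts\mathcal A^{\mathrm{op}}\leftrightarrow Ts\mathcal A$ is on $T^k$ the Koszul-signed reversal of factors times $(-1)^k$. An augmented coalgebra homomorphism $\phi:Ts\mathcal A^{\mathrm{op}}\boxtimes Ts\mathcal C\to Ts\underline{\mathsf C}_{\Bbbk}$ consists of a map $\mathrm{Ob}\,\mathcal A\times\mathrm{Ob}\,\mathcal C\to\mathrm{Ob}\,\underline{\mathsf C}_{\Bbbk}$ and a degree 0 homomorphism of counital coalgebras over it, with $\phi_{00}=0$; it is determined by arbitrary degree 0 components $\phi_{kn}:T^ks\mathcal A^{\mathrm{op}}(X,Y)\otimes T^ns\mathcal C(Z,W)\to s\underline{\mathsf C}_{\Bbbk}(\phi(X,Z),\phi(Y,W))$, $(k,n)\ne(0,0)$. It is an $A_\infty$-functor if it commutes with the differentials: $\phi b=(b^{\mathrm{op}}\boxtimes1+1\boxtimes b)\phi$. Put $P=Ts\mathcal A\otimes s\mathcal P\otimes Ts\mathcal C$, a $Ts\mathcal A$-$Ts\mathcal C$-bicomodule with coactions $\delta'=\Delta_0\otimes1\otimes1$, $\delta''=1\otimes1\otimes\Delta_0$. A $(1,1,1,b^{\mathcal A},b^{\mathcal C})$-connection of degree 1 is a degree 1 map $b^{\mathcal P}:P\to P$ (preserving source and target objects) with $b^{\mathcal P}\delta'=\delta'(1\otimes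 b^{\mathcal P}+b^{\mathcal A}\otimes1)$ and $b^{\mathcal P}\delta''=\delta''(1\otimes b^{\mathcal C}+b^{\mathcal P}\otimes1)$. It is determined by its components $b^{\mathcal P}_{kn}:T^ks\mathcal A\otimes s\mathcal P\otimes T^ns\mathcal C\to s\mathcal P$, the restrictions of $b^{\mathcal P}(\mathrm{pr}_0\otimes1\otimes\mathrm{pr}_0)$. It is called flat if $(b^{\mathcal P})^2=0$. Correspondence $b^{\mathcal P}\leftrightarrow\phi^{\mathcal P}$ (a bijection between connections of degree 1 with $(b^{\mathcal P}_{00})^2=0$ and augmented coalgebra homomorphisms): $\phi^{\mathcal P}(X,Z)$ is the complex $(\mathcal P(X,Z),sb^{\mathcal P}_{00}s^{-1})$, and for $(k,n)\neq(0,0)$ the component $b^{\mathcal P}_{kn}$ is the composite $T^ks\mathcal A(Y,X)\otimes s\mathcal P(X,Z)\otimes T^ns\mathcal C(Z,W)\xrightarrow{c\otimes1}s\mathcal P(X,Z)\otimes T^ks\mathcal A(Y,X)\otimes T^ns\mathcal C(Z,W)\xrightarrow{1\otimes\gamma\otimes1}s\mathcal P(X,Z)\otimes T^ks\mathcal A^{\mathrm{op}}(X,Y)\otimes T^ns\mathcal C(Z,W)\xrightarrow{1\otimes\phi^{\mathcal P}_{kn}}s\mathcal P(X,Z)\otimes s\underline{\mathsf C}_{\Bbbk}(\mathcal P(X,Z),\mathcal P(Y,W))\xrightarrow{(s\otimes s)^{-1}}\mathcal P(X,Z)\otimes\underline{\mathsf C}_{\Bbbk}(\mathcal P(X,Z),\mathcal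 P(Y,W))\xrightarrow{\mathrm{ev}}\mathcal P(Y,W)\xrightarrow{s}s\mathcal P(Y,W)$. *)

theory Defs
  imports HOL.Modules "HOL-Library.Poly_Mapping" "HOL-Library.Function_Algebras"
begin

section \<open>Graded spans presented by homogeneous pure tensors\<close>

text \<open>
  A family of \<open>\<int>\<close>-graded \<open>k\<close>-modules, indexed by a source and a target object, is given by a set
  of generators (the homogeneous pure tensors), each with a source, a target and a degree, and
  by the relations expressing additivity and homogeneity in each tensor factor. The module
  in question is the quotient of the free \<open>k\<close>-module \<open>'w \<Rightarrow>\<^sub>0 'k\<close> on the generators by the
  submodule \<open>rels\<close> spanned by these relations. Since the relations are homogeneous and
  preserve source and target, this quotient is the direct sum of the modules of the family.

  The relation \<open>padd S u v w\<close> says that the tensors \<open>u\<close>, \<open>v\<close>, \<open>w\<close> agree in all factors but one,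
  where the factor of \<open>w\<close> is the sum of those of \<open>u\<close> and \<open>v\<close>; the relation \<open>pscl S c u w\<close>
  says that \<open>w\<close> arises from \<open>u\<close> by multiplying one factor by \<open>c\<close>.
\<close>

definition fscale :: "'k::comm_ring_1 \<Rightarrow> ('w \<Rightarrow>\<^sub>0 'k) \<Rightarrow> ('w \<Rightarrow>\<^sub>0 'k)" where
  "fscale c p = Poly_Mapping.map ((*) c) p"

lemma lookup_fscale [simp]: "Poly_Mapping.lookup (fscale c p) w = c * Poly_Mapping.lookup p w"
  by (simp add: fscale_def Poly_Mapping.map.rep_eq when_def)

interpretation free_module: module fscale
  by standard (rule poly_mapping_eqI; simp add: lookup_add algebra_simps)+

abbreviation unit_vec :: "'w \<Rightarrow> ('w \<Rightarrow>\<^sub>0 'k::comm_ring_1)" where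
  "unit_vec w \<equiv> Poly_Mapping.single w 1"

record ('w, 's, 't, 'k) gspan =
  gen :: "'w set"
  src :: "'w \<Rightarrow> 's"
  tgt :: "'w \<Rightarrow> 't"
  dgr :: "'w \<Rightarrow> int"
  padd :: "'w \<Rightarrow> 'w \<Rightarrow> 'w \<Rightarrow> bool"
  pscl :: "'k \<Rightarrow> 'w \<Rightarrow> 'w \<Rightarrow> bool"

definition rels :: "('w, 's, 't, 'k::comm_ring_1) gspan \<Rightarrow> ('w \<Rightarrow>\<^sub>0 'k) set" where
  "rels S = module.span fscale
     ({unit_vec w - unit_vec u - unit_vec v | u v w.
         u \<in> gen S \<and> v \<in> gen S \<and> w \<in> gen S \<and> padd S u v w} \<union>
      {unit_vec w - fscale c (unit_vec u) | c u w. u \<in> gen S \<and> w \<in> gen S \<and> pscl S c u w})"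

text \<open>
  A linear map is given by representatives of its values on generators; two maps are equal if
  these agree modulo \<open>rels\<close> of the codomain.
  Maps act on the right, so \<open>f \<triangleright> g\<close> is first \<open>f\<close>, then \<open>g\<close>.
\<close>

type_synonym ('w, 'v, 'k) gmap = "'w \<Rightarrow> ('v \<Rightarrow>\<^sub>0 'k)"

definition lin :: "('w, 'v, 'k::comm_ring_1) gmap \<Rightarrow> ('w \<Rightarrow>\<^sub>0 'k) \<Rightarrow> ('v \<Rightarrow>\<^sub>0 'k)" where
  "lin f p = (\<Sum>w\<in>Poly_Mapping.keys p. fscale (Poly_Mapping.lookup p w) (f w))"

definition gcomp :: "('u, 'v, 'k::comm_ring_1) gmap \<Rightarrow> ('v, 'w, 'k) gmap \<Rightarrow> ('u, 'w, 'k) gmap"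
    (infixl \<open>\<triangleright>\<close> 55) where
  "(f \<triangleright> g) w = lin g (f w)"

abbreviation idm :: "('w, 'w, 'k::comm_ring_1) gmap" where
  "idm \<equiv> unit_vec"

definition eq_on :: "'u set \<Rightarrow> ('v, 's, 't, 'k::comm_ring_1) gspan \<Rightarrow>
    ('u, 'v, 'k) gmap \<Rightarrow> ('u, 'v, 'k) gmap \<Rightarrow> bool" where
  "eq_on W T f g \<longleftrightarrow> (\<forall>w\<in>W. f w - g w \<in> rels T)"

text \<open>Homogeneous linear maps \<open>S \<rightarrow> T\<close> of degree \<open>e\<close> over the object maps \<open>fs\<close>, \<open>ft\<close>.\<close>

definition hom_maps :: "('w, 's, 't, 'k::comm_ring_1) gspan \<Rightarrow> ('v, 's2, 't2, 'k) gspan \<Rightarrow>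
    ('s \<Rightarrow> 's2) \<Rightarrow> ('t \<Rightarrow> 't2) \<Rightarrow> int \<Rightarrow> ('w, 'v, 'k) gmap set" where
  "hom_maps S T fs ft e = {f.
     (\<forall>w\<in>gen S. \<forall>v\<in>Poly_Mapping.keys (f w). v \<in> gen T \<and> src T v = fs (src S w) \<and>
        tgt T v = ft (tgt S w) \<and> dgr T v = dgr S w + e) \<and>
     (\<forall>r\<in>rels S. lin f r \<in> rels T)}"

definition ksgn :: "int \<Rightarrow> 'k::comm_ring_1" where
  "ksgn n = (if even n then 1 else - 1)"

definition ftens :: "('w \<Rightarrow>\<^sub>0 'k::comm_ring_1) \<Rightarrow> ('v \<Rightarrow>\<^sub>0 'k) \<Rightarrow> ('w \<times> 'v \<Rightarrow>\<^sub>0 'k)" where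
  "ftens p q = (\<Sum>w\<in>Poly_Mapping.keys p. \<Sum>v\<in>Poly_Mapping.keys q.
     Poly_Mapping.single (w, v) (Poly_Mapping.lookup p w * Poly_Mapping.lookup q v))"

text \<open>\<open>tmap dg e f g\<close> is \<open>f \<otimes> g\<close>, where \<open>e\<close> is the degree of \<open>f\<close> and \<open>dg\<close> is the degree function on
  the domain of \<open>g\<close>.\<close>

definition tmap :: "('v \<Rightarrow> int) \<Rightarrow> int \<Rightarrow> ('w, 'w2, 'k::comm_ring_1) gmap \<Rightarrow> ('v, 'v2, 'k) gmap \<Rightarrow>
    ('w \<times> 'v, 'w2 \<times> 'v2, 'k) gmap" where
  "tmap dg e f g = (\<lambda>(w, v). fscale (ksgn (dg v * e)) (ftens (f w) (g v)))"

definition padd_pair :: "('w, 's, 't, 'k) gspan \<Rightarrow> ('v, 's2, 't2, 'k) gspan \<Rightarrow>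
    'w \<times> 'v \<Rightarrow> 'w \<times> 'v \<Rightarrow> 'w \<times> 'v \<Rightarrow> bool" where
  "padd_pair S T u v w \<longleftrightarrow>
     padd S (fst u) (fst v) (fst w) \<and> snd u = snd w \<and> snd v = snd w \<or>
     fst u = fst w \<and> fst v = fst w \<and> padd T (snd u) (snd v) (snd w)"

definition pscl_pair :: "('w, 's, 't, 'k) gspan \<Rightarrow> ('v, 's2, 't2, 'k) gspan \<Rightarrow>
    'k \<Rightarrow> 'w \<times> 'v \<Rightarrow> 'w \<times> 'v \<Rightarrow> bool" where
  "pscl_pair S T c u w \<longleftrightarrow>
     pscl S c (fst u) (fst w) \<and> snd u = snd w \<or> fst u = fst w \<and> pscl T c (snd u) (snd w)"

text \<open>\<open>tens S T\<close> is \<open>(S \<otimes> T)(X,Z) = \<Oplus>\<^sub>Y S(X,Y) \<otimes> T(Y,Z)\<close>; in contrast,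
  \<open>box S T\<close> is \<open>(S \<boxtimes> T)((X,Z),(Y,W)) = S(X,Y) \<otimes> T(Z,W)\<close>.\<close>

definition tens :: "('w, 's, 't, 'k) gspan \<Rightarrow> ('v, 't, 'u, 'k) gspan \<Rightarrow>
    ('w \<times> 'v, 's, 'u, 'k) gspan" where
  "tens S T = \<lparr>gen = {(w, v). w \<in> gen S \<and> v \<in> gen T \<and> tgt S w = src T v},
     src = (\<lambda>(w, v). src S w), tgt = (\<lambda>(w, v). tgt T v),
     dgr = (\<lambda>(w, v). dgr S w + dgr T v),
     padd = padd_pair S T, pscl = pscl_pair S T\<rparr>"

definition box :: "('w, 's, 't, 'k) gspan \<Rightarrow> ('v, 's2, 't2, 'k) gspan \<Rightarrow>
    ('w \<times> 'v, 's \<times> 's2, 't \<times> 't2, 'k) gspan" where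
  "box S T = \<lparr>gen = gen S \<times> gen T,
     src = (\<lambda>(w, v). (src S w, src T v)), tgt = (\<lambda>(w, v). (tgt S w, tgt T v)),
     dgr = (\<lambda>(w, v). dgr S w + dgr T v),
     padd = padd_pair S T, pscl = pscl_pair S T\<rparr>"


section \<open>Graded quivers and spans, suspension\<close>

text \<open>The graded modules \<open>M X Y n\<close> are submodules of an ambient \<open>k\<close>-module.\<close>

definition graded_span :: "('k::comm_ring_1 \<Rightarrow> 'a::ab_group_add \<Rightarrow> 'a) \<Rightarrow> 's set \<Rightarrow> 't set \<Rightarrow>
    ('s \<Rightarrow> 't \<Rightarrow> int \<Rightarrow> 'a set) \<Rightarrow> bool" where
  "graded_span sc I J M \<longleftrightarrow> module sc \<and>
     (\<forall>X\<in>I. \<forall>Y\<in>J. \<forall>n. module.subspace sc (M X Y n))"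

definition shift :: "('s \<Rightarrow> 't \<Rightarrow> int \<Rightarrow> 'a set) \<Rightarrow> 's \<Rightarrow> 't \<Rightarrow> int \<Rightarrow> 'a set" where
  "shift M X Y n = M X Y (n + 1)"

text \<open>\<open>Letter X n x Y\<close> is the element \<open>x\<close> of degree \<open>n\<close> of \<open>M(X,Y)\<close>.\<close>

datatype ('s, 't, 'a) letter = Letter (lsrc: 's) (ldeg: int) (lelt: 'a) (ltgt: 't)

definition ladd :: "('s, 't, 'a::plus) letter \<Rightarrow> ('s, 't, 'a) letter \<Rightarrow> ('s, 't, 'a) letter \<Rightarrow> bool" where
  "ladd u v w \<longleftrightarrow> (\<exists>X n x y Y.
     u = Letter X n x Y \<and> v = Letter X n y Y \<and> w = Letter X n (x + y) Y)"

definition lscl :: "('k \<Rightarrow> 'a \<Rightarrow> 'a) \<Rightarrow> 'k \<Rightarrow> ('s, 't, 'a) letter \<Rightarrow> ('s, 't, 'a) letter \<Rightarrow> bool" where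
  "lscl sc c u w \<longleftrightarrow> (\<exists>X n x Y. u = Letter X n x Y \<and> w = Letter X n (sc c x) Y)"

definition letters :: "'s set \<Rightarrow> 't set \<Rightarrow> ('s \<Rightarrow> 't \<Rightarrow> int \<Rightarrow> 'a set) \<Rightarrow> ('s, 't, 'a) letter set" where
  "letters I J M = {Letter X n x Y | X n x Y. X \<in> I \<and> Y \<in> J \<and> x \<in> M X Y n}"

definition susp :: "('k \<Rightarrow> 'a::plus \<Rightarrow> 'a) \<Rightarrow> 's set \<Rightarrow> 't set \<Rightarrow> ('s \<Rightarrow> 't \<Rightarrow> int \<Rightarrow> 'a set) \<Rightarrow>
    (('s, 't, 'a) letter, 's, 't, 'k) gspan" where
  "susp sc I J M = \<lparr>gen = letters I J (shift M), src = lsrc, tgt = ltgt, dgr = ldeg,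
     padd = ladd, pscl = lscl sc\<rparr>"

definition realize :: "('k::comm_ring_1 \<Rightarrow> 'a::ab_group_add \<Rightarrow> 'a) \<Rightarrow>
    (('s, 't, 'a) letter \<Rightarrow>\<^sub>0 'k) \<Rightarrow> 'a" where
  "realize sc p = (\<Sum>l\<in>Poly_Mapping.keys p. sc (Poly_Mapping.lookup p l) (lelt l))"

fun s_letter s_inv_letter :: "('s, 't, 'a) letter \<Rightarrow> ('s, 't, 'a) letter" where
  "s_letter (Letter X n x Y) = Letter X (n - 1) x Y"
| "s_inv_letter (Letter X n x Y) = Letter X (n + 1) x Y"

definition s_map :: "(('s, 't, 'a) letter, ('s, 't, 'a) letter, 'k::comm_ring_1) gmap" where
  "s_map l = unit_vec (s_letter l)"

definition s_inv :: "(('s, 't, 'a) letter, ('s, 't, 'a) letter, 'k::comm_ring_1) gmap" where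
  "s_inv l = unit_vec (s_inv_letter l)"

text \<open>The inverse of \<open>s \<otimes> s\<close>. By the Koszul rule it is \<open>- (s\<^sup>-\<^sup>1 \<otimes> s\<^sup>-\<^sup>1)\<close>.\<close>

definition ss_inv :: "(('s, 't, 'a) letter \<times> ('u, 'v, 'b) letter,
    ('s, 't, 'a) letter \<times> ('u, 'v, 'b) letter, 'k::comm_ring_1) gmap" where
  "ss_inv w = - tmap ldeg 1 s_inv s_inv w"

lemma s_tensor_s_ss_inv:
  "(tmap ldeg (- 1) s_map s_map \<triangleright> ss_inv) w = (idm w :: _ \<Rightarrow>\<^sub>0 'k::comm_ring_1)"
proof (cases w)
  case (Pair u v)
  obtain X n x Y where u: "u = Letter X n x Y" by (cases u)
  obtain Z m y W where v: "v = Letter Z m y W" by (cases v)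
  have *: "tmap ldeg (- 1) s_map s_map w =
      Poly_Mapping.single (s_letter u, s_letter v) (ksgn m :: 'k)"
    by (rule poly_mapping_eqI)
      (simp add: tmap_def ftens_def s_map_def Pair u v lookup_single when_def ksgn_def)
  show ?thesis
    unfolding gcomp_def *
    by (rule poly_mapping_eqI)
      (simp add: lin_def ss_inv_def tmap_def ftens_def s_inv_def Pair u v lookup_single when_def
        ksgn_def)
qed


section \<open>Tensor coalgebras\<close>

text \<open>\<open>(X, [l\<^sub>1, \<dots>, l\<^sub>n])\<close> is the tensor \<open>l\<^sub>1 \<otimes> \<dots> \<otimes> l\<^sub>n\<close> with source \<open>X\<close>; \<open>(X, [])\<close> is the unit
  of \<open>T\<^sup>0(X,X) = k\<close>.\<close>

type_synonym ('o, 'a) path = "'o \<times> ('o, 'o, 'a) letter list"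

fun is_path :: "'o \<Rightarrow> ('o, 'o, 'a) letter list \<Rightarrow> bool" where
  "is_path X [] \<longleftrightarrow> True"
| "is_path X (l # ls) \<longleftrightarrow> lsrc l = X \<and> is_path (ltgt l) ls"

definition path_tgt :: "('o, 'a) path \<Rightarrow> 'o" where
  "path_tgt w = (if snd w = [] then fst w else ltgt (last (snd w)))"

definition path_deg :: "('o, 'a) path \<Rightarrow> int" where
  "path_deg w = sum_list (map ldeg (snd w))"

text \<open>\<open>Ts_pow N sc Ob A\<close> is the direct sum of the \<open>T\<^sup>nsA\<close> for \<open>n \<in> N\<close>.\<close>

definition Ts_pow :: "nat set \<Rightarrow> ('k \<Rightarrow> 'a::plus \<Rightarrow> 'a) \<Rightarrow> 'o set \<Rightarrow> ('o \<Rightarrow> 'o \<Rightarrow> int \<Rightarrow> 'a set) \<Rightarrow>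
    (('o, 'a) path, 'o, 'o, 'k) gspan" where
  "Ts_pow N sc Ob A = \<lparr>
     gen = {(X, ls). X \<in> Ob \<and> set ls \<subseteq> letters Ob Ob (shift A) \<and> is_path X ls \<and> length ls \<in> N},
     src = fst, tgt = path_tgt, dgr = path_deg,
     padd = (\<lambda>u v w. \<exists>X us vs k l m. ladd k l m \<and>
       u = (X, us @ [k] @ vs) \<and> v = (X, us @ [l] @ vs) \<and> w = (X, us @ [m] @ vs)),
     pscl = (\<lambda>c u w. \<exists>X us vs k m. lscl sc c k m \<and>
       u = (X, us @ [k] @ vs) \<and> w = (X, us @ [m] @ vs))\<rparr>"

abbreviation Ts :: "('k \<Rightarrow> 'a::plus \<Rightarrow> 'a) \<Rightarrow> 'o set \<Rightarrow> ('o \<Rightarrow> 'o \<Rightarrow> int \<Rightarrow> 'a set) \<Rightarrow>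
    (('o, 'a) path, 'o, 'o, 'k) gspan" where
  "Ts \<equiv> Ts_pow UNIV"

definition cut :: "(('o, 'a) path, ('o, 'a) path \<times> ('o, 'a) path, 'k::comm_ring_1) gmap" where
  "cut = (\<lambda>(X, ls). \<Sum>i\<le>length ls.
     unit_vec ((X, take i ls), (path_tgt (X, take i ls), drop i ls)))"

definition counit :: "(('o, 'a) path, unit, 'k::comm_ring_1) gmap" where
  "counit w = (if snd w = [] then unit_vec () else 0)"

definition pr1 :: "(('o, 'a) path, ('o, 'o, 'a) letter, 'k::comm_ring_1) gmap" where
  "pr1 w = (if length (snd w) = 1 then unit_vec (hd (snd w)) else 0)"

text \<open>The summand for \<open>i < j\<close> below is \<open>1\<^sup>\<otimes>\<^sup>r \<otimes> b\<^sub>n \<otimes> 1\<^sup>\<otimes>\<^sup>t\<close> with \<open>r = i\<close>, \<open>n = j - i\<close>; here \<open>b\<close> has degree 1.\<close>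

definition coder :: "(nat \<Rightarrow> (('o, 'a) path, ('o, 'o, 'a) letter, 'k::comm_ring_1) gmap) \<Rightarrow>
    (('o, 'a) path, ('o, 'a) path, 'k) gmap" where
  "coder b = (\<lambda>(X, ls). \<Sum>j\<le>length ls. \<Sum>i<j.
     fscale (ksgn (sum_list (map ldeg (drop j ls))))
       (lin (\<lambda>l. unit_vec (X, take i ls @ [l] @ drop j ls))
         (b (j - i) (path_tgt (X, take i ls), drop i (take j ls)))))"

definition ainf_category :: "('k::comm_ring_1 \<Rightarrow> 'a::ab_group_add \<Rightarrow> 'a) \<Rightarrow> 'o set \<Rightarrow>
    ('o \<Rightarrow> 'o \<Rightarrow> int \<Rightarrow> 'a set) \<Rightarrow>
    (nat \<Rightarrow> (('o, 'a) path, ('o, 'o, 'a) letter, 'k) gmap) \<Rightarrow> bool" where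
  "ainf_category sc Ob A b \<longleftrightarrow>
     graded_span sc Ob Ob A \<and>
     (\<forall>n\<ge>1. b n \<in> hom_maps (Ts_pow {n} sc Ob A) (susp sc Ob Ob A) id id 1) \<and>
     eq_on (gen (Ts sc Ob A)) (Ts sc Ob A) (coder b \<triangleright> coder b) 0"

definition opp :: "('o \<Rightarrow> 'o \<Rightarrow> int \<Rightarrow> 'a set) \<Rightarrow> 'o \<Rightarrow> 'o \<Rightarrow> int \<Rightarrow> 'a set" where
  "opp A X Y = A Y X"

fun flip_letter :: "('s, 't, 'a) letter \<Rightarrow> ('t, 's, 'a) letter" where
  "flip_letter (Letter X n x Y) = Letter Y n x X"

definition gam :: "(('o, 'a) path, ('o, 'a) path, 'k::comm_ring_1) gmap" where
  "gam = (\<lambda>(X, ls).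
     fscale (ksgn (int (length ls) + (\<Sum>j<length ls. \<Sum>i<j. ldeg (ls ! i) * ldeg (ls ! j))))
       (unit_vec (path_tgt (X, ls), rev (map flip_letter ls))))"

definition b_opp :: "(nat \<Rightarrow> (('o, 'a) path, ('o, 'o, 'a) letter, 'k::comm_ring_1) gmap) \<Rightarrow>
    (('o, 'a) path, ('o, 'a) path, 'k) gmap" where
  "b_opp b = gam \<triangleright> coder b \<triangleright> gam"


section \<open>The dg category of complexes\<close>

text \<open>
  The objects are the complexes whose components are submodules of a fixed ambient module.
  Maps on submodules are extended by zero to the ambient type, so that they are determined by their
  restriction and form a submodule of \<open>int \<Rightarrow> 'p \<Rightarrow> 'p\<close>.
\<close>

type_synonym 'p cpx = "(int \<Rightarrow> 'p set) \<times> (int \<Rightarrow> 'p \<Rightarrow> 'p)"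

definition gr_hom :: "('k::comm_ring_1 \<Rightarrow> 'p::ab_group_add \<Rightarrow> 'p) \<Rightarrow>
    (int \<Rightarrow> 'p set) \<Rightarrow> (int \<Rightarrow> 'p set) \<Rightarrow> int \<Rightarrow> (int \<Rightarrow> 'p \<Rightarrow> 'p) set" where
  "gr_hom sc M N n = {f. \<forall>i.
     (\<forall>x\<in>M i. f i x \<in> N (i + n)) \<and>
     (\<forall>x\<in>M i. \<forall>y\<in>M i. f i (x + y) = f i x + f i y) \<and>
     (\<forall>c. \<forall>x\<in>M i. f i (sc c x) = sc c (f i x)) \<and>
     (\<forall>x. x \<notin> M i \<longrightarrow> f i x = 0)}"

definition complexes :: "('k::comm_ring_1 \<Rightarrow> 'p::ab_group_add \<Rightarrow> 'p) \<Rightarrow> 'p cpx set" where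
  "complexes sc = {(M, d). (\<forall>i. module.subspace sc (M i)) \<and> d \<in> gr_hom sc M M 1 \<and>
     (\<forall>i. \<forall>x\<in>M i. d (i + 1) (d i x) = 0)}"

definition Ck :: "('k::comm_ring_1 \<Rightarrow> 'p::ab_group_add \<Rightarrow> 'p) \<Rightarrow>
    'p cpx \<Rightarrow> 'p cpx \<Rightarrow> int \<Rightarrow> (int \<Rightarrow> 'p \<Rightarrow> 'p) set" where
  "Ck sc M N n = gr_hom sc (fst M) (fst N) n"

definition hom_scale :: "('k \<Rightarrow> 'p \<Rightarrow> 'p) \<Rightarrow> 'k \<Rightarrow> (int \<Rightarrow> 'p \<Rightarrow> 'p) \<Rightarrow> (int \<Rightarrow> 'p \<Rightarrow> 'p)" where
  "hom_scale sc c f = (\<lambda>i x. sc c (f i x))"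

type_synonym 'p cletter = "('p cpx, 'p cpx, int \<Rightarrow> 'p \<Rightarrow> 'p) letter"

text \<open>Maps of complexes are also written on the right of their arguments: \<open>x (fg) = (x f) g\<close>.\<close>

fun Ck_m1 :: "('k::comm_ring_1 \<Rightarrow> 'p::ab_group_add \<Rightarrow> 'p) \<Rightarrow> ('p cletter, 'p cletter, 'k) gmap" where
  "Ck_m1 sc (Letter (M, dM) n f (N, dN)) =
     unit_vec (Letter (M, dM) (n + 1)
       (\<lambda>i x. dN (i + n) (f i x) - sc (ksgn n) (f (i + 1) (dM i x))) (N, dN))"

fun Ck_m2 :: "('p cletter \<times> 'p cletter, 'p cletter, 'k::comm_ring_1) gmap" where
  "Ck_m2 (Letter L n f M, Letter M' m g N) =
     unit_vec (Letter L (n + m) (\<lambda>i x. g (i + n) (f i x)) N)"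

definition Ck_b :: "('k::comm_ring_1 \<Rightarrow> 'p::ab_group_add \<Rightarrow> 'p) \<Rightarrow>
    nat \<Rightarrow> (('p cpx, int \<Rightarrow> 'p \<Rightarrow> 'p) path, 'p cletter, 'k) gmap" where
  "Ck_b sc n w =
     (if n = 1 then (s_inv \<triangleright> Ck_m1 sc \<triangleright> s_map) (snd w ! 0)
      else if n = 2 then (ss_inv \<triangleright> Ck_m2 \<triangleright> s_map) (snd w ! 0, snd w ! 1)
      else 0)"

abbreviation sCk :: "('k::comm_ring_1 \<Rightarrow> 'p::ab_group_add \<Rightarrow> 'p) \<Rightarrow>
    ('p cletter, 'p cpx, 'p cpx, 'k) gspan" where
  "sCk sc \<equiv> susp (hom_scale sc) (complexes sc) (complexes sc) (Ck sc)"

abbreviation TsCk :: "('k::comm_ring_1 \<Rightarrow> 'p::ab_group_add \<Rightarrow> 'p) \<Rightarrow>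
    (('p cpx, int \<Rightarrow> 'p \<Rightarrow> 'p) path, 'p cpx, 'p cpx, 'k) gspan" where
  "TsCk sc \<equiv> Ts (hom_scale sc) (complexes sc) (Ck sc)"


section \<open>Augmented coalgebra homomorphisms and \<open>A\<^sub>\<infinity>\<close>-functors of two arguments\<close>

definition box_deg :: "('o, 'a) path \<times> ('q, 'c) path \<Rightarrow> int" where
  "box_deg = (\<lambda>(w, v). path_deg w + path_deg v)"

definition box_cut :: "(('o, 'a) path \<times> ('q, 'c) path,
    (('o, 'a) path \<times> ('q, 'c) path) \<times> (('o, 'a) path \<times> ('q, 'c) path), 'k::comm_ring_1) gmap" where
  "box_cut = tmap path_deg 0 cut cut \<triangleright>
     (\<lambda>((w, w'), (v, v')). fscale (ksgn (path_deg w' * path_deg v)) (unit_vec ((w, v), (w', v'))))"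

definition box_counit :: "(('o, 'a) path \<times> ('q, 'c) path, unit, 'k::comm_ring_1) gmap" where
  "box_counit = tmap path_deg 0 counit counit \<triangleright> (\<lambda>_. unit_vec ())"

definition aug_coalg_hom :: "('k::comm_ring_1 \<Rightarrow> 'a::ab_group_add \<Rightarrow> 'a) \<Rightarrow> 'o set \<Rightarrow>
    ('o \<Rightarrow> 'o \<Rightarrow> int \<Rightarrow> 'a set) \<Rightarrow>
    ('k \<Rightarrow> 'c::ab_group_add \<Rightarrow> 'c) \<Rightarrow> 'q set \<Rightarrow> ('q \<Rightarrow> 'q \<Rightarrow> int \<Rightarrow> 'c set) \<Rightarrow>
    ('k \<Rightarrow> 'p::ab_group_add \<Rightarrow> 'p) \<Rightarrow> ('o \<times> 'q \<Rightarrow> 'p cpx) \<Rightarrow>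
    (('o, 'a) path \<times> ('q, 'c) path, ('p cpx, int \<Rightarrow> 'p \<Rightarrow> 'p) path, 'k) gmap \<Rightarrow> bool" where
  "aug_coalg_hom scA ObA A scC ObC C scP \<phi>0 \<phi> \<longleftrightarrow>
     (let B = box (Ts scA ObA (opp A)) (Ts scC ObC C) in
      \<phi>0 ` (ObA \<times> ObC) \<subseteq> complexes scP \<and>
      \<phi> \<in> hom_maps B (TsCk scP) \<phi>0 \<phi>0 0 \<and>
      eq_on (gen B) (tens (TsCk scP) (TsCk scP)) (\<phi> \<triangleright> cut) (box_cut \<triangleright> tmap box_deg 0 \<phi> \<phi>) \<and>
      (\<forall>w\<in>gen B. (\<phi> \<triangleright> counit) w = box_counit w) \<and>
      (\<forall>X\<in>ObA. \<forall>Z\<in>ObC. (\<phi> \<triangleright> pr1) ((X, []), (Z, [])) \<in> rels (sCk scP)))"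

definition ainf_functor :: "('k::comm_ring_1 \<Rightarrow> 'a::ab_group_add \<Rightarrow> 'a) \<Rightarrow> 'o set \<Rightarrow>
    ('o \<Rightarrow> 'o \<Rightarrow> int \<Rightarrow> 'a set) \<Rightarrow> (nat \<Rightarrow> (('o, 'a) path, ('o, 'o, 'a) letter, 'k) gmap) \<Rightarrow>
    ('k \<Rightarrow> 'c::ab_group_add \<Rightarrow> 'c) \<Rightarrow> 'q set \<Rightarrow>
    ('q \<Rightarrow> 'q \<Rightarrow> int \<Rightarrow> 'c set) \<Rightarrow> (nat \<Rightarrow> (('q, 'c) path, ('q, 'q, 'c) letter, 'k) gmap) \<Rightarrow>
    ('k \<Rightarrow> 'p::ab_group_add \<Rightarrow> 'p) \<Rightarrow> ('o \<times> 'q \<Rightarrow> 'p cpx) \<Rightarrow>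
    (('o, 'a) path \<times> ('q, 'c) path, ('p cpx, int \<Rightarrow> 'p \<Rightarrow> 'p) path, 'k) gmap \<Rightarrow> bool" where
  "ainf_functor scA ObA A bA scC ObC C bC scP \<phi>0 \<phi> \<longleftrightarrow>
     aug_coalg_hom scA ObA A scC ObC C scP \<phi>0 \<phi> \<and>
     eq_on (gen (box (Ts scA ObA (opp A)) (Ts scC ObC C))) (TsCk scP)
       (\<phi> \<triangleright> coder (Ck_b scP))
       ((tmap path_deg 1 (b_opp bA) idm + tmap path_deg 0 idm (coder bC)) \<triangleright> \<phi>)"


section \<open>Connections on \<open>TsA \<otimes> sP \<otimes> TsC\<close>\<close>

type_synonym ('o, 'a, 'p, 'q, 'c) bipath = "('o, 'a) path \<times> ('o, 'q, 'p) letter \<times> ('q, 'c) path"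

definition bicom :: "('k \<Rightarrow> 'a::plus \<Rightarrow> 'a) \<Rightarrow> 'o set \<Rightarrow> ('o \<Rightarrow> 'o \<Rightarrow> int \<Rightarrow> 'a set) \<Rightarrow>
    ('k \<Rightarrow> 'c::plus \<Rightarrow> 'c) \<Rightarrow> 'q set \<Rightarrow> ('q \<Rightarrow> 'q \<Rightarrow> int \<Rightarrow> 'c set) \<Rightarrow>
    ('k \<Rightarrow> 'p::plus \<Rightarrow> 'p) \<Rightarrow> ('o \<Rightarrow> 'q \<Rightarrow> int \<Rightarrow> 'p set) \<Rightarrow>
    (('o, 'a, 'p, 'q, 'c) bipath, 'o, 'q, 'k) gspan" where
  "bicom scA ObA A scC ObC C scP P =
     tens (Ts scA ObA A) (tens (susp scP ObA ObC P) (Ts scC ObC C))"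

definition tail_deg :: "('o, 'q, 'p) letter \<times> ('q, 'c) path \<Rightarrow> int" where
  "tail_deg = (\<lambda>(p, v). ldeg p + path_deg v)"

definition bipath_deg :: "('o, 'a, 'p, 'q, 'c) bipath \<Rightarrow> int" where
  "bipath_deg = (\<lambda>(w, p, v). path_deg w + ldeg p + path_deg v)"

definition coact_left :: "(('o, 'a, 'p, 'q, 'c) bipath,
    ('o, 'a) path \<times> ('o, 'a, 'p, 'q, 'c) bipath, 'k::comm_ring_1) gmap" where
  "coact_left = tmap tail_deg 0 cut idm \<triangleright> (\<lambda>((w, w'), pv). unit_vec (w, (w', pv)))"

definition coact_right :: "(('o, 'a, 'p, 'q, 'c) bipath,
    ('o, 'a, 'p, 'q, 'c) bipath \<times> ('q, 'c) path, 'k::comm_ring_1) gmap" where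
  "coact_right = tmap tail_deg 0 idm (tmap path_deg 0 idm cut) \<triangleright>
     (\<lambda>(w, (p, (v, v'))). unit_vec ((w, (p, v)), v'))"

text \<open>\<open>(1,1,1,b\<^sup>A,b\<^sup>C)\<close>-connections of degree 1.\<close>

definition connection :: "('k::comm_ring_1 \<Rightarrow> 'a::ab_group_add \<Rightarrow> 'a) \<Rightarrow> 'o set \<Rightarrow>
    ('o \<Rightarrow> 'o \<Rightarrow> int \<Rightarrow> 'a set) \<Rightarrow> (nat \<Rightarrow> (('o, 'a) path, ('o, 'o, 'a) letter, 'k) gmap) \<Rightarrow>
    ('k \<Rightarrow> 'c::ab_group_add \<Rightarrow> 'c) \<Rightarrow> 'q set \<Rightarrow>
    ('q \<Rightarrow> 'q \<Rightarrow> int \<Rightarrow> 'c set) \<Rightarrow> (nat \<Rightarrow> (('q, 'c) path, ('q, 'q, 'c) letter, 'k) gmap) \<Rightarrow>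
    ('k \<Rightarrow> 'p::ab_group_add \<Rightarrow> 'p) \<Rightarrow> ('o \<Rightarrow> 'q \<Rightarrow> int \<Rightarrow> 'p set) \<Rightarrow>
    (('o, 'a, 'p, 'q, 'c) bipath, ('o, 'a, 'p, 'q, 'c) bipath, 'k) gmap \<Rightarrow> bool" where
  "connection scA ObA A bA scC ObC C bC scP P bP \<longleftrightarrow>
     (let S = bicom scA ObA A scC ObC C scP P in
      bP \<in> hom_maps S S id id 1 \<and>
      eq_on (gen S) (tens (Ts scA ObA A) S)
        (bP \<triangleright> coact_left)
        (coact_left \<triangleright> (tmap bipath_deg 0 idm bP + tmap bipath_deg 1 (coder bA) idm)) \<and>
      eq_on (gen S) (tens S (Ts scC ObC C))
        (bP \<triangleright> coact_right)
        (coact_right \<triangleright> (tmap path_deg 0 idm (coder bC) + tmap path_deg 1 bP idm)))"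

definition flat :: "('k::comm_ring_1 \<Rightarrow> 'a::ab_group_add \<Rightarrow> 'a) \<Rightarrow> 'o set \<Rightarrow>
    ('o \<Rightarrow> 'o \<Rightarrow> int \<Rightarrow> 'a set) \<Rightarrow>
    ('k \<Rightarrow> 'c::ab_group_add \<Rightarrow> 'c) \<Rightarrow> 'q set \<Rightarrow> ('q \<Rightarrow> 'q \<Rightarrow> int \<Rightarrow> 'c set) \<Rightarrow>
    ('k \<Rightarrow> 'p::ab_group_add \<Rightarrow> 'p) \<Rightarrow> ('o \<Rightarrow> 'q \<Rightarrow> int \<Rightarrow> 'p set) \<Rightarrow>
    (('o, 'a, 'p, 'q, 'c) bipath, ('o, 'a, 'p, 'q, 'c) bipath, 'k) gmap \<Rightarrow> bool" where
  "flat scA ObA A scC ObC C scP P bP \<longleftrightarrow>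
     (let S = bicom scA ObA A scC ObC C scP P in eq_on (gen S) S (bP \<triangleright> bP) 0)"

text \<open>\<open>pr\<^sub>0 \<otimes> 1 \<otimes> pr\<^sub>0\<close>, with values in \<open>T\<^sup>0sA \<otimes> sP \<otimes> T\<^sup>0sC = sP\<close>.\<close>

definition pr010 :: "(('o, 'a, 'p, 'q, 'c) bipath, ('o, 'q, 'p) letter, 'k::comm_ring_1) gmap" where
  "pr010 = (\<lambda>(w, p, v). if snd w = [] \<and> snd v = [] then unit_vec p else 0)"

text \<open>The components \<open>b\<^sup>P\<^sub>k\<^sub>n\<close> are the restrictions of \<open>bP \<triangleright> pr010\<close> to \<open>T\<^sup>ksA \<otimes> sP \<otimes> T\<^sup>nsC\<close>.\<close>

definition b00 :: "(('o, 'a, 'p, 'q, 'c) bipath, ('o, 'a, 'p, 'q, 'c) bipath, 'k::comm_ring_1) gmap \<Rightarrow>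
    (('o, 'q, 'p) letter, ('o, 'q, 'p) letter, 'k) gmap" where
  "b00 bP l = (bP \<triangleright> pr010) ((lsrc l, []), l, (ltgt l, []))"


section \<open>The correspondence between connections and coalgebra homomorphisms\<close>

definition dP :: "('k::comm_ring_1 \<Rightarrow> 'p::ab_group_add \<Rightarrow> 'p) \<Rightarrow> ('o \<Rightarrow> 'q \<Rightarrow> int \<Rightarrow> 'p set) \<Rightarrow>
    (('o, 'a, 'p, 'q, 'c) bipath, ('o, 'a, 'p, 'q, 'c) bipath, 'k) gmap \<Rightarrow>
    'o \<Rightarrow> 'q \<Rightarrow> int \<Rightarrow> 'p \<Rightarrow> 'p" where
  "dP scP P bP X Z = (\<lambda>i x. if x \<in> P X Z i
     then realize scP ((s_map \<triangleright> b00 bP \<triangleright> s_inv) (Letter X i x Z)) else 0)"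

text \<open>The evaluation \<open>P(X,Z) \<otimes> Ck(P(X,Z), P(Y,W)) \<rightarrow> P(Y,W)\<close>. As distinct objects may be
  sent to the same complex, \<open>Y\<close> and \<open>W\<close> are given explicitly.\<close>

fun evm :: "'o \<Rightarrow> 'q \<Rightarrow>
    (('o, 'q, 'p) letter \<times> 'p cletter, ('o, 'q, 'p) letter, 'k::comm_ring_1) gmap" where
  "evm Y W (Letter X n x Z, Letter M m f N) = unit_vec (Letter Y (n + m) (f n x) W)"

definition c_map :: "(('o, 'a, 'p, 'q, 'c) bipath,
    ('o, 'q, 'p) letter \<times> ('o, 'a) path \<times> ('q, 'c) path, 'k::comm_ring_1) gmap" where
  "c_map = (\<lambda>(w, p, v). fscale (ksgn (path_deg w * ldeg p)) (unit_vec (p, w, v)))"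

definition conn_of_hom ::
    "(('o, 'a) path \<times> ('q, 'c) path, ('p cpx, int \<Rightarrow> 'p \<Rightarrow> 'p) path, 'k::comm_ring_1) gmap \<Rightarrow>
    (('o, 'a, 'p, 'q, 'c) bipath, ('o, 'q, 'p) letter, 'k) gmap" where
  "conn_of_hom \<phi> u = (case u of (w, p, v) \<Rightarrow>
     (c_map \<triangleright> tmap box_deg 0 idm (tmap path_deg 0 gam idm) \<triangleright>
      tmap box_deg 0 idm (\<phi> \<triangleright> pr1) \<triangleright> ss_inv \<triangleright> evm (fst w) (path_tgt v) \<triangleright> s_map) u)"

definition corresponds :: "('k::comm_ring_1 \<Rightarrow> 'a::ab_group_add \<Rightarrow> 'a) \<Rightarrow> 'o set \<Rightarrow>
    ('o \<Rightarrow> 'o \<Rightarrow> int \<Rightarrow> 'a set) \<Rightarrow>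
    ('k \<Rightarrow> 'c::ab_group_add \<Rightarrow> 'c) \<Rightarrow> 'q set \<Rightarrow> ('q \<Rightarrow> 'q \<Rightarrow> int \<Rightarrow> 'c set) \<Rightarrow>
    ('k \<Rightarrow> 'p::ab_group_add \<Rightarrow> 'p) \<Rightarrow> ('o \<Rightarrow> 'q \<Rightarrow> int \<Rightarrow> 'p set) \<Rightarrow>
    (('o, 'a, 'p, 'q, 'c) bipath, ('o, 'a, 'p, 'q, 'c) bipath, 'k) gmap \<Rightarrow>
    ('o \<times> 'q \<Rightarrow> 'p cpx) \<Rightarrow>
    (('o, 'a) path \<times> ('q, 'c) path, ('p cpx, int \<Rightarrow> 'p \<Rightarrow> 'p) path, 'k) gmap \<Rightarrow> bool" where
  "corresponds scA ObA A scC ObC C scP P bP \<phi>0 \<phi> \<longleftrightarrow>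
     (\<forall>X\<in>ObA. \<forall>Z\<in>ObC. \<phi>0 (X, Z) = (P X Z, dP scP P bP X Z)) \<and>
     eq_on {(w, p, v) \<in> gen (bicom scA ObA A scC ObC C scP P). (length (snd w), length (snd v)) \<noteq> (0, 0)}
       (susp scP ObA ObC P) (bP \<triangleright> pr010) (conn_of_hom \<phi>)"

end

theory Submission
  imports Defs
begin

text \<open>
  A map \<open>D\<close> compatible with the two coactions of \<open>TsA \<otimes> sP \<otimes> TsC\<close> is recovered from \<open>D (pr\<^sub>0 \<otimes> 1 \<otimes> pr\<^sub>0)\<close>,
  and the square of a connection is again compatible with them, because \<open>b\<^sup>A\<close> and \<open>b\<^sup>C\<close> square to zero.
  Hence flatness can be tested on the components of \<open>(b\<^sup>P)\<^sup>2\<close>. Dually, \<open>\<xi> = \<phi>b - (b\<^sup>o\<^sup>p \<boxtimes> 1 + 1 \<boxtimes> b)\<phi>\<close> is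
  a \<open>(\<phi>,\<phi>)\<close>-coderivation, and therefore vanishes as soon as \<open>\<xi> pr\<^sub>1\<close> does. Under the adjunction
  defining the correspondence, the components of \<open>(b\<^sup>P)\<^sup>2\<close> become, up to sign, those of \<open>\<xi>\<close>: the terms with
  one factor \<open>b\<^sup>P\<^sub>0\<^sub>0\<close> give \<open>m\<^sub>1\<close>, the terms with two factors \<open>b\<^sup>P\<^sub>k\<^sub>n\<close>, \<open>(k,n) \<noteq> (0,0)\<close>, give \<open>m\<^sub>2\<close>, and the terms
  with \<open>b\<^sup>A\<close> and \<open>b\<^sup>C\<close> give the differential of the source. To avoid \<open>A\<^sup>o\<^sup>p\<close>, \<open>\<phi>\<close> is precomposed with \<open>\<gamma>\<close>.
\<close>

section \<open>Linear extension and congruence modulo relations\<close>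

text \<open>All modules are quotients of free modules on pure tensors, so every map given on
  generators must be shown to respect the relations, and equations hold only modulo
  \<open>rels\<close>. The obstacle is that a relation may be tensored with a generator only where
  their end objects match; hence the bookkeeping with \<open>homog\<close>, which constrains
  representatives and not just their classes. Both reductions to components use a one-sided inverse
  of a comultiplication: grafting for the coactions, and splitting off the first letter for the cut
  of \<open>TsCk\<close>. Grafting recovers the square of the connection at once. Splitting off a
  letter expresses \<open>\<xi>\<close> through itself at smaller arguments, so an induction on path
  lengths is needed; the only term whose arguments do not shrink is killed by
  \<open>\<phi>\<^sub>0\<^sub>0 = 0\<close>. The final comparison is made in honest modules:
  \<open>realize\<close> evaluates representatives and is injective on homogeneous classes. The two
  sides then differ by one invertible sign \<open>\<rho>\<close>, and the letters from
  \<open>P\<close> are numerous enough to test a graded map at every element.\<close>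

abbreviation keys :: "('w \<Rightarrow>\<^sub>0 'k::zero) \<Rightarrow> 'w set" where
  "keys \<equiv> Poly_Mapping.keys"

lemmas fscale_right_distrib = free_module.scale_right_distrib
  and fscale_right_diff_distrib = free_module.scale_right_diff_distrib
  and fscale_sum_right = free_module.scale_sum_right
  and fscale_fscale = free_module.scale_scale

text \<open>Values lie in an arbitrary module: \<open>lin\<close> (into a free module) and
  \<open>realize\<close> (into the ambient module of a span) are both instances, so the calculus of
  linear extensions is developed once.\<close>

definition lext :: "('k::comm_ring_1 \<Rightarrow> 'b::ab_group_add \<Rightarrow> 'b) \<Rightarrow> ('w \<Rightarrow> 'b) \<Rightarrow> ('w \<Rightarrow>\<^sub>0 'k) \<Rightarrow> 'b" where
  "lext sc h p = (\<Sum>w\<in>keys p. sc (Poly_Mapping.lookup p w) (h w))"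

lemma lin_eq_lext: "lin f = lext fscale f"
  by (simp add: lin_def lext_def fun_eq_iff)

lemma realize_eq_lext: "realize sc = lext sc lelt"
  by (simp add: realize_def lext_def fun_eq_iff)

text \<open>The two kinds of relations are treated at once: \<open>comb_rel S c d u v w\<close> is the relation
  \<open>w = c u + d v\<close>, where \<open>c = d = 1\<close> for additivity and \<open>d = 0\<close> for homogeneity.\<close>

definition comb_rel :: "('w, 's, 't, 'k::comm_ring_1) gspan \<Rightarrow> 'k \<Rightarrow> 'k \<Rightarrow> 'w \<Rightarrow> 'w \<Rightarrow> 'w \<Rightarrow> bool" where
  "comb_rel S c d u v w \<longleftrightarrow> padd S u v w \<and> c = 1 \<and> d = 1 \<or> pscl S c u w \<and> d = 0 \<and> v = u"

context module
begin

lemma lext_superset: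
  assumes "finite W" "keys p \<subseteq> W"
  shows "lext scale h p = (\<Sum>w\<in>W. scale (Poly_Mapping.lookup p w) (h w))"
  unfolding lext_def
  by (rule sum.mono_neutral_left[OF assms]) (auto simp: in_keys_iff)

lemma lext_add: "lext scale h (p + q) = lext scale h p + lext scale h q"
proof -
  let ?W = "keys p \<union> keys q"
  have "keys (p + q) \<subseteq> ?W" by (rule Poly_Mapping.keys_add)
  then show ?thesis
    by (simp add: lext_superset[of ?W] lookup_add scale_left_distrib sum.distrib)
qed

lemma lext_zero [simp]: "lext scale h 0 = 0"
  by (simp add: lext_def)

lemma lext_fscale: "lext scale h (fscale c p) = scale c (lext scale h p)"
proof -
  have "keys (fscale c p) \<subseteq> keys p"
    by (auto simp: in_keys_iff)
  then show ?thesis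
    by (simp add: lext_superset[of "keys p"] scale_sum_right)
qed

lemma lext_minus: "lext scale h (- p) = - lext scale h p"
  using lext_add[of h p "- p"] by (simp add: eq_neg_iff_add_eq_0 add.commute)

lemma lext_diff: "lext scale h (p - q) = lext scale h p - lext scale h q"
  using lext_add[of h p "- q"] by (simp add: lext_minus)

lemma lext_sum: "lext scale h (\<Sum>i\<in>I. p i) = (\<Sum>i\<in>I. lext scale h (p i))"
  by (induction I rule: infinite_finite_induct) (auto simp: lext_add)

lemma lext_single: "lext scale h (Poly_Mapping.single w c) = scale c (h w)"
  by (simp add: lext_def)

lemma lext_unit [simp]: "lext scale h (unit_vec w) = h w"
  by (simp add: lext_single)

lemma lext_cong:
  assumes "\<And>w. w \<in> keys p \<Longrightarrow> h w = h' w"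
  shows "lext scale h p = lext scale h' p"
  unfolding lext_def using assms by (simp cong: sum.cong)

lemma lext_lin: "lext scale h (lin f p) = lext scale (\<lambda>w. lext scale h (f w)) p"
  by (simp add: lin_def lext_sum lext_fscale) (simp add: lext_def)

lemma lext_fun_add: "lext scale (\<lambda>w. h w + h' w) p = lext scale h p + lext scale h' p"
  by (simp add: lext_def scale_right_distrib sum.distrib)

lemma lext_fun_zero [simp]: "lext scale (\<lambda>w. 0) p = 0"
  by (simp add: lext_def)

lemma lext_fun_diff: "lext scale (\<lambda>w. h w - h' w) p = lext scale h p - lext scale h' p"
  by (simp add: lext_def scale_right_diff_distrib sum_subtractf)

lemma lext_fun_scale: "lext scale (\<lambda>w. scale c (h w)) p = scale c (lext scale h p)"
  by (simp add: lext_def scale_sum_right mult.commute)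

lemma lext_fun_sum: "lext scale (\<lambda>w. \<Sum>i\<in>I. h i w) p = (\<Sum>i\<in>I. lext scale (h i) p)"
  by (induction I rule: infinite_finite_induct) (auto simp: lext_fun_add)

lemma lext_swap:
  "lext scale (\<lambda>w. lext scale (\<lambda>v. h w v) q) p = lext scale (\<lambda>v. lext scale (\<lambda>w. h w v) p) q"
  by (simp add: lext_def scale_sum_right mult.commute) (rule sum.swap)

lemma lext_mem:
  assumes "subspace U" "\<And>w. w \<in> keys p \<Longrightarrow> h w \<in> U"
  shows "lext scale h p \<in> U"
  unfolding lext_def by (intro subspace_sum subspace_scale assms)

text \<open>The universal property of the quotient. A general submodule \<open>U\<close> serves two
  purposes: \<open>U = rels T\<close> for maps between presented modules, \<open>U = {0}\<close> for
  evaluations in an actual module.\<close>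

lemma lext_rels:
  assumes U: "subspace U"
    and rel: "\<And>c d u v w. u \<in> gen S \<Longrightarrow> v \<in> gen S \<Longrightarrow> w \<in> gen S \<Longrightarrow> comb_rel S c d u v w \<Longrightarrow>
      h w - scale c (h u) - scale d (h v) \<in> U"
    and r: "r \<in> rels S"
  shows "lext scale h r \<in> U"
  using r unfolding rels_def
proof (induction rule: free_module.span_induct_alt)
  case base
  then show ?case by (simp add: subspace_0[OF U])
next
  case (step c x y)
  have "lext scale h x \<in> U"
    using step(1) rel[of _ _ _ 1 1] rel[of _ _ _ _ 0] by (auto simp: comb_rel_def lext_diff lext_fscale)
  then show ?case using step(2) by (simp add: lext_add lext_fscale subspace_add subspace_scale U)
qed

end

lemmas lin_add = free_module.lext_add[folded lin_eq_lext]
  and lin_zero [simp] = free_module.lext_zero[folded lin_eq_lext]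
  and lin_fscale = free_module.lext_fscale[folded lin_eq_lext]
  and lin_minus = free_module.lext_minus[folded lin_eq_lext]
  and lin_diff = free_module.lext_diff[folded lin_eq_lext]
  and lin_sum = free_module.lext_sum[folded lin_eq_lext]
  and lin_unit [simp] = free_module.lext_unit[folded lin_eq_lext]
  and lin_cong = free_module.lext_cong[folded lin_eq_lext]
  and lin_lin = free_module.lext_lin[folded lin_eq_lext]
  and lin_fun_add = free_module.lext_fun_add[folded lin_eq_lext]
  and lin_fun_zero [simp] = free_module.lext_fun_zero[folded lin_eq_lext]
  and lin_fun_diff = free_module.lext_fun_diff[folded lin_eq_lext]
  and lin_fun_scale = free_module.lext_fun_scale[folded lin_eq_lext]
  and lin_fun_sum = free_module.lext_fun_sum[folded lin_eq_lext]
  and lin_swap = free_module.lext_swap[folded lin_eq_lext]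

lemma lin_idm [simp]: "lin idm p = p"
proof (rule poly_mapping_eqI)
  fix v
  have "Poly_Mapping.lookup (lin idm p) v =
      (\<Sum>w\<in>keys p. if w = v then Poly_Mapping.lookup p v else 0)"
    unfolding lin_def lookup_sum by (rule sum.cong) (auto simp: lookup_single when_def)
  also have "\<dots> = Poly_Mapping.lookup p v"
    by (simp add: in_keys_iff)
  finally show "Poly_Mapping.lookup (lin idm p) v = Poly_Mapping.lookup p v" .
qed

lemma subspace_rels [simp]: "free_module.subspace (rels S)"
  by (simp add: rels_def)

lemma padd_rels:
  "\<lbrakk>u \<in> gen S; v \<in> gen S; w \<in> gen S; padd S u v w\<rbrakk> \<Longrightarrow> unit_vec w - unit_vec u - unit_vec v \<in> rels S"
  unfolding rels_def by (rule free_module.span_base) blast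

lemma pscl_rels:
  "\<lbrakk>u \<in> gen S; w \<in> gen S; pscl S c u w\<rbrakk> \<Longrightarrow> unit_vec w - fscale c (unit_vec u) \<in> rels S"
  unfolding rels_def by (rule free_module.span_base) blast

lemma comb_rel_rels:
  "\<lbrakk>u \<in> gen S; v \<in> gen S; w \<in> gen S; comb_rel S c d u v w\<rbrakk> \<Longrightarrow>
    unit_vec w - fscale c (unit_vec u) - fscale d (unit_vec v) \<in> rels S"
  using padd_rels[of u S v w] pscl_rels[of u S w c] by (auto simp: comb_rel_def)

lemmas rels_add = free_module.subspace_add[OF subspace_rels]
  and rels_scale = free_module.subspace_scale[OF subspace_rels]
  and rels_sum = free_module.subspace_sum[OF subspace_rels]

definition eqv :: "('w, 's, 't, 'k::comm_ring_1) gspan \<Rightarrow> ('w \<Rightarrow>\<^sub>0 'k) \<Rightarrow> ('w \<Rightarrow>\<^sub>0 'k) \<Rightarrow> bool" where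
  "eqv S p q \<longleftrightarrow> p - q \<in> rels S"

lemma rels_0 [simp]: "0 \<in> rels S"
  by (simp add: free_module.subspace_0)

lemma eqv_refl [simp]: "eqv S p p"
  by (simp add: eqv_def)

lemma eqv_sym: "eqv S p q \<Longrightarrow> eqv S q p"
  unfolding eqv_def using free_module.subspace_neg[OF subspace_rels] by fastforce

lemma eqv_trans [trans]: "eqv S p q \<Longrightarrow> eqv S q r \<Longrightarrow> eqv S p r"
  unfolding eqv_def using free_module.subspace_add[OF subspace_rels] by fastforce

lemma eqv_add: "eqv S p q \<Longrightarrow> eqv S p' q' \<Longrightarrow> eqv S (p + p') (q + q')"
  unfolding eqv_def using free_module.subspace_add[OF subspace_rels, of "p - q" _ "p' - q'"]
  by (simp add: algebra_simps)

lemma eqv_diff: "eqv S p q \<Longrightarrow> eqv S p' q' \<Longrightarrow> eqv S (p - p') (q - q')"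
  unfolding eqv_def using free_module.subspace_diff[OF subspace_rels, of "p - q" _ "p' - q'"]
  by (simp add: algebra_simps)

lemma eqv_fscale: "eqv S p q \<Longrightarrow> eqv S (fscale c p) (fscale c q)"
  unfolding eqv_def using free_module.subspace_scale[OF subspace_rels, of "p - q"]
  by (simp add: fscale_right_diff_distrib)

lemma eqv_sum: "(\<And>i. i \<in> I \<Longrightarrow> eqv S (p i) (q i)) \<Longrightarrow> eqv S (sum p I) (sum q I)"
  unfolding eqv_def by (simp add: sum_subtractf[symmetric] free_module.subspace_sum)

lemma eqv_0_iff: "eqv S p 0 \<longleftrightarrow> p \<in> rels S"
  by (simp add: eqv_def)

lemma eqv_rels_iff: "eqv S p q \<Longrightarrow> p \<in> rels S \<longleftrightarrow> q \<in> rels S"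
  by (metis eqv_0_iff eqv_sym eqv_trans)

lemma eqv_lin_cong:
  assumes "\<And>w. w \<in> keys p \<Longrightarrow> eqv S (f w) (g w)"
  shows "eqv S (lin f p) (lin g p)"
  unfolding lin_def by (intro eqv_sum eqv_fscale assms)

lemma eqv_lin:
  assumes "eqv S p q" "\<And>r. r \<in> rels S \<Longrightarrow> lin f r \<in> rels T"
  shows "eqv T (lin f p) (lin f q)"
  using assms unfolding eqv_def by (metis lin_diff)

lemma lin_rels:
  assumes "\<And>c d u v w. u \<in> gen S \<Longrightarrow> v \<in> gen S \<Longrightarrow> w \<in> gen S \<Longrightarrow> comb_rel S c d u v w \<Longrightarrow>
      f w - fscale c (f u) - fscale d (f v) \<in> rels T"
    and "r \<in> rels S"
  shows "lin f r \<in> rels T"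
  unfolding lin_eq_lext by (rule free_module.lext_rels[OF subspace_rels assms])

lemma lin_mem_rels:
  assumes "\<And>w. w \<in> keys p \<Longrightarrow> f w \<in> rels T"
  shows "lin f p \<in> rels T"
  unfolding lin_eq_lext by (rule free_module.lext_mem[OF subspace_rels assms])

lemma keys_lin: "keys (lin f p) \<subseteq> (\<Union>w\<in>keys p. keys (f w))"
proof
  fix v assume "v \<in> keys (lin f p)"
  then have "(\<Sum>w\<in>keys p. Poly_Mapping.lookup p w * Poly_Mapping.lookup (f w) v) \<noteq> 0"
    by (simp add: in_keys_iff lin_def lookup_sum)
  then obtain w where "w \<in> keys p" "Poly_Mapping.lookup p w * Poly_Mapping.lookup (f w) v \<noteq> 0"
    by (meson sum.neutral)
  then show "v \<in> (\<Union>w\<in>keys p. keys (f w))"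
    by (auto simp: in_keys_iff intro!: bexI[of _ w])
qed

lemma keys_fscale: "keys (fscale c p) \<subseteq> keys p"
  by (auto simp: in_keys_iff)

text \<open>A condition on the representative, not on its class: a relation could be added that
  involves other objects. Tensoring and grafting below depend on the ends of all generators that
  actually occur.\<close>

definition homog :: "('w, 's, 't, 'k::comm_ring_1) gspan \<Rightarrow> 's \<Rightarrow> 't \<Rightarrow> int \<Rightarrow> ('w \<Rightarrow>\<^sub>0 'k) \<Rightarrow> bool" where
  "homog T X Y d q \<longleftrightarrow>
     (\<forall>v\<in>keys q. v \<in> gen T \<and> src T v = X \<and> tgt T v = Y \<and> dgr T v = d)"

lemma homogD:
  assumes "homog T X Y d q" "v \<in> keys q"
  shows "v \<in> gen T" "src T v = X" "tgt T v = Y" "dgr T v = d"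
  using assms by (auto simp: homog_def)

lemma homog_zero [simp]: "homog T X Y d 0"
  by (simp add: homog_def)

lemma homog_add: "homog T X Y d p \<Longrightarrow> homog T X Y d q \<Longrightarrow> homog T X Y d (p + q)"
  using Poly_Mapping.keys_add[of p q] unfolding homog_def by blast

lemma homog_fscale: "homog T X Y d p \<Longrightarrow> homog T X Y d (fscale c p)"
  using keys_fscale[of c p] unfolding homog_def by blast

lemma homog_diff: "homog T X Y d p \<Longrightarrow> homog T X Y d q \<Longrightarrow> homog T X Y d (p - q)"
  using keys_diff[of p q] unfolding homog_def by blast

lemma homog_sum: "(\<And>i. i \<in> I \<Longrightarrow> homog T X Y d (p i)) \<Longrightarrow> homog T X Y d (sum p I)"
  by (induction I rule: infinite_finite_induct) (auto intro: homog_add)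

lemma homog_unit: "w \<in> gen T \<Longrightarrow> homog T (src T w) (tgt T w) (dgr T w) (unit_vec w)"
  by (simp add: homog_def)

lemma homog_lin:
  assumes "\<And>w. w \<in> keys p \<Longrightarrow> homog T X Y d (f w)"
  shows "homog T X Y d (lin f p)"
  unfolding homog_def
proof
  fix v assume "v \<in> keys (lin f p)"
  then obtain w where "w \<in> keys p" "v \<in> keys (f w)"
    using keys_lin[of f p] by fast
  then show "v \<in> gen T \<and> src T v = X \<and> tgt T v = Y \<and> dgr T v = d"
    using homogD[OF assms] by simp
qed

lemma hom_maps_homog:
  assumes "f \<in> hom_maps S T fs ft e" "w \<in> gen S"
  shows "homog T (fs (src S w)) (ft (tgt S w)) (dgr S w + e) (f w)"
  using assms unfolding hom_maps_def homog_def by simp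

lemma hom_maps_homog_lin:
  assumes "f \<in> hom_maps S T fs ft e" "homog S X Y d p"
  shows "homog T (fs X) (ft Y) (d + e) (lin f p)"
proof (rule homog_lin)
  fix w assume w: "w \<in> keys p"
  show "homog T (fs X) (ft Y) (d + e) (f w)"
    using hom_maps_homog[OF assms(1) homogD(1)[OF assms(2) w]] homogD(2-4)[OF assms(2) w] by simp
qed

lemma hom_maps_rels: "f \<in> hom_maps S T fs ft e \<Longrightarrow> r \<in> rels S \<Longrightarrow> lin f r \<in> rels T"
  by (simp add: hom_maps_def)

lemma ksgn_add: "ksgn (a + b) = ksgn a * (ksgn b :: 'k::comm_ring_1)"
  by (simp add: ksgn_def)

lemma ksgn_cong: "even a \<longleftrightarrow> even b \<Longrightarrow> ksgn a = (ksgn b :: 'k::comm_ring_1)"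
  by (simp add: ksgn_def)

lemma ksgn_0 [simp]: "ksgn 0 = (1 :: 'k::comm_ring_1)"
  by (simp add: ksgn_def)

lemma ksgn_square [simp]: "ksgn a * ksgn a = (1 :: 'k::comm_ring_1)"
  by (simp add: ksgn_def)


section \<open>Tensor products\<close>

text \<open>Guarantees that discarding all generators with the wrong ends turns a relation into a
  relation, and that Koszul signs are constant along a relation.\<close>

definition homogeneous_rels :: "('w, 's, 't, 'k::comm_ring_1) gspan \<Rightarrow> bool" where
  "homogeneous_rels S \<longleftrightarrow> (\<forall>c d u v w. comb_rel S c d u v w \<longrightarrow>
     src S u = src S w \<and> tgt S u = tgt S w \<and> dgr S u = dgr S w \<and>
     src S v = src S w \<and> tgt S v = tgt S w \<and> dgr S v = dgr S w)"

lemma homogeneous_relsD: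
  assumes "homogeneous_rels S" "comb_rel S c d u v w"
  shows "src S u = src S w" "tgt S u = tgt S w" "dgr S u = dgr S w"
    "src S v = src S w" "tgt S v = tgt S w" "dgr S v = dgr S w"
  using assms unfolding homogeneous_rels_def by blast+

lemma gen_tens: "gen (tens S T) = {(w, v). w \<in> gen S \<and> v \<in> gen T \<and> tgt S w = src T v}"
  by (simp add: tens_def)

lemma tens_sel [simp]:
  "src (tens S T) (w, v) = src S w" "tgt (tens S T) (w, v) = tgt T v"
  "dgr (tens S T) (w, v) = dgr S w + dgr T v"
  by (simp_all add: tens_def)

lemma comb_rel_tens:
  "comb_rel (tens S T) c d (u, u') (v, v') (w, w') \<longleftrightarrow>
     comb_rel S c d u v w \<and> u' = w' \<and> v' = w' \<or> u = w \<and> v = w \<and> comb_rel T c d u' v' w'"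
  by (auto simp: comb_rel_def tens_def padd_pair_def pscl_pair_def)

lemma homogeneous_rels_tens:
  assumes "homogeneous_rels S" "homogeneous_rels T"
  shows "homogeneous_rels (tens S T)"
  unfolding homogeneous_rels_def
proof (intro allI impI)
  fix c d x y z assume r: "comb_rel (tens S T) c d x y z"
  obtain u u' v v' w w' where [simp]: "x = (u, u')" "y = (v, v')" "z = (w, w')" by (metis surj_pair)
  from r consider "comb_rel S c d u v w" "u' = w'" "v' = w'" | "u = w" "v = w" "comb_rel T c d u' v' w'"
    by (auto simp: comb_rel_tens)
  then show "src (tens S T) x = src (tens S T) z \<and> tgt (tens S T) x = tgt (tens S T) z \<and>
      dgr (tens S T) x = dgr (tens S T) z \<and> src (tens S T) y = src (tens S T) z \<and>
      tgt (tens S T) y = tgt (tens S T) z \<and> dgr (tens S T) y = dgr (tens S T) z"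
    by cases (auto dest: homogeneous_relsD[OF assms(1)] homogeneous_relsD[OF assms(2)])
qed

lemma ftens_eq_lin:
  fixes p :: "'a \<Rightarrow>\<^sub>0 'c::comm_ring_1" and q :: "'b \<Rightarrow>\<^sub>0 'c"
  shows "ftens p q = lin (\<lambda>w. lin (\<lambda>v. unit_vec (w, v)) q) p"
proof -
  have "Poly_Mapping.single (w, v) (c * d) = fscale c (fscale d (unit_vec (w, v)))"
    for w :: 'a and v :: 'b and c d :: 'c
    by (rule poly_mapping_eqI) (simp add: lookup_single when_def)
  then show ?thesis
    by (simp add: ftens_def lin_def fscale_sum_right)
qed

lemma ftens_unit_left: "ftens (unit_vec w) q = lin (\<lambda>v. unit_vec (w, v)) q"
  by (simp add: ftens_eq_lin)

lemma ftens_unit_right: "ftens p (unit_vec v) = lin (\<lambda>w. unit_vec (w, v)) p"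
  by (simp add: ftens_eq_lin)

lemma ftens_unit_unit [simp]: "ftens (unit_vec w) (unit_vec v) = unit_vec (w, v)"
  by (simp add: ftens_eq_lin)

lemma (in module) lext_ftens:
  "lext scale h (ftens p q) = lext scale (\<lambda>w. lext scale (\<lambda>v. h (w, v)) q) p"
  by (simp add: ftens_eq_lin lext_lin)

lemmas lin_ftens = free_module.lext_ftens[folded lin_eq_lext]

lemma ftens_fscale_left: "ftens (fscale c p) q = fscale c (ftens p q)"
  and ftens_diff_left: "ftens (p - p') q = ftens p q - ftens p' q"
  and ftens_sum_left: "ftens (sum f I) q = (\<Sum>i\<in>I. ftens (f i) q)"
  by (simp_all add: ftens_eq_lin lin_add lin_fscale lin_diff lin_sum)

lemma ftens_fscale_right: "ftens p (fscale c q) = fscale c (ftens p q)"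
  and ftens_diff_right: "ftens p (q - q') = ftens p q - ftens p q'"
  and ftens_sum_right: "ftens p (sum f I) = (\<Sum>i\<in>I. ftens p (f i))"
  by (simp_all add: ftens_eq_lin lin_add lin_fscale lin_diff lin_sum
      lin_fun_add lin_fun_scale lin_fun_diff lin_fun_sum)

lemma ftens_rels_right:
  assumes T: "homogeneous_rels T" and p: "\<And>w. w \<in> keys p \<Longrightarrow> w \<in> gen S \<and> tgt S w = Y"
    and r: "r \<in> rels T" and rY: "\<And>v. v \<in> keys r \<Longrightarrow> src T v = Y"
  shows "ftens p r \<in> rels (tens S T)"
  unfolding ftens_eq_lin
proof (rule lin_mem_rels)
  fix w assume w: "w \<in> keys p"
  \<comment> \<open>A presentation of \<open>r\<close> by basic relations may pass through
    generators with other sources, which cancel in the end. Sending those to 0 gives a map defined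
    on all of \<open>rels T\<close> that agrees on \<open>r\<close> with tensoring by
    \<open>w\<close>.\<close>
  let ?f = "\<lambda>v. if src T v = Y then unit_vec (w, v) else 0"
  have "lin ?f r \<in> rels (tens S T)"
  proof (rule lin_rels[OF _ r])
    fix c d u v x assume *: "u \<in> gen T" "v \<in> gen T" "x \<in> gen T" "comb_rel T c d u v x"
    then show "?f x - fscale c (?f u) - fscale d (?f v) \<in> rels (tens S T)"
      using p[OF w] homogeneous_relsD[OF T *(4)]
      by (auto intro!: comb_rel_rels simp: gen_tens comb_rel_tens)
  qed
  also have "lin ?f r = lin (\<lambda>v. unit_vec (w, v)) r"
    using rY by (intro lin_cong) simp
  finally show "lin (\<lambda>v. unit_vec (w, v)) r \<in> rels (tens S T)" .
qed

lemma ftens_rels_left: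
  assumes S: "homogeneous_rels S" and q: "\<And>v. v \<in> keys q \<Longrightarrow> v \<in> gen T \<and> src T v = Y"
    and r: "r \<in> rels S" and rY: "\<And>w. w \<in> keys r \<Longrightarrow> tgt S w = Y"
  shows "ftens r q \<in> rels (tens S T)"
  unfolding ftens_eq_lin lin_swap[of _ q r]
proof (rule lin_mem_rels)
  fix v assume v: "v \<in> keys q"
  let ?f = "\<lambda>w. if tgt S w = Y then unit_vec (w, v) else 0"
  have "lin ?f r \<in> rels (tens S T)"
  proof (rule lin_rels[OF _ r])
    fix c d u w x assume *: "u \<in> gen S" "w \<in> gen S" "x \<in> gen S" "comb_rel S c d u w x"
    then show "?f x - fscale c (?f u) - fscale d (?f w) \<in> rels (tens S T)"
      using q[OF v] homogeneous_relsD[OF S *(4)]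
      by (auto intro!: comb_rel_rels simp: gen_tens comb_rel_tens)
  qed
  also have "lin ?f r = lin (\<lambda>w. unit_vec (w, v)) r"
    using rY by (intro lin_cong) simp
  finally show "lin (\<lambda>w. unit_vec (w, v)) r \<in> rels (tens S T)" .
qed

lemma tmap_apply: "tmap dg e f g (w, v) = fscale (ksgn (dg v * e)) (ftens (f w) (g v))"
  by (simp add: tmap_def)

lemma lin_tmap_ftens:
  assumes "\<And>v. v \<in> keys q \<Longrightarrow> dg v = d"
  shows "lin (tmap dg e f g) (ftens p q) = fscale (ksgn (d * e)) (ftens (lin f p) (lin g q))"
proof -
  have "lin (\<lambda>v. tmap dg e f g (w, v)) q = fscale (ksgn (d * e)) (ftens (f w) (lin g q))" for w
  proof -
    have "lin (\<lambda>v. tmap dg e f g (w, v)) q = lin (\<lambda>v. fscale (ksgn (d * e)) (ftens (f w) (g v))) q"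
      using assms by (intro lin_cong) (simp add: tmap_apply)
    then show ?thesis by (simp add: lin_fun_scale ftens_eq_lin lin_lin lin_swap[of _ q])
  qed
  then show ?thesis
    by (simp add: lin_ftens lin_fun_scale) (simp add: ftens_eq_lin lin_lin)
qed

text \<open>A basic relation of the tensor product changes one factor only. It is carried through
  \<open>f\<close> or \<open>g\<close> in that factor, and the common ends of the three generators
  allow the other factor to be tensored back.\<close>

lemma tmap_rels:
  assumes S: "homogeneous_rels S" and T: "homogeneous_rels T"
    and S': "homogeneous_rels S'" and T': "homogeneous_rels T'"
    and f: "f \<in> hom_maps S S' fs fm e" and g': "g \<in> hom_maps T T' fm ft e'"
    and r: "r \<in> rels (tens S T)"
    and dg: "\<And>v. v \<in> gen T \<Longrightarrow> dg v = dgr T v"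
  shows "lin (tmap dg e f g) r \<in> rels (tens S' T')"
proof (rule lin_rels[OF _ r])
  have left: "ftens s (g v) \<in> rels (tens S' T')"
    if "s \<in> rels S'" "homog S' X (fm (src T v)) d s" "v \<in> gen T" for s v X d
    by (rule ftens_rels_left[OF S' _ that(1)])
      (use hom_maps_homog[OF g' that(3)] that(2) in \<open>auto simp: homog_def\<close>)
  have right: "ftens (f w) t \<in> rels (tens S' T')"
    if "t \<in> rels T'" "homog T' (fm (tgt S w)) Y d t" "w \<in> gen S" for t w Y d
    by (rule ftens_rels_right[OF T' _ that(1)])
      (use hom_maps_homog[OF f that(3)] that(2) in \<open>auto simp: homog_def\<close>)
  fix c d u v w assume uvw: "u \<in> gen (tens S T)" "v \<in> gen (tens S T)" "w \<in> gen (tens S T)"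
    "comb_rel (tens S T) c d u v w"
  obtain u1 u2 v1 v2 w1 w2 where [simp]: "u = (u1, u2)" "v = (v1, v2)" "w = (w1, w2)"
    by (metis surj_pair)
  have g: "u1 \<in> gen S" "v1 \<in> gen S" "w1 \<in> gen S" "u2 \<in> gen T" "v2 \<in> gen T" "w2 \<in> gen T"
    and m: "tgt S w1 = src T w2"
    using uvw by (auto simp: gen_tens)
  consider (1) "comb_rel S c d u1 v1 w1" "u2 = w2" "v2 = w2" | (2) "comb_rel T c d u2 v2 w2" "u1 = w1" "v1 = w1"
    using uvw(4) by (auto simp: comb_rel_tens)
  then show "tmap dg e f g w - fscale c (tmap dg e f g u) - fscale d (tmap dg e f g v) \<in> rels (tens S' T')"
  proof cases
    case 1
    note eq = homogeneous_relsD[OF S 1(1)]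
    have "lin f (unit_vec w1 - fscale c (unit_vec u1) - fscale d (unit_vec v1)) \<in> rels S'"
      by (intro hom_maps_rels[OF f] comb_rel_rels g 1)
    then have r: "f w1 - fscale c (f u1) - fscale d (f v1) \<in> rels S'" by (simp add: lin_diff lin_fscale)
    have "homog S' (fs (src S w1)) (fm (src T w2)) (dgr S w1 + e) (f w1 - fscale c (f u1) - fscale d (f v1))"
      using hom_maps_homog[OF f g(1)] hom_maps_homog[OF f g(2)] hom_maps_homog[OF f g(3)]
      by (intro homog_diff homog_fscale) (simp_all add: eq m)
    from rels_scale[OF left[OF r this g(6)], of "ksgn (dg w2 * e)"] show ?thesis
      using 1 by (simp add: tmap_apply ftens_diff_left ftens_fscale_left fscale_right_diff_distrib mult.commute)
  next
    case 2
    note eq = homogeneous_relsD[OF T 2(1)]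
    have "lin g (unit_vec w2 - fscale c (unit_vec u2) - fscale d (unit_vec v2)) \<in> rels T'"
      by (intro hom_maps_rels[OF g'] comb_rel_rels g 2)
    then have r: "g w2 - fscale c (g u2) - fscale d (g v2) \<in> rels T'" by (simp add: lin_diff lin_fscale)
    have "homog T' (fm (tgt S w1)) (ft (tgt T w2)) (dgr T w2 + e') (g w2 - fscale c (g u2) - fscale d (g v2))"
      using hom_maps_homog[OF g' g(4)] hom_maps_homog[OF g' g(5)] hom_maps_homog[OF g' g(6)]
      by (intro homog_diff homog_fscale) (simp_all add: eq m)
    from rels_scale[OF right[OF r this g(3)], of "ksgn (dg w2 * e)"] show ?thesis
      using 2 by (simp add: tmap_apply ftens_diff_right ftens_fscale_right fscale_right_diff_distrib dg g eq mult.commute)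
  qed
qed

lemma idm_hom_maps: "idm \<in> hom_maps S S id id 0"
  by (simp add: hom_maps_def)

text \<open>As \<open>f\<close> and \<open>g\<close> have degree 1, the Koszul sign cancels the mixed terms.\<close>

lemma tensor_derivation_square:
  fixes f :: "('w, 'w, 'k::comm_ring_1) gmap" and g :: "('v, 'v, 'k) gmap"
  assumes g: "\<And>x. x \<in> keys (g v) \<Longrightarrow> dg x = dg v + 1"
  defines "M \<equiv> tmap dg 0 idm g + tmap dg 1 f idm"
  shows "lin M (M (w, v)) = ftens (unit_vec w) (lin g (g v)) + ftens (lin f (f w)) (unit_vec v)"
proof -
  have M: "lin M p = lin (tmap dg 0 idm g) p + lin (tmap dg 1 f idm) p" for p
    unfolding M_def plus_fun_def by (rule lin_fun_add)
  have Mv: "M (w, v) = ftens (unit_vec w) (g v) + fscale (ksgn (dg v)) (ftens (f w) (unit_vec v))"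
    by (simp add: M_def tmap_apply)
  have 1: "lin M (ftens (unit_vec w) (g v)) =
      ftens (unit_vec w) (lin g (g v)) + fscale (ksgn (dg v + 1)) (ftens (f w) (g v))"
    unfolding M by (simp add: lin_tmap_ftens[where d = "dg v + 1", OF g])
  have 2: "lin M (ftens (f w) (unit_vec v)) =
      ftens (f w) (g v) + fscale (ksgn (dg v)) (ftens (lin f (f w)) (unit_vec v))"
  proof -
    have "lin (tmap dg e h idm) (ftens (f w) (unit_vec v)) =
        fscale (ksgn (dg v * e)) (ftens (lin h (f w)) (lin idm (unit_vec v)))" for e and h :: "('w, 'w, 'k) gmap"
      by (rule lin_tmap_ftens) simp
    moreover have "lin (tmap dg 0 idm g) (ftens (f w) (unit_vec v)) =
        fscale (ksgn (dg v * 0)) (ftens (lin idm (f w)) (lin g (unit_vec v)))"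
      by (rule lin_tmap_ftens) simp
    ultimately show ?thesis unfolding M by simp
  qed
  have s: "ksgn (dg v + 1) = - (ksgn (dg v) :: 'k)" by (simp add: ksgn_def)
  show ?thesis
    unfolding Mv lin_add lin_fscale 1 2 by (simp add: s fscale_right_distrib)
qed

section \<open>Tensor coalgebras\<close>

lemma letters_iff: "l \<in> letters I J M \<longleftrightarrow> lsrc l \<in> I \<and> ltgt l \<in> J \<and> lelt l \<in> M (lsrc l) (ltgt l) (ldeg l)"
  by (cases l) (auto simp: letters_def)

lemma susp_sel [simp]:
  "gen (susp sc I J M) = letters I J (shift M)" "src (susp sc I J M) = lsrc"
  "tgt (susp sc I J M) = ltgt" "dgr (susp sc I J M) = ldeg"
  "padd (susp sc I J M) = ladd" "pscl (susp sc I J M) = lscl sc"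
  by (simp_all add: susp_def)

lemma Ts_sel [simp]:
  "gen (Ts_pow N sc Ob A) =
     {(X, ls). X \<in> Ob \<and> set ls \<subseteq> letters Ob Ob (shift A) \<and> is_path X ls \<and> length ls \<in> N}"
  "src (Ts_pow N sc Ob A) = fst" "tgt (Ts_pow N sc Ob A) = path_tgt"
  "dgr (Ts_pow N sc Ob A) = path_deg"
  by (simp_all add: Ts_pow_def)

lemma comb_rel_susp: "comb_rel (susp sc I J M) c d k l m \<longleftrightarrow>
    ladd k l m \<and> c = 1 \<and> d = 1 \<or> lscl sc c k m \<and> d = 0 \<and> l = k"
  by (simp add: comb_rel_def susp_def)

lemma comb_rel_suspD:
  assumes "comb_rel (susp sc I J M) c d k l m"
  shows "lsrc k = lsrc m" "ltgt k = ltgt m" "ldeg k = ldeg m" "lsrc l = lsrc m" "ltgt l = ltgt m" "ldeg l = ldeg m"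
  using assms by (auto simp: comb_rel_susp ladd_def lscl_def)

lemma (in module) comb_rel_lelt:
  "comb_rel (susp scale I J M) c d k l m \<Longrightarrow> lelt m = scale c (lelt k) + scale d (lelt l)"
  by (auto simp: comb_rel_susp ladd_def lscl_def)

lemma comb_rel_Ts: "comb_rel (Ts_pow N sc Ob A) c d u v w \<longleftrightarrow>
    (\<exists>X us vs k l m. comb_rel (susp sc Ob Ob A) c d k l m \<and>
      u = (X, us @ [k] @ vs) \<and> v = (X, us @ [l] @ vs) \<and> w = (X, us @ [m] @ vs))"
  unfolding comb_rel_susp by (auto simp: comb_rel_def Ts_pow_def) blast+

lemma comb_rel_TsI: "comb_rel (susp sc Ob Ob A) c d k l m \<Longrightarrow>
    comb_rel (Ts_pow N sc Ob A) c d (X, us @ [k] @ vs) (X, us @ [l] @ vs) (X, us @ [m] @ vs)"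
  unfolding comb_rel_Ts by blast

lemma comb_rel_Ts_nonempty:
  "comb_rel (Ts_pow N sc Ob A) c d u v w \<Longrightarrow> snd u \<noteq> [] \<and> snd v \<noteq> [] \<and> snd w \<noteq> []"
  by (auto simp: comb_rel_Ts)

lemma eqv_commute: "eqv S p q \<longleftrightarrow> eqv S q p"
  using eqv_sym by blast

section \<open>Realization of representatives in the ambient module\<close>

lemma realize_rels:
  assumes "module sc" "r \<in> rels (susp sc I J M)"
  shows "realize sc r = 0"
proof -
  interpret module sc by fact
  have "lext sc lelt r \<in> {0}"
    by (rule lext_rels[OF _ _ assms(2)]) (auto simp: subspace_single_0 comb_rel_lelt)
  then show ?thesis by (simp add: realize_eq_lext)
qed

lemma realize_eqv: "module sc \<Longrightarrow> eqv (susp sc I J M) p q \<Longrightarrow> realize sc p = realize sc q"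
  using realize_rels[of sc "p - q" I J M] module.lext_diff[of sc lelt p q]
  by (simp add: eqv_def realize_eq_lext)

text \<open>Letters with the same ends and degree can be added, so a homogeneous combination
  collapses to one letter. The shift by 1 is the suspension.\<close>

lemma
  assumes M: "graded_span sc I J M" and X: "X \<in> I" and Y: "Y \<in> J"
    and q: "homog (susp sc I J M) X Y n q"
  shows eqv_unit_realize: "eqv (susp sc I J M) q (unit_vec (Letter X n (realize sc q) Y))"
    and realize_mem: "realize sc q \<in> M X Y (n + 1)"
proof -
  let ?S = "susp sc I J M"
  interpret module sc using M by (simp add: graded_span_def)
  have sub: "subspace (M X Y (n + 1))" using M X Y by (simp add: graded_span_def)
  have g: "Letter X n x Y \<in> gen ?S \<longleftrightarrow> x \<in> M X Y (n + 1)" for x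
    using X Y by (simp add: letters_iff shift_def)
  have l: "l = Letter X n (lelt l) Y \<and> lelt l \<in> M X Y (n + 1)" if "l \<in> keys q" for l
    using homogD[OF q that] by (cases l) (auto simp: letters_iff shift_def)
  have "eqv ?S (\<Sum>l\<in>W. fscale (c l) (unit_vec l)) (unit_vec (Letter X n (\<Sum>l\<in>W. sc (c l) (lelt l)) Y)) \<and>
      (\<Sum>l\<in>W. sc (c l) (lelt l)) \<in> M X Y (n + 1)" if "W \<subseteq> keys q" "finite W" for W and c :: "_ \<Rightarrow> 'a"
    using that(2,1)
  proof (induction W)
    case empty
    \<comment> \<open>The letter carrying 0 is a nonzero basis vector of the free module;
      homogeneity with scalar 0 identifies it with zero.\<close>
    have "unit_vec (Letter X n 0 Y) - fscale 0 (unit_vec (Letter X n 0 Y)) \<in> rels ?S"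
      by (rule pscl_rels) (auto simp: g subspace_0[OF sub] lscl_def simp del: susp_sel(1))
    then show ?case by (simp add: subspace_0[OF sub] eqv_sym eqv_def eqv_0_iff eqv_rels_iff free_module.subspace_neg)
  next
    case (insert l W)
    let ?x = "sc (c l) (lelt l)" and ?y = "\<Sum>l\<in>W. sc (c l) (lelt l)"
    have IH: "eqv ?S (\<Sum>l\<in>W. fscale (c l) (unit_vec l)) (unit_vec (Letter X n ?y Y))" "?y \<in> M X Y (n + 1)"
      using insert by auto
    have lm: "lelt l \<in> M X Y (n + 1)" and le: "Letter X n (lelt l) Y = l" using l[of l] insert by auto
    have x: "?x \<in> M X Y (n + 1)" using lm by (rule subspace_scale[OF sub])
    have xy: "?x + ?y \<in> M X Y (n + 1)" by (rule subspace_add[OF sub x IH(2)])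
    have "unit_vec (Letter X n ?x Y) - fscale (c l) (unit_vec l) \<in> rels ?S"
      by (rule pscl_rels) (use le g[of "lelt l"] g x lm in \<open>auto simp: lscl_def simp del: susp_sel(1) intro!: exI[of _ "lelt l"]\<close>)
    then have 1: "eqv ?S (fscale (c l) (unit_vec l)) (unit_vec (Letter X n ?x Y))"
      by (subst eqv_commute) (simp add: eqv_def)
    have "unit_vec (Letter X n (?x + ?y) Y) - unit_vec (Letter X n ?x Y) - unit_vec (Letter X n ?y Y) \<in> rels ?S"
      by (rule padd_rels) (use g x IH(2) xy in \<open>auto simp: ladd_def simp del: susp_sel(1)\<close>)
    then have "eqv ?S (unit_vec (Letter X n ?x Y) + unit_vec (Letter X n ?y Y)) (unit_vec (Letter X n (?x + ?y) Y))"
      by (subst eqv_commute) (simp add: eqv_def diff_diff_eq)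
    with eqv_add[OF 1 IH(1)] show ?case
      using insert(1,2) xy by (auto intro: eqv_trans)
  qed
  from this[of "keys q" "Poly_Mapping.lookup q"]
  show "eqv ?S q (unit_vec (Letter X n (realize sc q) Y))" "realize sc q \<in> M X Y (n + 1)"
    using lin_idm[of q, unfolded lin_def] by (auto simp: realize_def)
qed

text \<open>The presentation is faithful in each bidegree. This converts membership in
  \<open>rels\<close> into equations in \<open>P\<close> and in the complexes of maps.\<close>

lemma rels_iff_realize:
  assumes M: "graded_span sc I J M" and X: "X \<in> I" and Y: "Y \<in> J"
    and q: "homog (susp sc I J M) X Y n q"
  shows "q \<in> rels (susp sc I J M) \<longleftrightarrow> realize sc q = 0"
proof
  assume "realize sc q = 0"
  then have "eqv (susp sc I J M) q (unit_vec (Letter X n 0 Y))"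
    using eqv_unit_realize[OF assms] by simp
  moreover have "eqv (susp sc I J M) 0 (unit_vec (Letter X n 0 Y))"
    using eqv_unit_realize[OF M X Y, of n 0] by (simp add: realize_def)
  ultimately show "q \<in> rels (susp sc I J M)" by (metis eqv_0_iff eqv_sym eqv_trans)
next
  assume "q \<in> rels (susp sc I J M)"
  then show "realize sc q = 0"
    using realize_rels M by (auto simp: graded_span_def)
qed

lemma comb_letters_rels:
  assumes M: "graded_span sc I J M" and X: "X \<in> I" and Y: "Y \<in> J"
    and x: "x \<in> M X Y (n + 1)" and y: "y \<in> M X Y (n + 1)"
  shows "unit_vec (Letter X n (sc c x + sc d y) Y) - fscale c (unit_vec (Letter X n x Y)) -
    fscale d (unit_vec (Letter X n y Y)) \<in> rels (susp sc I J M)" (is "?q \<in> _")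
proof -
  interpret module sc using M by (simp add: graded_span_def)
  have "subspace (M X Y (n + 1))" using M X Y by (simp add: graded_span_def)
  then have "homog (susp sc I J M) X Y n ?q"
    using X Y x y by (intro homog_diff homog_fscale)
      (auto simp: homog_def letters_iff shift_def subspace_add subspace_scale)
  moreover have "realize sc ?q = 0"
    by (simp add: realize_eq_lext lext_diff lext_fscale)
  ultimately show ?thesis using rels_iff_realize[OF M X Y] by blast
qed

lemma (in module) realize_fscale: "realize scale (fscale c q) = scale c (realize scale q)"
  by (simp add: realize_eq_lext lext_fscale)

lemma (in module) realize_lin: "realize scale (lin f q) = lext scale (\<lambda>w. realize scale (f w)) q"
  by (simp add: realize_eq_lext lext_lin)

section \<open>Paths, their cuts, and sums over factorizations\<close>

lemma path_tgt_Nil [simp]: "path_tgt (X, []) = X"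
  by (simp add: path_tgt_def)

lemma path_tgt_Cons [simp]: "path_tgt (X, l # ls) = path_tgt (ltgt l, ls)"
  by (simp add: path_tgt_def)

lemma path_tgt_append [simp]: "path_tgt (X, a @ b) = path_tgt (path_tgt (X, a), b)"
  by (induction a arbitrary: X) auto

lemma is_path_append [simp]: "is_path X (a @ b) \<longleftrightarrow> is_path X a \<and> is_path (path_tgt (X, a)) b"
  by (induction a arbitrary: X) auto

lemma path_deg_Nil [simp]: "path_deg (X, []) = 0"
  and path_deg_Cons [simp]: "path_deg (X, l # ls) = ldeg l + path_deg (Y, ls)"
  and path_deg_append [simp]: "path_deg (X, a @ b) = path_deg (X, a) + path_deg (Z, b)"
  by (simp_all add: path_deg_def)

lemma path_deg_eq: "path_deg (X, a) = path_deg (Y, a)"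
  by (simp add: path_deg_def)

lemma path_tgt_mem:
  assumes "X \<in> Ob" "set ls \<subseteq> letters I Ob M"
  shows "path_tgt (X, ls) \<in> Ob"
  using assms by (induction ls arbitrary: X) (auto simp: letters_iff)

lemma homogeneous_rels_susp: "homogeneous_rels (susp sc I J M)"
  unfolding homogeneous_rels_def by (auto dest: comb_rel_suspD)

lemma homogeneous_rels_Ts: "homogeneous_rels (Ts_pow N sc Ob A)"
  unfolding homogeneous_rels_def comb_rel_Ts
  by (auto simp: path_deg_def dest: comb_rel_suspD)

text \<open>Indexing by the two pieces instead of the position of the cut makes exchanges of nested
  sums explicit bijections, without arithmetic of \<open>take\<close> and
  \<open>drop\<close>.\<close>

definition splits :: "'x list \<Rightarrow> ('x list \<times> 'x list) set" where
  "splits ls = {(a, b). a @ b = ls}"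

lemma splits_image: "splits ls = (\<lambda>i. (take i ls, drop i ls)) ` {..length ls}"
proof
  show "splits ls \<subseteq> (\<lambda>i. (take i ls, drop i ls)) ` {..length ls}"
  proof
    fix x assume "x \<in> splits ls"
    then obtain a b where "x = (a, b)" "a @ b = ls" by (auto simp: splits_def)
    then show "x \<in> (\<lambda>i. (take i ls, drop i ls)) ` {..length ls}"
      by (intro image_eqI[where x = "length a"]) auto
  qed
qed (auto simp: splits_def)

lemma finite_splits [simp]: "finite (splits ls)"
  by (simp add: splits_image)

lemma inj_on_take_drop: "inj_on (\<lambda>i. (take i ls, drop i ls)) {..length ls}"
  by (rule inj_onI) (metis Pair_inject atMost_iff length_take min.absorb2)

definition cuts :: "('o, 'a) path \<Rightarrow> (('o, 'a) path \<times> ('o, 'a) path) set" where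
  "cuts w = (\<lambda>(a, b). ((fst w, a), (path_tgt (fst w, a), b))) ` splits (snd w)"

lemma finite_cuts [simp]: "finite (cuts w)"
  by (simp add: cuts_def)

lemma sum_cuts_cong:
  "(\<And>w1 w2. (w1, w2) \<in> cuts w \<Longrightarrow> f w1 w2 = g w1 w2) \<Longrightarrow>
    (\<Sum>(w1, w2)\<in>cuts w. f w1 w2) = (\<Sum>(w1, w2)\<in>cuts w. g w1 w2)"
  by (auto intro!: sum.cong)

lemma sum_cuts_cong':
  "(\<And>w1 w2. (w1, w2) \<in> cuts w \<Longrightarrow> f (w1, w2) = g w1 w2) \<Longrightarrow>
    (\<Sum>c\<in>cuts w. f c) = (\<Sum>(w1, w2)\<in>cuts w. g w1 w2)"
  by (auto intro!: sum.cong)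

lemma sum_cuts_cong2:
  assumes "\<And>w1 w2 v1 v2. (w1, w2) \<in> cuts w \<Longrightarrow> (v1, v2) \<in> cuts v \<Longrightarrow> f w1 w2 v1 v2 = g w1 w2 v1 v2"
  shows "(\<Sum>(w1, w2)\<in>cuts w. \<Sum>(v1, v2)\<in>cuts v. f w1 w2 v1 v2) =
    (\<Sum>(w1, w2)\<in>cuts w. \<Sum>(v1, v2)\<in>cuts v. g w1 w2 v1 v2)"
  by (intro sum_cuts_cong assms)

lemma eqv_sum_cuts:
  "(\<And>w1 w2. (w1, w2) \<in> cuts w \<Longrightarrow> eqv S (f w1 w2) (g w1 w2)) \<Longrightarrow>
    eqv S (\<Sum>(w1, w2)\<in>cuts w. f w1 w2) (\<Sum>(w1, w2)\<in>cuts w. g w1 w2)"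
  by (auto intro!: eqv_sum)

lemma homog_sum_cuts:
  "(\<And>w1 w2. (w1, w2) \<in> cuts w \<Longrightarrow> homog S X Y d (f w1 w2)) \<Longrightarrow> homog S X Y d (\<Sum>(w1, w2)\<in>cuts w. f w1 w2)"
  by (auto intro!: homog_sum)

lemma sum_cuts:
  "(\<Sum>c\<in>cuts (X, ls). f c) = (\<Sum>(a, b)\<in>splits ls. f ((X, a), (path_tgt (X, a), b)))"
  unfolding cuts_def by (subst sum.reindex) (auto simp: inj_on_def case_prod_beta intro: sum.cong)

lemma cut_eq: "cut w = (\<Sum>c\<in>cuts w. unit_vec c)"
proof -
  obtain X ls where w: "w = (X, ls)" by force
  show ?thesis
    unfolding w sum_cuts cut_def splits_image
    by (subst sum.reindex[OF inj_on_take_drop]) simp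
qed

lemma cuts_iff:
  "(w1, w2) \<in> cuts w \<longleftrightarrow> fst w1 = fst w \<and> fst w2 = path_tgt w1 \<and> snd w1 @ snd w2 = snd w"
  by (cases w1; cases w2; cases w) (auto simp: cuts_def splits_def image_iff)

lemma cuts_deg: "(w1, w2) \<in> cuts w \<Longrightarrow> path_deg w = path_deg w1 + path_deg w2"
  by (cases w1; cases w2; cases w) (auto simp: cuts_iff path_deg_def)

lemma cuts_tgt: "(w1, w2) \<in> cuts w \<Longrightarrow> path_tgt w2 = path_tgt w"
  by (cases w1; cases w2; cases w) (auto simp: cuts_iff)

lemma cuts_gen:
  assumes "(w1, w2) \<in> cuts w" "w \<in> gen (Ts sc Ob A)"
  shows "w1 \<in> gen (Ts sc Ob A)" "w2 \<in> gen (Ts sc Ob A)"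
  using assms
  by (cases w1; cases w2; cases w; auto simp: cuts_iff intro!: path_tgt_mem)+

text \<open>The places where a block \<open>m\<close> can be fed to \<open>b\<close>; blocks are
  nonempty because the components start at \<open>n = 1\<close>.\<close>

definition triples :: "'x list \<Rightarrow> ('x list \<times> 'x list \<times> 'x list) set" where
  "triples ls = {(a, m, t). a @ m @ t = ls \<and> m \<noteq> []}"

lemma finite_triples [simp]: "finite (triples ls)"
proof (rule finite_subset)
  show "triples ls \<subseteq> (\<lambda>(i, j). (take i ls, drop i (take j ls), drop j ls)) ` ({..length ls} \<times> {..length ls})"
  proof
    fix x assume "x \<in> triples ls"
    then obtain a m t where "x = (a, m, t)" "a @ m @ t = ls" by (auto simp: triples_def)
    then show "x \<in> (\<lambda>(i, j). (take i ls, drop i (take j ls), drop j ls)) ` ({..length ls} \<times> {..length ls})"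
      by (intro image_eqI[where x = "(length a, length a + length m)"]) auto
  qed
qed auto

definition coder_term ::
  "(nat \<Rightarrow> (('o, 'a) path, ('o, 'o, 'a) letter, 'k::comm_ring_1) gmap) \<Rightarrow> 'o \<Rightarrow>
    ('o, 'o, 'a) letter list \<times> ('o, 'o, 'a) letter list \<times> ('o, 'o, 'a) letter list \<Rightarrow>
    (('o, 'a) path \<Rightarrow>\<^sub>0 'k)" where
  "coder_term b X = (\<lambda>(a, m, t). fscale (ksgn (path_deg (X, t)))
     (lin (\<lambda>l. unit_vec (X, a @ [l] @ t)) (b (length m) (path_tgt (X, a), m))))"

text \<open>The form by positions is kept for comparing words that differ in one letter: they have
  the same positions but different sets of \<open>triples\<close>.\<close>

lemma coder_eq_index: "coder b (X, ls) = (\<Sum>j\<le>length ls. \<Sum>i<j.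
    coder_term b X (take i ls, drop i (take j ls), drop j ls))"
  by (auto simp: coder_def coder_term_def path_deg_def min_def intro!: sum.cong)

lemma coder_eq: "coder b (X, ls) = (\<Sum>x\<in>triples ls. coder_term b X x)"
proof -
  have "coder b (X, ls) = (\<Sum>(j, i)\<in>Sigma {..length ls} (\<lambda>j. {..<j}).
      coder_term b X (take i ls, drop i (take j ls), drop j ls))"
    by (simp add: coder_eq_index sum.Sigma)
  also have "\<dots> = (\<Sum>x\<in>triples ls. coder_term b X x)"
  proof (rule sum.reindex_bij_witness[where
      i = "\<lambda>(a, m, t). (length a + length m, length a)" and
      j = "\<lambda>(j, i). (take i ls, drop i (take j ls), drop j ls)"])
    fix x assume "x \<in> Sigma {..length ls} (\<lambda>j. {..<j})"
    then obtain i j where x: "x = (j, i)" "i < j" "j \<le> length ls" by auto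
    have "take i ls @ drop i (take j ls) @ drop j ls = ls"
      using x(2) by (metis append.assoc append_take_drop_id less_imp_le min.absorb1 take_take)
    then show "(case x of (j, i) \<Rightarrow> (take i ls, drop i (take j ls), drop j ls)) \<in> triples ls"
      using x by (auto simp: triples_def)
  qed (auto simp: triples_def)
  finally show ?thesis .
qed

text \<open>Both sides run over the factorizations \<open>ls = a1 @ a2 @ m @ t\<close> with
  \<open>m\<close> nonempty: cutting before the block commutes with choosing the block.\<close>

lemma sum_splits_triples:
  "(\<Sum>(a, m, t)\<in>triples ls. \<Sum>(a1, a2)\<in>splits a. f a1 a2 m t) =
   (\<Sum>(a1, r)\<in>splits ls. \<Sum>(a2, m, t)\<in>triples r. f a1 a2 m t)"
proof -
  have "(\<Sum>(a, m, t)\<in>triples ls. \<Sum>(a1, a2)\<in>splits a. f a1 a2 m t) =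
      (\<Sum>(x, y)\<in>Sigma (triples ls) (\<lambda>(a, m, t). splits a). case x of (a, m, t) \<Rightarrow> case y of (a1, a2) \<Rightarrow> f a1 a2 m t)"
    by (subst sum.Sigma[symmetric]) (auto intro!: sum.cong)
  also have "\<dots> = (\<Sum>(x, y)\<in>Sigma (splits ls) (\<lambda>(a1, r). triples r). case y of (a2, m, t) \<Rightarrow> f (fst x) a2 m t)"
    by (rule sum.reindex_bij_witness[where
      i = "\<lambda>((a1, r), (a2, m, t)). ((a1 @ a2, m, t), (a1, a2))" and
      j = "\<lambda>((a, m, t), (a1, a2)). ((a1, a2 @ m @ t), (a2, m, t))"]) (auto simp: triples_def splits_def)
  also have "\<dots> = (\<Sum>(a1, r)\<in>splits ls. \<Sum>(a2, m, t)\<in>triples r. f a1 a2 m t)"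
    by (subst sum.Sigma[symmetric]) (auto intro!: sum.cong)
  finally show ?thesis .
qed

lemma sum_triples_splits:
  "(\<Sum>(a, m, t)\<in>triples ls. \<Sum>(t1, t2)\<in>splits t. f a m t1 t2) =
   (\<Sum>(r, t2)\<in>splits ls. \<Sum>(a, m, t1)\<in>triples r. f a m t1 t2)"
proof -
  have "(\<Sum>(a, m, t)\<in>triples ls. \<Sum>(t1, t2)\<in>splits t. f a m t1 t2) =
      (\<Sum>(x, y)\<in>Sigma (triples ls) (\<lambda>(a, m, t). splits t). case x of (a, m, t) \<Rightarrow> case y of (t1, t2) \<Rightarrow> f a m t1 t2)"
    by (subst sum.Sigma[symmetric]) (auto intro!: sum.cong)
  also have "\<dots> = (\<Sum>(x, y)\<in>Sigma (splits ls) (\<lambda>(r, t2). triples r). case y of (a, m, t1) \<Rightarrow> f a m t1 (snd x))"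
    by (rule sum.reindex_bij_witness[where
      i = "\<lambda>((r, t2), (a, m, t1)). ((a, m, t1 @ t2), (t1, t2))" and
      j = "\<lambda>((a, m, t), (t1, t2)). ((a @ m @ t1, t2), (a, m, t1))"]) (auto simp: triples_def splits_def)
  also have "\<dots> = (\<Sum>(r, t2)\<in>splits ls. \<Sum>(a, m, t1)\<in>triples r. f a m t1 t2)"
    by (subst sum.Sigma[symmetric]) (auto intro!: sum.cong)
  finally show ?thesis .
qed

text \<open>A cut leaves the distinguished letter in the right piece or in the left piece. This
  dichotomy becomes the two summands of the coderivation property.\<close>

lemma splits_insert: "splits (a @ [l] @ t) =
    (\<lambda>(a1, a2). (a1, a2 @ [l] @ t)) ` splits a \<union> (\<lambda>(t1, t2). (a @ [l] @ t1, t2)) ` splits t"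
  by (auto simp: splits_def append_eq_append_conv2 append_eq_Cons_conv Cons_eq_append_conv image_iff)

lemma sum_splits_insert: "(\<Sum>x\<in>splits (a @ [l] @ t). f x) =
    (\<Sum>(a1, a2)\<in>splits a. f (a1, a2 @ [l] @ t)) + (\<Sum>(t1, t2)\<in>splits t. f (a @ [l] @ t1, t2))"
proof -
  have "(\<lambda>(a1, a2). (a1, a2 @ [l] @ t)) ` splits a \<inter> (\<lambda>(t1, t2). (a @ [l] @ t1, t2)) ` splits t = {}"
  proof -
    have "length (fst x) \<le> length a" if "x \<in> (\<lambda>(a1, a2). (a1, a2 @ [l] @ t)) ` splits a" for x
      using that by (auto simp: splits_def)
    moreover have "length (fst x) > length a" if "x \<in> (\<lambda>(t1, t2). (a @ [l] @ t1, t2)) ` splits t" for x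
      using that by (auto simp: splits_def)
    ultimately show ?thesis by fastforce
  qed
  moreover have "inj_on (\<lambda>(a1, a2). (a1, a2 @ [l] @ t)) (splits a)"
    "inj_on (\<lambda>(t1, t2). (a @ [l] @ t1, t2)) (splits t)"
    by (auto simp: inj_on_def)
  ultimately show ?thesis
    unfolding splits_insert by (simp add: sum.union_disjoint sum.reindex) (simp add: case_prod_beta)
qed

definition tensor_coder :: "(nat \<Rightarrow> (('o, 'a) path, ('o, 'o, 'a) letter, 'k::comm_ring_1) gmap) \<Rightarrow>
    (('o, 'a) path \<times> ('o, 'a) path, ('o, 'a) path \<times> ('o, 'a) path, 'k) gmap" where
  "tensor_coder b = tmap path_deg 0 idm (coder b) + tmap path_deg 1 (coder b) idm"

lemma tensor_coder_apply: "tensor_coder b (w1, w2) =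
    ftens (unit_vec w1) (coder b w2) + fscale (ksgn (path_deg w2)) (ftens (coder b w1) (unit_vec w2))"
  by (simp add: tensor_coder_def tmap_apply)

text \<open>A cut of the result passes to the left or to the right of the letter produced by
  \<open>b\<close>. In the second case the sign of \<open>t\<close> factors into those of
  \<open>t1\<close> and \<open>t2\<close>, the latter being the Koszul sign of moving
  \<open>b\<close> past the right piece. The hypothesis on targets makes the intermediate object of
  the cut independent of that letter.\<close>

lemma coder_term_cut:
  assumes b: "\<And>l. l \<in> keys (b (length m) (path_tgt (X, a), m)) \<Longrightarrow> ltgt l = path_tgt (X, a @ m)"
  shows "lin cut (coder_term b X (a, m, t)) =
      (\<Sum>(a1, a2)\<in>splits a. ftens (unit_vec (X, a1)) (coder_term b (path_tgt (X, a1)) (a2, m, t))) +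
      (\<Sum>(t1, t2)\<in>splits t. fscale (ksgn (path_deg (X, t2)))
         (ftens (coder_term b X (a, m, t1)) (unit_vec (path_tgt (X, a @ m @ t1), t2))))"
proof -
  let ?q = "b (length m) (path_tgt (X, a), m)" and ?s = "ksgn (path_deg (X, t)) :: 'c"
  have *: "lin (\<lambda>l. cut (X, a @ [l] @ t)) ?q =
      lin (\<lambda>l. (\<Sum>(a1, a2)\<in>splits a. unit_vec ((X, a1), (path_tgt (X, a1), a2 @ [l] @ t))) +
        (\<Sum>(t1, t2)\<in>splits t. unit_vec ((X, a @ [l] @ t1), (path_tgt (X, a @ m @ t1), t2)))) ?q"
    using b by (intro lin_cong) (simp only: cut_eq sum_cuts sum_splits_insert, auto intro!: sum.cong)
  have "lin cut (coder_term b X (a, m, t)) = fscale ?s (lin (\<lambda>l. cut (X, a @ [l] @ t)) ?q)"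
    by (simp add: coder_term_def lin_fscale lin_lin)
  also have "\<dots> = (\<Sum>(a1, a2)\<in>splits a. fscale ?s
         (lin (\<lambda>l. unit_vec ((X, a1), (path_tgt (X, a1), a2 @ [l] @ t))) ?q)) +
      (\<Sum>(t1, t2)\<in>splits t. fscale ?s
         (lin (\<lambda>l. unit_vec ((X, a @ [l] @ t1), (path_tgt (X, a @ m @ t1), t2))) ?q))"
    unfolding * by (simp add: lin_fun_add lin_fun_sum case_prod_beta fscale_right_distrib
        fscale_sum_right)
  also have "(\<Sum>(a1, a2)\<in>splits a. fscale ?s
         (lin (\<lambda>l. unit_vec ((X, a1), (path_tgt (X, a1), a2 @ [l] @ t))) ?q)) =
      (\<Sum>(a1, a2)\<in>splits a. ftens (unit_vec (X, a1)) (coder_term b (path_tgt (X, a1)) (a2, m, t)))"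
    by (rule sum.cong)
      (auto simp: splits_def coder_term_def ftens_fscale_right ftens_unit_left lin_lin path_deg_def)
  also have "(\<Sum>(t1, t2)\<in>splits t. fscale ?s
         (lin (\<lambda>l. unit_vec ((X, a @ [l] @ t1), (path_tgt (X, a @ m @ t1), t2))) ?q)) =
      (\<Sum>(t1, t2)\<in>splits t. fscale (ksgn (path_deg (X, t2)))
         (ftens (coder_term b X (a, m, t1)) (unit_vec (path_tgt (X, a @ m @ t1), t2))))"
    by (rule sum.cong)
      (auto simp: splits_def coder_term_def ftens_fscale_left ftens_unit_right lin_lin lin_fscale ksgn_add path_deg_def mult.commute)
  finally show ?thesis .
qed

text \<open>The coderivation property holds exactly in the free modules, not only modulo relations,
  since it is a rearrangement of sums; only the ends of the values of \<open>b\<close>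
  enter.\<close>

lemma cut_coder:
  fixes w :: "('o, 'a) path" and b :: "nat \<Rightarrow> (('o, 'a) path, ('o, 'o, 'a) letter, 'k::comm_ring_1) gmap"
  assumes b: "\<And>a m t l. \<lbrakk>a @ m @ t = snd w; m \<noteq> [];
      l \<in> keys (b (length m) (path_tgt (fst w, a), m))\<rbrakk> \<Longrightarrow> ltgt l = path_tgt (fst w, a @ m)"
  shows "lin cut (coder b w) = lin (tensor_coder b) (cut w)"
proof -
  obtain X ls where w: "w = (X, ls)" by force
  have "lin cut (coder b w) = (\<Sum>(a, m, t)\<in>triples ls.
      (\<Sum>(a1, a2)\<in>splits a. ftens (unit_vec (X, a1)) (coder_term b (path_tgt (X, a1)) (a2, m, t))) +
      (\<Sum>(t1, t2)\<in>splits t. fscale (ksgn (path_deg (X, t2)))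
         (ftens (coder_term b X (a, m, t1)) (unit_vec (path_tgt (X, a @ m @ t1), t2)))))"
    unfolding w coder_eq lin_sum
  proof (rule sum.cong[OF refl])
    fix x assume "x \<in> triples ls"
    then obtain a m t where x: "x = (a, m, t)" "a @ m @ t = ls" "m \<noteq> []" by (auto simp: triples_def)
    show "lin cut (coder_term b X x) = (case x of (a, m, t) \<Rightarrow>
      (\<Sum>(a1, a2)\<in>splits a. ftens (unit_vec (X, a1)) (coder_term b (path_tgt (X, a1)) (a2, m, t))) +
      (\<Sum>(t1, t2)\<in>splits t. fscale (ksgn (path_deg (X, t2)))
         (ftens (coder_term b X (a, m, t1)) (unit_vec (path_tgt (X, a @ m @ t1), t2)))))"
      unfolding x(1) prod.case by (rule coder_term_cut) (use b[of a m t] x in \<open>simp add: w\<close>)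
  qed
  also have "\<dots> = (\<Sum>(a1, r)\<in>splits ls. \<Sum>(a2, m, t)\<in>triples r.
        ftens (unit_vec (X, a1)) (coder_term b (path_tgt (X, a1)) (a2, m, t))) +
      (\<Sum>(r, t2)\<in>splits ls. \<Sum>(a, m, t1)\<in>triples r. fscale (ksgn (path_deg (X, t2)))
         (ftens (coder_term b X (a, m, t1)) (unit_vec (path_tgt (X, a @ m @ t1), t2))))"
    unfolding sum_splits_triples[symmetric] sum_triples_splits[symmetric]
    by (simp add: sum.distrib case_prod_beta)
  also have "\<dots> = (\<Sum>(a1, a2)\<in>splits ls. tensor_coder b ((X, a1), (path_tgt (X, a1), a2)))"
    unfolding sum.distrib[symmetric]
  proof (rule sum.cong[OF refl], clarify)
    fix a1 a2 :: "('o, 'o, 'a) letter list"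
    have "(\<Sum>(a, m, t1)\<in>triples a1. fscale (ksgn (path_deg (X, a2)))
         (ftens (coder_term b X (a, m, t1)) (unit_vec (path_tgt (X, a @ m @ t1), a2)))) =
       (\<Sum>x\<in>triples a1. fscale (ksgn (path_deg (X, a2)))
         (ftens (coder_term b X x) (unit_vec (path_tgt (X, a1), a2))))"
      by (rule sum.cong) (auto simp: triples_def)
    then show "(\<Sum>(a2, m, t)\<in>triples a2. ftens (unit_vec (X, a1)) (coder_term b (path_tgt (X, a1)) (a2, m, t))) +
       (\<Sum>(a, m, t1)\<in>triples a1. fscale (ksgn (path_deg (X, a2)))
         (ftens (coder_term b X (a, m, t1)) (unit_vec (path_tgt (X, a @ m @ t1), a2)))) =
       tensor_coder b ((X, a1), path_tgt (X, a1), a2)"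
      by (simp add: tensor_coder_apply coder_eq ftens_sum_left ftens_sum_right case_prod_beta
          fscale_sum_right path_deg_eq[of "path_tgt _" _ X])
  qed
  also have "\<dots> = lin (tensor_coder b) (cut w)"
    by (simp add: w cut_eq sum_cuts lin_sum case_prod_beta)
  finally show ?thesis .
qed


section \<open>Coderivations respect the relations\<close>

lemma place_rels:
  assumes r: "r \<in> rels (susp sc Ob Ob A)"
    and rk: "\<And>l. l \<in> keys r \<Longrightarrow> lsrc l = path_tgt (X, us) \<and> ltgt l = Y"
    and ctx: "X \<in> Ob" "set us \<subseteq> letters Ob Ob (shift A)" "is_path X us"
      "set vs \<subseteq> letters Ob Ob (shift A)" "is_path Y vs" "Suc (length us + length vs) \<in> N"
  shows "lin (\<lambda>l. unit_vec (X, us @ [l] @ vs)) r \<in> rels (Ts_pow N sc Ob A)"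
proof -
  \<comment> \<open>Letters that do not fit the context are sent to 0, so that the map is defined on
    every relation and not just on those with the ends of \<open>r\<close>.\<close>
  let ?f = "\<lambda>l. if lsrc l = path_tgt (X, us) \<and> ltgt l = Y then unit_vec (X, us @ [l] @ vs) else 0"
  have gen: "(X, us @ [l] @ vs) \<in> gen (Ts_pow N sc Ob A)"
    if "l \<in> letters Ob Ob (shift A)" "lsrc l = path_tgt (X, us)" "ltgt l = Y" for l
    using that ctx by simp
  have "lin ?f r \<in> rels (Ts_pow N sc Ob A)"
  proof (rule lin_rels[OF _ r])
    fix c d and k l m :: "('a, 'a, 'b) letter"
    assume *: "k \<in> gen (susp sc Ob Ob A)" "l \<in> gen (susp sc Ob Ob A)" "m \<in> gen (susp sc Ob Ob A)"
      "comb_rel (susp sc Ob Ob A) c d k l m"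
    note eq = comb_rel_suspD[OF *(4)]
    show "?f m - fscale c (?f k) - fscale d (?f l) \<in> rels (Ts_pow N sc Ob A)"
    proof (cases "lsrc m = path_tgt (X, us) \<and> ltgt m = Y")
      case True
      then have "unit_vec (X, us @ [m] @ vs) - fscale c (unit_vec (X, us @ [k] @ vs)) -
          fscale d (unit_vec (X, us @ [l] @ vs)) \<in> rels (Ts_pow N sc Ob A)"
        using * eq by (intro comb_rel_rels gen comb_rel_TsI) auto
      then show ?thesis using True by (simp add: eq)
    qed (auto simp: eq)
  qed
  also have "lin ?f r = lin (\<lambda>l. unit_vec (X, us @ [l] @ vs)) r"
    using rk by (intro lin_cong) simp
  finally show ?thesis .
qed

text \<open>Covers the two given categories and the complexes alike: maps \<open>b n\<close> of
  degree 1 already determine a coderivation.\<close>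

locale quiver_maps =
  fixes sc :: "'k::comm_ring_1 \<Rightarrow> 'a::ab_group_add \<Rightarrow> 'a" and Ob :: "'o set"
    and A :: "'o \<Rightarrow> 'o \<Rightarrow> int \<Rightarrow> 'a set"
    and b :: "nat \<Rightarrow> (('o, 'a) path, ('o, 'o, 'a) letter, 'k) gmap"
  assumes b: "\<And>n. n \<ge> 1 \<Longrightarrow> b n \<in> hom_maps (Ts_pow {n} sc Ob A) (susp sc Ob Ob A) id id 1"
begin

abbreviation "T \<equiv> Ts sc Ob A"
abbreviation "sA \<equiv> susp sc Ob Ob A"

lemma b_homog:
  assumes "(X, a @ m @ t) \<in> gen T" "m \<noteq> []"
  shows "homog sA (path_tgt (X, a)) (path_tgt (X, a @ m)) (path_deg (X, m) + 1)
    (b (length m) (path_tgt (X, a), m))"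
proof -
  have "path_tgt (X, a) \<in> Ob" using assms by (intro path_tgt_mem) auto
  then have "(path_tgt (X, a), m) \<in> gen (Ts_pow {length m} sc Ob A)" using assms by auto
  from hom_maps_homog[OF b this] assms(2) show ?thesis
    using path_deg_eq[of "path_tgt (X, a)" m X] by (simp add: Suc_le_eq)
qed

lemma coder_term_homog:
  assumes g: "(X, a @ m @ t) \<in> gen T" and m: "m \<noteq> []"
  shows "homog T X (path_tgt (X, a @ m @ t)) (path_deg (X, a @ m @ t) + 1) (coder_term b X (a, m, t))"
  unfolding coder_term_def prod.case
proof (intro homog_fscale homog_lin)
  fix l assume "l \<in> keys (b (length m) (path_tgt (X, a), m))"
  note l = homogD[OF b_homog[OF g m] this]
  show "homog T X (path_tgt (X, a @ m @ t)) (path_deg (X, a @ m @ t) + 1) (unit_vec (X, a @ [l] @ t))"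
    using g l by (auto simp: homog_def path_deg_def)
qed

lemma coder_homog:
  assumes "w \<in> gen T"
  shows "homog T (fst w) (path_tgt w) (path_deg w + 1) (coder b w)"
proof -
  obtain X ls where w: "w = (X, ls)" by force
  show ?thesis
    unfolding w coder_eq
  proof (rule homog_sum)
    fix x assume "x \<in> triples ls"
    then obtain a m t where x: "x = (a, m, t)" "a @ m @ t = ls" "m \<noteq> []" by (auto simp: triples_def)
    show "homog T (fst (X, ls)) (path_tgt (X, ls)) (path_deg (X, ls) + 1) (coder_term b X x)"
      using coder_term_homog[of X a m t] x assms w by simp
  qed
qed

lemma coder_term_nonempty:
  "y \<in> keys (coder_term b X x) \<Longrightarrow> snd y \<noteq> []"
  using keys_fscale keys_lin by (fastforce simp: coder_term_def split: prod.splits)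

lemma coder_nonempty:
  assumes "y \<in> keys (coder b w)"
  shows "snd y \<noteq> []"
proof -
  obtain X ls where w: "w = (X, ls)" by force
  have "keys (\<Sum>x\<in>triples ls. coder_term b X x) \<subseteq>
      (\<Union>x\<in>triples ls. keys (coder_term b X x))"
    by (rule keys_sum)
  then show ?thesis
    using assms coder_term_nonempty unfolding w coder_eq by blast
qed

lemma cut_coder':
  assumes "w \<in> gen T"
  shows "lin cut (coder b w) = lin (tensor_coder b) (cut w)"
proof (rule cut_coder)
  fix a m t l
  assume *: "a @ m @ t = snd w" "m \<noteq> []" "l \<in> keys (b (length m) (path_tgt (fst w, a), m))"
  show "ltgt l = path_tgt (fst w, a @ m)"
    using homogD[OF b_homog[of "fst w" a m t] *(3)] *(1,2) assms by (cases w) auto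
qed

text \<open>For fixed positions the changed letter lies to the right of the block fed to
  \<open>b\<close>, inside it, or to its left. Outside, it is part of the context of the new letter;
  inside, the relation is first carried through \<open>b\<close> and its value is then put into a
  fixed context.\<close>

lemma coder_term_rels:
  assumes klm: "k \<in> letters Ob Ob (shift A)" "l \<in> letters Ob Ob (shift A)" "m \<in> letters Ob Ob (shift A)"
    and rel: "comb_rel sA c d k l m" and g: "(X, us @ [m] @ vs) \<in> gen T" and ij: "i < j" "j \<le> length (us @ [m] @ vs)"
  defines "f \<equiv> \<lambda>x. coder_term b X (take i (us @ [x] @ vs), drop i (take j (us @ [x] @ vs)), drop j (us @ [x] @ vs))"
  shows "f m - fscale c (f k) - fscale d (f l) \<in> rels T"
proof -
  note eq = comb_rel_suspD[OF rel]
  let ?r = "\<lambda>u. u m - fscale c (u k) - fscale d (u l)"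
  have r0: "?r unit_vec \<in> rels sA" using klm rel by (intro comb_rel_rels) simp_all
  have place: "?r (\<lambda>x. unit_vec (Z, as @ [x] @ bs)) \<in> rels (Ts_pow N sc Ob A)"
    if "(Z, as @ [m] @ bs) \<in> gen (Ts_pow N sc Ob A)" for Z as bs N
  proof -
    have "lin (\<lambda>x. unit_vec (Z, as @ [x] @ bs)) (?r unit_vec) \<in> rels (Ts_pow N sc Ob A)"
    proof (rule place_rels[OF r0])
      fix x assume "x \<in> keys (?r unit_vec)"
      then have "x \<in> {k, l, m}"
        using keys_diff[of "unit_vec m - fscale c (unit_vec k)" "fscale d (unit_vec l)"]
          keys_diff[of "unit_vec m" "fscale c (unit_vec k)"] keys_fscale[of c "unit_vec k"]
          keys_fscale[of d "unit_vec l"] by auto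
      then show "lsrc x = path_tgt (Z, as) \<and> ltgt x = ltgt m" using that eq by auto
    qed (use that in auto)
    then show ?thesis by (simp add: lin_diff lin_fscale)
  qed
  consider (1) a2 where "j \<le> length us" "us = take i us @ drop i (take j us) @ a2" "a2 = drop j us"
    | (2) as bs where "i \<le> length us" "us = take i us @ as" "vs = bs @ drop (j - Suc (length us)) vs"
      "bs = take (j - Suc (length us)) vs" "as = drop i us" "length us < j"
    | (3) i' j' where "i = Suc (length us + i')" "j = Suc (length us + j')"
  proof -
    consider "j \<le> length us" | "i \<le> length us" "length us < j" | "length us < i" by linarith
    then show ?thesis
    proof cases
      case 1
      then show ?thesis using ij that(1)
        by (metis append.assoc append_take_drop_id less_imp_le min.absorb1 take_take)
    next
      case 2 then show ?thesis by (intro that(2)) auto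
    next
      case 3
      then obtain i' where "i = Suc (length us + i')" using less_iff_Suc_add by auto
      moreover from 3 ij obtain j' where "j = Suc (length us + j')" using less_iff_Suc_add[of "length us" j] by auto
      ultimately show ?thesis by (rule that(3))
    qed
  qed
  then show ?thesis
  proof cases
    case 1
    let ?a = "take i us" and ?m = "drop i (take j us)" and ?a2 = "drop j us"
    let ?q = "b (length ?m) (path_tgt (X, ?a), ?m)"
    have m0: "?m \<noteq> []" using 1(1) ij by simp
    have f: "f x = fscale (ksgn (path_deg (X, ?a2 @ [x] @ vs)))
        (lin (\<lambda>y. unit_vec (X, (?a @ [y] @ ?a2) @ [x] @ vs)) ?q)" for x
      using 1(1) ij by (simp add: f_def coder_term_def)
    \<comment> \<open>Here the changed letter enters the Koszul sign, but only through its degree,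
      which a relation preserves.\<close>
    have deg: "path_deg (X, ?a2 @ [x] @ vs) = path_deg (X, ?a2 @ [m] @ vs)" if "x \<in> {k, l}" for x
      using that eq by (auto simp: path_deg_def)
    have "?r f = fscale (ksgn (path_deg (X, ?a2 @ [m] @ vs)))
        (lin (\<lambda>y. ?r (\<lambda>x. unit_vec (X, (?a @ [y] @ ?a2) @ [x] @ vs))) ?q)"
      unfolding f using deg[of k] deg[of l]
      by (simp add: lin_fun_diff lin_fun_scale fscale_right_diff_distrib mult.commute)
    also have "\<dots> \<in> rels T"
    proof (intro rels_scale lin_mem_rels place)
      fix y assume y: "y \<in> keys ?q"
      have g': "(X, ?a @ ?m @ (?a2 @ [m] @ vs)) \<in> gen T" using g 1(2,3)
        by (metis append.assoc)
      show "(X, (?a @ [y] @ ?a2) @ [m] @ vs) \<in> gen T"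
        using homogD[OF b_homog[OF g' m0] y] g' by auto
    qed
    finally show ?thesis .
  next
    case 2
    let ?a = "take i us" and ?t = "drop (j - Suc (length us)) vs"
    let ?n = "length (as @ [m] @ bs)"
    have f: "f x = fscale (ksgn (path_deg (X, ?t)))
        (lin (\<lambda>y. unit_vec (X, ?a @ [y] @ ?t)) (b ?n (path_tgt (X, ?a), as @ [x] @ bs)))" for x
    proof -
      obtain j' where j': "j = Suc (length us + j')" using 2(6) less_iff_Suc_add by auto
      show ?thesis using 2(1,4,5) ij by (simp add: f_def coder_term_def j')
    qed
    have g': "(X, ?a @ (as @ [m] @ bs) @ ?t) \<in> gen T" using g 2(2,3) by (metis append.assoc)
    have "path_tgt (X, ?a) \<in> Ob" using g' by (intro path_tgt_mem) auto
    then have g2: "(path_tgt (X, ?a), as @ [m] @ bs) \<in> gen (Ts_pow {?n} sc Ob A)" using g' by auto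
    have "lin (b ?n) (?r (\<lambda>x. unit_vec (path_tgt (X, ?a), as @ [x] @ bs))) \<in> rels sA"
      by (rule hom_maps_rels[OF b place[OF g2]]) simp
    then have r: "?r (\<lambda>x. b ?n (path_tgt (X, ?a), as @ [x] @ bs)) \<in> rels sA" (is "?p \<in> _")
      by (simp add: lin_diff lin_fscale)
    have hx: "homog sA (path_tgt (X, ?a)) (path_tgt (X, ?a @ as @ [m] @ bs)) (path_deg (X, as @ [m] @ bs) + 1)
        (b ?n (path_tgt (X, ?a), as @ [x] @ bs))" if x: "x \<in> {k, l, m}" for x
    proof -
      have "(X, ?a @ (as @ [x] @ bs) @ ?t) \<in> gen T" using g' x klm eq by auto
      from b_homog[OF this] show ?thesis using x eq by (auto simp: path_deg_def)
    qed
    have h: "homog sA (path_tgt (X, ?a)) (path_tgt (X, ?a @ as @ [m] @ bs)) (path_deg (X, as @ [m] @ bs) + 1) ?p"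
      by (intro homog_diff homog_fscale hx) auto
    have "lin (\<lambda>y. unit_vec (X, ?a @ [y] @ ?t)) ?p \<in> rels T"
      by (rule place_rels[OF r]) (use homogD[OF h] g' in auto)
    from rels_scale[OF this, of "ksgn (path_deg (X, ?t))"] show ?thesis
      unfolding f by (simp add: lin_diff lin_fscale fscale_right_diff_distrib mult.commute)
  next
    case 3
    let ?a = "us @ [m] @ take i' vs" and ?m = "drop i' (take j' vs)" and ?t = "drop j' vs"
    let ?q = "b (length ?m) (path_tgt (X, ?a), ?m)"
    have m0: "?m \<noteq> []" using 3 ij by simp
    have f: "f x = fscale (ksgn (path_deg (X, ?t)))
        (lin (\<lambda>y. unit_vec (X, us @ [x] @ (take i' vs @ [y] @ ?t))) ?q)" if "x \<in> {k, l, m}" for x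
      using that 3 ij eq by (auto simp: f_def coder_term_def)
    have "?r f = fscale (ksgn (path_deg (X, ?t)))
        (lin (\<lambda>y. ?r (\<lambda>x. unit_vec (X, us @ [x] @ (take i' vs @ [y] @ ?t)))) ?q)"
      using f[of k] f[of l] f[of m]
      by (simp add: lin_fun_diff lin_fun_scale fscale_right_diff_distrib mult.commute)
    also have "\<dots> \<in> rels T"
    proof (intro rels_scale lin_mem_rels place)
      fix y assume y: "y \<in> keys ?q"
      have "vs = take i' vs @ ?m @ ?t"
        using 3 ij by (metis add_less_cancel_left append.assoc append_take_drop_id less_imp_le min.absorb1 Suc_less_eq take_take)
      then have g': "(X, ?a @ ?m @ ?t) \<in> gen T" using g by (metis append.assoc)
      show "(X, us @ [m] @ (take i' vs @ [y] @ ?t)) \<in> gen T"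
        using homogD[OF b_homog[OF g' m0] y] g' by auto
    qed
    finally show ?thesis .
  qed
qed

lemma coder_rels:
  assumes klm: "k \<in> letters Ob Ob (shift A)" "l \<in> letters Ob Ob (shift A)" "m \<in> letters Ob Ob (shift A)"
    and rel: "comb_rel sA c d k l m" and g: "(X, us @ [m] @ vs) \<in> gen T"
  shows "coder b (X, us @ [m] @ vs) - fscale c (coder b (X, us @ [k] @ vs)) -
    fscale d (coder b (X, us @ [l] @ vs)) \<in> rels T"
proof -
  have c: "coder b (X, us @ [x] @ vs) = (\<Sum>j\<le>length (us @ [m] @ vs). \<Sum>i<j.
      coder_term b X (take i (us @ [x] @ vs), drop i (take j (us @ [x] @ vs)), drop j (us @ [x] @ vs)))" for x
    unfolding coder_eq_index by simp
  show ?thesis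
    unfolding c fscale_sum_right sum_subtractf[symmetric]
    by (intro rels_sum coder_term_rels[OF klm rel g]) auto
qed

lemma coder_hom_maps: "coder b \<in> hom_maps T T id id 1"
proof -
  have "lin (coder b) r \<in> rels T" if "r \<in> rels T" for r
  proof (rule lin_rels[OF _ that])
    fix c d u v w assume *: "u \<in> gen T" "v \<in> gen T" "w \<in> gen T" "comb_rel T c d u v w"
    then obtain X us vs k l m where e: "comb_rel sA c d k l m" "u = (X, us @ [k] @ vs)" "v = (X, us @ [l] @ vs)" "w = (X, us @ [m] @ vs)"
      unfolding comb_rel_Ts by blast
    show "coder b w - fscale c (coder b u) - fscale d (coder b v) \<in> rels T"
      unfolding e by (rule coder_rels) (use * e in auto)
  qed
  moreover have "homog T (src T w) (tgt T w) (dgr T w + 1) (coder b w)" if "w \<in> gen T" for w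
    using coder_homog[OF that] by simp
  ultimately show ?thesis
    unfolding hom_maps_def homog_def by (simp del: Ts_sel)
qed

end

declare Ts_sel(1) [simp del]

section \<open>Connections and flatness\<close>

lemma cuts_right_Nil: "{(w1, w2) \<in> cuts w. w2 = (path_tgt w1, [])} = {(w, (path_tgt w, []))}"
  by (cases w) (auto simp: cuts_iff)

lemma cuts_left_Nil: "{(w1, w2) \<in> cuts w. w1 = (fst w2, [])} = {((fst w, []), w)}"
  by (cases w) (auto simp: cuts_iff)

text \<open>Counitality of the cut in summed form: exactly one cut has an empty right piece.\<close>

lemma sum_cuts_right_Nil:
  "(\<Sum>(w1, w2)\<in>cuts w. if w2 = (path_tgt w1, []) then f w1 w2 else 0) = f w (path_tgt w, [])"
proof -
  have "(\<Sum>(w1, w2)\<in>cuts w. if w2 = (path_tgt w1, []) then f w1 w2 else 0) =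
      (\<Sum>(w1, w2)\<in>{(w1, w2) \<in> cuts w. w2 = (path_tgt w1, [])}. f w1 w2)"
    by (intro sum.mono_neutral_cong_right) (auto split: if_splits)
  then show ?thesis by (simp add: cuts_right_Nil)
qed

lemma sum_cuts_left_Nil:
  "(\<Sum>(w1, w2)\<in>cuts w. if w1 = (fst w2, []) then f w1 w2 else 0) = f (fst w, []) w"
proof -
  have "(\<Sum>(w1, w2)\<in>cuts w. if w1 = (fst w2, []) then f w1 w2 else 0) =
      (\<Sum>(w1, w2)\<in>{(w1, w2) \<in> cuts w. w1 = (fst w2, [])}. f w1 w2)"
    by (intro sum.mono_neutral_cong_right) (auto split: if_splits)
  then show ?thesis by (simp add: cuts_left_Nil)
qed

lemma lin_if: "lin (\<lambda>x. if Q then f x else 0) p = (if Q then lin f p else 0)"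
  by simp

lemma coact_left_eq: "coact_left (w, pv) = (\<Sum>(w1, w2)\<in>cuts w. unit_vec (w1, (w2, pv)))"
  by (simp add: coact_left_def gcomp_def tmap_apply cut_eq ftens_sum_left lin_sum case_prod_beta)

lemma coact_right_eq: "coact_right (w, p, v) = (\<Sum>(v1, v2)\<in>cuts v. unit_vec ((w, p, v1), v2))"
  by (simp add: coact_right_def gcomp_def tmap_apply cut_eq ftens_sum_right lin_sum case_prod_beta)

text \<open>This is \<open>1 \<otimes> pr\<^sub>0 \<otimes> 1 \<otimes> 1\<close>: the inner path is
  projected to length 0 and \<open>w\<close> takes its place. Together with
  \<open>graft_right\<close> it undoes the coactions.\<close>

definition graft_left :: "('o, 'a) path \<Rightarrow>
    (('o, 'a, 'p, 'q, 'c) bipath, ('o, 'a, 'p, 'q, 'c) bipath, 'k::comm_ring_1) gmap" where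
  "graft_left w = (\<lambda>(w', pv). if w' = (path_tgt w, []) then unit_vec (w, pv) else 0)"

definition graft_right :: "('q, 'c) path \<Rightarrow>
    (('o, 'a, 'p, 'q, 'c) bipath, ('o, 'a, 'p, 'q, 'c) bipath, 'k::comm_ring_1) gmap" where
  "graft_right v = (\<lambda>(w, p, v'). if v' = (fst v, []) then unit_vec (w, p, v) else 0)"

text \<open>The joint effect of both graftings after \<open>pr010\<close>. The value 0 for ends that
  do not match makes it a map on all of \<open>sP\<close>, so that it respects every
  relation.\<close>

definition insert_letter :: "('o, 'a) path \<Rightarrow> ('q, 'c) path \<Rightarrow>
    (('o, 'q, 'p) letter, ('o, 'a, 'p, 'q, 'c) bipath, 'k::comm_ring_1) gmap" where
  "insert_letter w v = (\<lambda>p. if lsrc p = path_tgt w \<and> ltgt p = fst v then unit_vec (w, p, v) else 0)"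

text \<open>The counit axiom: of all cuts of the left path only the one with empty right piece
  survives.\<close>

lemma lin_coact_left_section:
  "lin (\<lambda>(w, u). graft_left w u) (coact_left g) = unit_vec g"
proof -
  obtain w pv where g: "g = (w, pv)" by (metis surj_pair)
  have "lin (\<lambda>(w, u). graft_left w u) (coact_left g) =
      (\<Sum>(w1, w2)\<in>cuts w. if w2 = (path_tgt w1, []) then unit_vec (w1, pv) else 0)"
    unfolding g coact_left_eq lin_sum by (rule sum.cong) (auto simp: graft_left_def)
  then show ?thesis by (simp add: sum_cuts_right_Nil g)
qed

lemma lin_coact_right_section:
  "lin (\<lambda>(u, v). graft_right v u) (coact_right g) = unit_vec g"
proof -
  obtain w p v where g: "g = (w, p, v)" by (metis surj_pair)
  have "lin (\<lambda>(u, v). graft_right v u) (coact_right g) =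
      (\<Sum>(v1, v2)\<in>cuts v. if v1 = (fst v2, []) then unit_vec (w, p, v2) else 0)"
    unfolding g coact_right_eq lin_sum by (rule sum.cong) (auto simp: graft_right_def)
  then show ?thesis by (simp add: sum_cuts_left_Nil g)
qed

locale ainf_pair =
  fixes scA :: "'k::comm_ring_1 \<Rightarrow> 'a::ab_group_add \<Rightarrow> 'a"
    and scC :: "'k \<Rightarrow> 'c::ab_group_add \<Rightarrow> 'c"
    and ObA :: "'o set" and A :: "'o \<Rightarrow> 'o \<Rightarrow> int \<Rightarrow> 'a set"
    and bA :: "nat \<Rightarrow> (('o, 'a) path, ('o, 'o, 'a) letter, 'k) gmap"
    and ObC :: "'q set" and C :: "'q \<Rightarrow> 'q \<Rightarrow> int \<Rightarrow> 'c set"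
    and bC :: "nat \<Rightarrow> (('q, 'c) path, ('q, 'q, 'c) letter, 'k) gmap"
  assumes catA: "ainf_category scA ObA A bA"
    and catC: "ainf_category scC ObC C bC"
begin

sublocale qA: quiver_maps scA ObA A bA
  using catA by unfold_locales (simp add: ainf_category_def)

sublocale qC: quiver_maps scC ObC C bC
  using catC by unfold_locales (simp add: ainf_category_def)

abbreviation "TA \<equiv> Ts scA ObA A"
abbreviation "TC \<equiv> Ts scC ObC C"

lemma coderA_square: "w \<in> gen TA \<Longrightarrow> lin (coder bA) (coder bA w) \<in> rels TA"
  using catA by (simp add: ainf_category_def eq_on_def gcomp_def)

lemma coderC_square: "v \<in> gen TC \<Longrightarrow> lin (coder bC) (coder bC v) \<in> rels TC"
  using catC by (simp add: ainf_category_def eq_on_def gcomp_def)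

end

locale bicomodule_connection = ainf_pair scA scC ObA A bA ObC C bC
  for scA :: "'k::comm_ring_1 \<Rightarrow> 'a::ab_group_add \<Rightarrow> 'a"
    and scC :: "'k \<Rightarrow> 'c::ab_group_add \<Rightarrow> 'c"
    and ObA :: "'o set" and A bA and ObC :: "'q set" and C bC +
  fixes scP :: "'k \<Rightarrow> 'p::ab_group_add \<Rightarrow> 'p"
    and P :: "'o \<Rightarrow> 'q \<Rightarrow> int \<Rightarrow> 'p set"
    and bP :: "(('o, 'a, 'p, 'q, 'c) bipath, ('o, 'a, 'p, 'q, 'c) bipath, 'k) gmap"
  assumes spanP: "graded_span scP ObA ObC P"
    and conn: "connection scA ObA A bA scC ObC C bC scP P bP"
begin

abbreviation "sP \<equiv> susp scP ObA ObC P"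
abbreviation "S \<equiv> bicom scA ObA A scC ObC C scP P"

lemma gen_S: "(w, p, v) \<in> gen S \<longleftrightarrow> w \<in> gen TA \<and> p \<in> gen sP \<and> v \<in> gen TC \<and>
    path_tgt w = lsrc p \<and> ltgt p = fst v"
  by (auto simp: bicom_def gen_tens)

lemma S_sel [simp]: "src S (w, p, v) = fst w" "tgt S (w, p, v) = path_tgt v"
    "dgr S (w, p, v) = path_deg w + ldeg p + path_deg v"
  by (simp_all add: bicom_def)

lemma dgr_S: "dgr S = bipath_deg"
  by (auto simp: fun_eq_iff bipath_deg_def)

lemma comb_rel_S: "comb_rel S c d (w1, p1, v1) (w2, p2, v2) (w3, p3, v3) \<longleftrightarrow>
    comb_rel TA c d w1 w2 w3 \<and> p1 = p3 \<and> p2 = p3 \<and> v1 = v3 \<and> v2 = v3 \<or>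
    w1 = w3 \<and> w2 = w3 \<and> comb_rel sP c d p1 p2 p3 \<and> v1 = v3 \<and> v2 = v3 \<or>
    w1 = w3 \<and> w2 = w3 \<and> p1 = p3 \<and> p2 = p3 \<and> comb_rel TC c d v1 v2 v3"
  by (auto simp: bicom_def comb_rel_tens)

lemma homogeneous_rels_S: "homogeneous_rels S"
  unfolding bicom_def by (intro homogeneous_rels_tens homogeneous_rels_Ts homogeneous_rels_susp)

lemma bP_hom_maps: "bP \<in> hom_maps S S id id 1"
  using conn by (simp add: connection_def Let_def)

lemma bP_homog: "(w, p, v) \<in> gen S \<Longrightarrow>
    homog S (fst w) (path_tgt v) (path_deg w + ldeg p + path_deg v + 1) (bP (w, p, v))"
  using hom_maps_homog[OF bP_hom_maps] by fastforce

definition "M_left = tmap bipath_deg 0 idm bP + tmap bipath_deg 1 (coder bA) idm"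
definition "M_right = tmap path_deg 0 idm (coder bC) + tmap path_deg 1 bP idm"

lemma bP_coact_left: "g \<in> gen S \<Longrightarrow>
    eqv (tens TA S) (lin coact_left (bP g)) (lin M_left (coact_left g))"
  using conn by (simp add: connection_def Let_def eq_on_def gcomp_def eqv_def M_left_def)

lemma bP_coact_right: "g \<in> gen S \<Longrightarrow>
    eqv (tens S TC) (lin coact_right (bP g)) (lin M_right (coact_right g))"
  using conn by (simp add: connection_def Let_def eq_on_def gcomp_def eqv_def M_right_def)

text \<open>A relation in the inner path replaces a letter, so all three inner paths are nonempty
  and are killed. Any other relation leaves the inner path fixed; if that path is empty, the
  relation becomes one of \<open>S\<close>.\<close>

lemma graft_left_rels:
  assumes "r \<in> rels (tens TA S)"
  shows "lin (\<lambda>(w, u). graft_left w u) r \<in> rels S"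
proof (rule lin_rels[OF _ assms])
  fix c d x y z assume g: "x \<in> gen (tens TA S)" "y \<in> gen (tens TA S)" "z \<in> gen (tens TA S)"
    and r: "comb_rel (tens TA S) c d x y z"
  obtain x0 x1 x2 x3 y0 y1 y2 y3 z0 z1 z2 z3 where
    [simp]: "x = (x0, x1, x2, x3)" "y = (y0, y1, y2, y3)" "z = (z0, z1, z2, z3)"
    by (metis surj_pair)
  note ne = comb_rel_Ts_nonempty[of UNIV scA ObA A c d x1 y1 z1]
  show "(case z of (w, u) \<Rightarrow> graft_left w u) - fscale c (case x of (w, u) \<Rightarrow> graft_left w u) -
      fscale d (case y of (w, u) \<Rightarrow> graft_left w u) \<in> rels S"
  proof (cases "snd z1 = []")
    case True
    have e: "x1 = z1" "y1 = z1" and "comb_rel S c d (x0, x2, x3) (y0, y2, y3) (z0, z2, z3)"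
      using r True ne by (auto simp: comb_rel_tens comb_rel_S)
    moreover have "x1 = (path_tgt x0, [])" "y1 = (path_tgt y0, [])" "z1 = (path_tgt z0, [])"
      using g True e by (auto simp: gen_tens intro: prod_eqI)
    ultimately show ?thesis
      using g by (auto simp: graft_left_def gen_tens gen_S intro!: comb_rel_rels)
  next
    case False
    then have "snd x1 \<noteq> []" "snd y1 \<noteq> []" using r ne by (auto simp: comb_rel_tens comb_rel_S)
    with False show ?thesis by (auto simp: graft_left_def)
  qed
qed

lemma graft_right_rels:
  assumes "r \<in> rels (tens S TC)"
  shows "lin (\<lambda>(u, v). graft_right v u) r \<in> rels S"
proof (rule lin_rels[OF _ assms])
  fix c d x y z assume g: "x \<in> gen (tens S TC)" "y \<in> gen (tens S TC)" "z \<in> gen (tens S TC)"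
    and r: "comb_rel (tens S TC) c d x y z"
  obtain x0 x1 x2 x3 y0 y1 y2 y3 z0 z1 z2 z3 where
    [simp]: "x = ((x0, x1, x2), x3)" "y = ((y0, y1, y2), y3)" "z = ((z0, z1, z2), z3)"
    by (metis surj_pair)
  note ne = comb_rel_Ts_nonempty[of UNIV scC ObC C c d x2 y2 z2]
  show "(case z of (u, v) \<Rightarrow> graft_right v u) - fscale c (case x of (u, v) \<Rightarrow> graft_right v u) -
      fscale d (case y of (u, v) \<Rightarrow> graft_right v u) \<in> rels S"
  proof (cases "snd z2 = []")
    case True
    have e: "x2 = z2" "y2 = z2" and "comb_rel S c d (x0, x1, x3) (y0, y1, y3) (z0, z1, z3)"
      using r True ne by (auto simp: comb_rel_tens comb_rel_S)
    moreover have "x2 = (fst x3, [])" "y2 = (fst y3, [])" "z2 = (fst z3, [])"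
      using g True e by (auto simp: gen_tens path_tgt_def intro: prod_eqI)
    ultimately show ?thesis
      using g by (auto simp: graft_right_def gen_tens gen_S intro!: comb_rel_rels)
  next
    case False
    then have "snd x2 \<noteq> []" "snd y2 \<noteq> []" using r ne by (auto simp: comb_rel_tens comb_rel_S)
    with False show ?thesis by (auto simp: graft_right_def)
  qed
qed

lemma lin_graft_left_eqv:
  assumes w: "w \<in> gen TA" and r: "eqv S p q"
    and h: "homog S (path_tgt w) Y d p" "homog S (path_tgt w) Y d q"
  shows "eqv S (lin (graft_left w) p) (lin (graft_left w) q)"
proof -
  have "ftens (unit_vec w) (p - q) \<in> rels (tens TA S)"
    by (rule ftens_rels_right[OF homogeneous_rels_S _ r[unfolded eqv_def]])
      (use w homogD(2)[OF homog_diff[OF h]] in auto)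
  from graft_left_rels[OF this] show ?thesis by (simp add: lin_ftens eqv_def lin_diff)
qed

lemma lin_graft_right_homog:
  assumes v: "v \<in> gen TC" and h: "homog S X (fst v) d q"
  shows "homog S X (path_tgt v) (d + path_deg v) (lin (graft_right v) q)"
proof (rule homog_lin)
  fix u assume "u \<in> keys q"
  note u = homogD[OF h this]
  obtain x y z where [simp]: "u = (x, y, z)" by (metis surj_pair)
  show "homog S X (path_tgt v) (d + path_deg v) (graft_right v u)"
    using u v by (auto simp: graft_right_def homog_def gen_S)
qed

lemma insert_letter_rels:
  assumes w: "w \<in> gen TA" and v: "v \<in> gen TC" and r: "r \<in> rels sP"
  shows "lin (insert_letter w v) r \<in> rels S"
proof (rule lin_rels[OF _ r])
  fix c d k l m assume *: "k \<in> gen sP" "l \<in> gen sP" "m \<in> gen sP" "comb_rel sP c d k l m"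
  note e = comb_rel_suspD[OF *(4)]
  show "insert_letter w v m - fscale c (insert_letter w v k) - fscale d (insert_letter w v l) \<in> rels S"
  proof (cases "lsrc m = path_tgt w \<and> ltgt m = fst v")
    case True
    then have "unit_vec (w, m, v) - fscale c (unit_vec (w, k, v)) - fscale d (unit_vec (w, l, v)) \<in> rels S"
      using * w v e by (intro comb_rel_rels) (auto simp: gen_S comb_rel_S)
    then show ?thesis using True by (simp add: insert_letter_def e)
  qed (auto simp: insert_letter_def e)
qed

lemma pr010_rels:
  assumes "r \<in> rels S"
  shows "lin pr010 r \<in> rels sP"
proof (rule lin_rels[OF _ assms])
  fix c d x y z assume g: "x \<in> gen S" "y \<in> gen S" "z \<in> gen S" and r: "comb_rel S c d x y z"
  obtain x0 x1 x2 y0 y1 y2 z0 z1 z2 where [simp]: "x = (x0, x1, x2)" "y = (y0, y1, y2)" "z = (z0, z1, z2)"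
    by (metis surj_pair)
  show "pr010 z - fscale c (pr010 x) - fscale d (pr010 y) \<in> rels sP"
    using r g comb_rel_Ts_nonempty[of UNIV scA ObA A c d x0 y0 z0] comb_rel_Ts_nonempty[of UNIV scC ObC C c d x2 y2 z2]
    by (auto simp: comb_rel_S pr010_def gen_S intro!: comb_rel_rels)
qed

lemma pr010_homog:
  assumes "homog S X Y d q"
  shows "homog sP X Y d (lin pr010 q)"
proof (rule homog_lin)
  fix u assume "u \<in> keys q"
  note u = homogD[OF assms this]
  obtain w p v where [simp]: "u = (w, p, v)" by (metis surj_pair)
  show "homog sP X Y d (pr010 u)"
    using u by (auto simp: pr010_def homog_def gen_S path_tgt_def path_deg_def)
qed

text \<open>The two graftings keep a term only if its inner paths are both empty, which is precisely
  what \<open>pr010\<close> retains.\<close>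

lemma graft_left_right:
  assumes "homog S (path_tgt w) (fst v) d q"
  shows "lin (graft_left w) (lin (graft_right v) q) = lin (insert_letter w v) (lin pr010 q)"
  unfolding lin_lin
proof (rule lin_cong)
  fix u assume "u \<in> keys q"
  note u = homogD[OF assms this]
  obtain a p c where e: "u = (a, p, c)" by (metis surj_pair)
  have a: "a = (path_tgt w, []) \<longleftrightarrow> snd a = []" and c: "c = (fst v, []) \<longleftrightarrow> snd c = []"
    using u(2,3) by (cases a; cases c; auto simp: e)+
  show "lin (graft_left w) (graft_right v u) = lin (insert_letter w v) (pr010 u)"
  proof (cases "snd a = [] \<and> snd c = []")
    case True
    then have ac: "a = (path_tgt w, [])" "c = (fst v, [])" using a c by auto
    have "lsrc p = path_tgt w" "ltgt p = fst v"
      using u(1) by (auto simp: e ac gen_S)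
    then show ?thesis
      by (simp add: e ac graft_left_def graft_right_def pr010_def insert_letter_def)
  next
    case False
    then have "graft_right v u = 0 \<or> a \<noteq> (path_tgt w, [])"
      using a c by (auto simp: e graft_right_def)
    then show ?thesis
      using False by (auto simp: e graft_left_def graft_right_def pr010_def)
  qed
qed

text \<open>The components \<open>b\<^sup>P\<^sub>k\<^sub>n\<close> for all \<open>k\<close> and
  \<open>n\<close> at once.\<close>

definition "\<beta> g = lin pr010 (bP g)"

lemma \<beta>_homog: "(w, p, v) \<in> gen S \<Longrightarrow>
    homog sP (fst w) (path_tgt v) (path_deg w + ldeg p + path_deg v + 1) (\<beta> (w, p, v))"
  unfolding \<beta>_def by (intro pr010_homog bP_homog)

lemma gen_S_cut_left:
  assumes "(w, p, v) \<in> gen S" "(w1, w2) \<in> cuts w"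
  shows "w1 \<in> gen TA" "w2 \<in> gen TA" "(w2, p, v) \<in> gen S" "fst w2 = path_tgt w1"
  using assms cuts_gen[OF assms(2)] cuts_tgt[OF assms(2)] by (auto simp: gen_S cuts_iff)

lemma gen_S_cut_right:
  assumes "(w, p, v) \<in> gen S" "(v1, v2) \<in> cuts v"
  shows "v1 \<in> gen TC" "v2 \<in> gen TC" "(w, p, v1) \<in> gen S" "fst v2 = path_tgt v1"
  using assms cuts_gen[OF assms(2)] by (auto simp: gen_S cuts_iff)

text \<open>Grafting undoes the left coaction, so it turns the left connection equation into a
  formula for \<open>bP\<close>. In the part containing \<open>b\<^sup>A\<close> only the cut with
  empty right piece remains.\<close>

lemma bP_left:
  assumes g: "(w, pv) \<in> gen S"
  shows "eqv S (bP (w, pv)) ((\<Sum>(w1, w2)\<in>cuts w. lin (graft_left w1) (bP (w2, pv))) +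
    fscale (ksgn (tail_deg pv)) (ftens (coder bA w) (unit_vec pv)))"
proof -
  let ?g = "\<lambda>(w, u). graft_left w u"
  have "bP (w, pv) = lin ?g (lin coact_left (bP (w, pv)))"
    by (simp add: lin_lin lin_coact_left_section)
  also have "eqv S \<dots> (lin ?g (lin M_left (coact_left (w, pv))))"
    by (intro eqv_lin[OF bP_coact_left[OF g]] graft_left_rels)
  also have "lin ?g (lin M_left (coact_left (w, pv))) =
      (\<Sum>(w1, w2)\<in>cuts w. lin (graft_left w1) (bP (w2, pv)) +
         (if w2 = (path_tgt w1, []) then fscale (ksgn (bipath_deg (w2, pv))) (ftens (coder bA w1) (unit_vec pv)) else 0))"
    unfolding coact_left_eq lin_sum
  proof (rule sum_cuts_cong', unfold prod.case)
    fix w1 w2 assume *: "(w1, w2) \<in> cuts w"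
    have h: "homog TA (fst w1) (path_tgt w1) (path_deg w1 + 1) (coder bA w1)"
      using gen_S_cut_left(1)[of w "fst pv" "snd pv"] g * by (intro qA.coder_homog) simp
    \<comment> \<open>A coderivation preserves targets, so the test made for each generator of
      \<open>coder bA w1\<close> is the same test for \<open>w1\<close>.\<close>
    have "lin (\<lambda>x. graft_left x (w2, pv)) (coder bA w1) =
        (if w2 = (path_tgt w1, []) then ftens (coder bA w1) (unit_vec pv) else 0)"
    proof -
      have "lin (\<lambda>x. graft_left x (w2, pv)) (coder bA w1) =
          lin (\<lambda>x. if w2 = (path_tgt w1, []) then unit_vec (x, pv) else 0) (coder bA w1)"
        using homogD[OF h] by (intro lin_cong) (auto simp: graft_left_def)
      then show ?thesis
        by (simp only: lin_if ftens_unit_right)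
    qed
    then show "lin ?g (lin M_left (unit_vec (w1, w2, pv))) =
        lin (graft_left w1) (bP (w2, pv)) + (if w2 = (path_tgt w1, [])
          then fscale (ksgn (bipath_deg (w2, pv))) (ftens (coder bA w1) (unit_vec pv)) else 0)"
      by (simp add: M_left_def tmap_apply lin_add lin_fscale lin_ftens)
  qed
  also have "\<dots> = (\<Sum>(w1, w2)\<in>cuts w. lin (graft_left w1) (bP (w2, pv))) +
      (\<Sum>(w1, w2)\<in>cuts w. if w2 = (path_tgt w1, []) then fscale (ksgn (bipath_deg (w2, pv))) (ftens (coder bA w1) (unit_vec pv)) else 0)"
    by (simp add: sum.distrib case_prod_beta)
  finally show ?thesis
    unfolding sum_cuts_right_Nil by (simp add: bipath_deg_def tail_deg_def case_prod_beta)
qed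

lemma bP_right:
  assumes g: "(w, p, v) \<in> gen S"
  shows "eqv S (bP (w, p, v)) ((\<Sum>(v1, v2)\<in>cuts v. fscale (ksgn (path_deg v2)) (lin (graft_right v2) (bP (w, p, v1)))) +
    lin (\<lambda>v'. unit_vec (w, p, v')) (coder bC v))"
proof -
  let ?g = "\<lambda>(u, v). graft_right v u"
  have "bP (w, p, v) = lin ?g (lin coact_right (bP (w, p, v)))"
    by (simp add: lin_lin lin_coact_right_section)
  also have "eqv S \<dots> (lin ?g (lin M_right (coact_right (w, p, v))))"
    by (intro eqv_lin[OF bP_coact_right[OF g]] graft_right_rels)
  also have "lin ?g (lin M_right (coact_right (w, p, v))) =
      (\<Sum>(v1, v2)\<in>cuts v. fscale (ksgn (path_deg v2)) (lin (graft_right v2) (bP (w, p, v1))) +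
         (if v1 = (fst v2, []) then lin (\<lambda>v'. unit_vec (w, p, v')) (coder bC v2) else 0))"
    unfolding coact_right_eq lin_sum
  proof (rule sum_cuts_cong', unfold prod.case)
    fix v1 v2 assume *: "(v1, v2) \<in> cuts v"
    have h: "homog TC (fst v2) (path_tgt v2) (path_deg v2 + 1) (coder bC v2)"
      using gen_S_cut_right(2)[OF g *] by (intro qC.coder_homog)
    have "lin (\<lambda>x. graft_right x (w, p, v1)) (coder bC v2) =
        (if v1 = (fst v2, []) then lin (\<lambda>v'. unit_vec (w, p, v')) (coder bC v2) else 0)"
    proof -
      have "lin (\<lambda>x. graft_right x (w, p, v1)) (coder bC v2) =
          lin (\<lambda>x. if v1 = (fst v2, []) then unit_vec (w, p, x) else 0) (coder bC v2)"
        using homogD[OF h] by (intro lin_cong) (auto simp: graft_right_def)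
      then show ?thesis
        by (simp only: lin_if)
    qed
    then show "lin ?g (lin M_right (unit_vec ((w, p, v1), v2))) =
        fscale (ksgn (path_deg v2)) (lin (graft_right v2) (bP (w, p, v1))) +
        (if v1 = (fst v2, []) then lin (\<lambda>v'. unit_vec (w, p, v')) (coder bC v2) else 0)"
      by (simp add: M_right_def tmap_apply lin_add lin_fscale lin_ftens)
  qed
  also have "\<dots> = (\<Sum>(v1, v2)\<in>cuts v. fscale (ksgn (path_deg v2)) (lin (graft_right v2) (bP (w, p, v1)))) +
      (\<Sum>(v1, v2)\<in>cuts v. if v1 = (fst v2, []) then lin (\<lambda>v'. unit_vec (w, p, v')) (coder bC v2) else 0)"
    by (simp add: sum.distrib case_prod_beta)
  finally show ?thesis
    unfolding sum_cuts_left_Nil .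
qed

text \<open>The explicit form of a connection: components inserted between outer pieces, plus
  \<open>b\<^sup>A\<close> and \<open>b\<^sup>C\<close> acting on the outer factors. It arises by
  substituting \<open>bP_right\<close> into \<open>bP_left\<close>; grafting lets the
  \<open>b\<^sup>C\<close> part contribute for the empty right piece of \<open>w\<close>
  only.\<close>

lemma bP_formula:
  assumes g: "(w, p, v) \<in> gen S"
  shows "eqv S (bP (w, p, v)) ((\<Sum>(w1, w2)\<in>cuts w. \<Sum>(v1, v2)\<in>cuts v.
      fscale (ksgn (path_deg v2)) (lin (insert_letter w1 v2) (\<beta> (w2, p, v1)))) +
    fscale (ksgn (ldeg p + path_deg v)) (lin (\<lambda>w'. unit_vec (w', p, v)) (coder bA w)) +
    lin (\<lambda>v'. unit_vec (w, p, v')) (coder bC v))"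
proof -
  have 1: "eqv S (lin (graft_left w1) (bP (w2, p, v)))
      ((\<Sum>(v1, v2)\<in>cuts v. fscale (ksgn (path_deg v2)) (lin (insert_letter w1 v2) (\<beta> (w2, p, v1)))) +
       (if w2 = (path_tgt w1, []) then lin (\<lambda>v'. unit_vec (w1, p, v')) (coder bC v) else 0))"
    if c: "(w1, w2) \<in> cuts w" for w1 w2
  proof -
    note gc = gen_S_cut_left[OF g c]
    let ?q = "(\<Sum>(v1, v2)\<in>cuts v. fscale (ksgn (path_deg v2)) (lin (graft_right v2) (bP (w2, p, v1)))) +
      lin (\<lambda>v'. unit_vec (w2, p, v')) (coder bC v)" and ?d = "path_deg w2 + ldeg p + path_deg v + 1"
    \<comment> \<open>Grafting \<open>w1\<close> preserves congruence only between representatives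
      whose source is the end of \<open>w1\<close>.\<close>
    have "homog S (path_tgt w1) (path_tgt v) ?d ?q"
    proof (intro homog_add homog_sum_cuts homog_fscale)
      fix v1 v2 assume c: "(v1, v2) \<in> cuts v"
      note gd = gen_S_cut_right[OF gc(3) c]
      show "homog S (path_tgt w1) (path_tgt v) ?d (lin (graft_right v2) (bP (w2, p, v1)))"
        using lin_graft_right_homog[OF gd(2), folded gd(4)] bP_homog[OF gd(3)] gc(4) gd(4) cuts_tgt[OF c] cuts_deg[OF c]
        by (fastforce simp: add_ac)
    next
      have "v \<in> gen TC" using g by (simp add: gen_S)
      note h = qC.coder_homog[OF this]
      show "homog S (path_tgt w1) (path_tgt v) ?d (lin (\<lambda>v'. unit_vec (w2, p, v')) (coder bC v))"
        by (rule homog_lin) (use homogD[OF h] gc in \<open>auto simp: homog_def gen_S\<close>)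
    qed
    then have "eqv S (lin (graft_left w1) (bP (w2, p, v))) (lin (graft_left w1) ?q)"
      using lin_graft_left_eqv[OF gc(1) bP_right[OF gc(3)]] bP_homog[OF gc(3)] gc(4) by simp
    also have "lin (graft_left w1) ?q =
        (\<Sum>(v1, v2)\<in>cuts v. fscale (ksgn (path_deg v2)) (lin (graft_left w1) (lin (graft_right v2) (bP (w2, p, v1))))) +
        lin (\<lambda>v'. graft_left w1 (w2, p, v')) (coder bC v)"
      by (simp add: lin_add lin_sum lin_fscale case_prod_beta lin_lin)
    also have "(\<Sum>(v1, v2)\<in>cuts v. fscale (ksgn (path_deg v2)) (lin (graft_left w1) (lin (graft_right v2) (bP (w2, p, v1))))) =
        (\<Sum>(v1, v2)\<in>cuts v. fscale (ksgn (path_deg v2)) (lin (insert_letter w1 v2) (\<beta> (w2, p, v1))))"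
    proof (rule sum_cuts_cong)
      fix v1 v2 assume c: "(v1, v2) \<in> cuts v"
      note gd = gen_S_cut_right[OF gc(3) c]
      show "fscale (ksgn (path_deg v2)) (lin (graft_left w1) (lin (graft_right v2) (bP (w2, p, v1)))) =
        fscale (ksgn (path_deg v2)) (lin (insert_letter w1 v2) (\<beta> (w2, p, v1)))"
        using graft_left_right[of w1 v2 _ "bP (w2, p, v1)"] bP_homog[OF gd(3)] gc(4) gd(4)
        by (simp add: \<beta>_def)
    qed
    also have "lin (\<lambda>v'. graft_left w1 (w2, p, v')) (coder bC v) =
        (if w2 = (path_tgt w1, []) then lin (\<lambda>v'. unit_vec (w1, p, v')) (coder bC v) else 0)"
      unfolding graft_left_def prod.case by (rule lin_if)
    finally show ?thesis .
  qed
  have "eqv S (bP (w, p, v)) ((\<Sum>(w1, w2)\<in>cuts w. lin (graft_left w1) (bP (w2, p, v))) +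
    fscale (ksgn (tail_deg (p, v))) (ftens (coder bA w) (unit_vec (p, v))))"
    by (rule bP_left[OF g])
  also have "eqv S \<dots> ((\<Sum>(w1, w2)\<in>cuts w.
      ((\<Sum>(v1, v2)\<in>cuts v. fscale (ksgn (path_deg v2)) (lin (insert_letter w1 v2) (\<beta> (w2, p, v1)))) +
       (if w2 = (path_tgt w1, []) then lin (\<lambda>v'. unit_vec (w1, p, v')) (coder bC v) else 0))) +
    fscale (ksgn (tail_deg (p, v))) (ftens (coder bA w) (unit_vec (p, v))))"
    by (intro eqv_add eqv_sum eqv_refl) (use 1 in auto)
  also have "(\<Sum>(w1, w2)\<in>cuts w.
      ((\<Sum>(v1, v2)\<in>cuts v. fscale (ksgn (path_deg v2)) (lin (insert_letter w1 v2) (\<beta> (w2, p, v1)))) +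
       (if w2 = (path_tgt w1, []) then lin (\<lambda>v'. unit_vec (w1, p, v')) (coder bC v) else 0))) =
    (\<Sum>(w1, w2)\<in>cuts w. \<Sum>(v1, v2)\<in>cuts v. fscale (ksgn (path_deg v2)) (lin (insert_letter w1 v2) (\<beta> (w2, p, v1)))) +
    (\<Sum>(w1, w2)\<in>cuts w. if w2 = (path_tgt w1, []) then lin (\<lambda>v'. unit_vec (w1, p, v')) (coder bC v) else 0)"
    by (simp add: sum.distrib case_prod_beta)
  finally show ?thesis
    unfolding sum_cuts_right_Nil by (simp add: tail_deg_def ftens_unit_right add_ac)
qed

section \<open>The square of a connection and its components\<close>

definition "D g = lin bP (bP g)"

lemma D_homog: "(w, p, v) \<in> gen S \<Longrightarrow>
    homog S (fst w) (path_tgt v) (path_deg w + ldeg p + path_deg v + 2) (D (w, p, v))"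
  using hom_maps_homog_lin[OF bP_hom_maps bP_homog] unfolding D_def by (fastforce simp: add.assoc)

lemma M_left_rels: "r \<in> rels (tens TA S) \<Longrightarrow> lin M_left r \<in> rels (tens TA S)"
proof -
  assume r: "r \<in> rels (tens TA S)"
  have "lin (tmap bipath_deg 0 idm bP) r \<in> rels (tens TA S)"
    by (rule tmap_rels[OF homogeneous_rels_Ts homogeneous_rels_S homogeneous_rels_Ts homogeneous_rels_S
          idm_hom_maps bP_hom_maps r]) (simp add: dgr_S)
  moreover have "lin (tmap bipath_deg 1 (coder bA) idm) r \<in> rels (tens TA S)"
    by (rule tmap_rels[OF homogeneous_rels_Ts homogeneous_rels_S homogeneous_rels_Ts homogeneous_rels_S
          qA.coder_hom_maps idm_hom_maps r]) (simp add: dgr_S)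
  ultimately show ?thesis
    unfolding M_left_def plus_fun_def lin_fun_add by (rule rels_add)
qed

lemma M_right_rels: "r \<in> rels (tens S TC) \<Longrightarrow> lin M_right r \<in> rels (tens S TC)"
proof -
  assume r: "r \<in> rels (tens S TC)"
  have "lin (tmap path_deg 0 idm (coder bC)) r \<in> rels (tens S TC)"
    by (rule tmap_rels[OF homogeneous_rels_S homogeneous_rels_Ts homogeneous_rels_S homogeneous_rels_Ts
          idm_hom_maps qC.coder_hom_maps r]) simp
  moreover have "lin (tmap path_deg 1 bP idm) r \<in> rels (tens S TC)"
    by (rule tmap_rels[OF homogeneous_rels_S homogeneous_rels_Ts homogeneous_rels_S homogeneous_rels_Ts
          bP_hom_maps idm_hom_maps r]) simp
  ultimately show ?thesis
    unfolding M_right_def plus_fun_def lin_fun_add by (rule rels_add)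
qed

text \<open>The coaction equation is applied twice. By \<open>tensor_derivation_square\<close> the
  mixed terms cancel, and the square of \<open>b\<^sup>A\<close> is a relation. So \<open>D\<close>
  commutes with the coaction without any correction term.\<close>

lemma D_left:
  assumes g: "(w, p, v) \<in> gen S"
  shows "eqv S (D (w, p, v)) (\<Sum>(w1, w2)\<in>cuts w. lin (graft_left w1) (D (w2, p, v)))"
proof -
  let ?g = "\<lambda>(w, u). graft_left w u"
  have "eqv (tens TA S) (lin coact_left (D (w, p, v))) (lin M_left (lin coact_left (bP (w, p, v))))"
    unfolding D_def lin_lin
    using homogD(1)[OF bP_homog[OF g]] by (intro eqv_lin_cong bP_coact_left)
  also have "eqv (tens TA S) \<dots> (lin M_left (lin M_left (coact_left (w, p, v))))"
    by (rule eqv_lin[OF bP_coact_left[OF g] M_left_rels])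
  also have "\<dots> = (\<Sum>(w1, w2)\<in>cuts w. lin M_left (M_left (w1, (w2, p, v))))"
    by (simp add: coact_left_eq lin_sum case_prod_beta)
  also have "eqv (tens TA S) \<dots> (\<Sum>(w1, w2)\<in>cuts w. ftens (unit_vec w1) (D (w2, p, v)))"
  proof (rule eqv_sum_cuts)
    fix w1 w2 assume c: "(w1, w2) \<in> cuts w"
    note gc = gen_S_cut_left[OF g c]
    have sq: "lin M_left (M_left (w1, (w2, p, v))) =
        ftens (unit_vec w1) (D (w2, p, v)) + ftens (lin (coder bA) (coder bA w1)) (unit_vec (w2, p, v))"
      unfolding M_left_def D_def
      by (rule tensor_derivation_square)
        (use homogD(4)[OF bP_homog[OF gc(3)]] in \<open>auto simp: dgr_S bipath_deg_def\<close>)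
    have "ftens (lin (coder bA) (coder bA w1)) (unit_vec (w2, p, v)) \<in> rels (tens TA S)"
    proof (rule ftens_rels_left[OF homogeneous_rels_Ts _ coderA_square[OF gc(1)]])
      fix x assume "x \<in> keys (lin (coder bA) (coder bA w1))"
      then show "tgt TA x = path_tgt w1"
        using homogD(3)[OF hom_maps_homog_lin[OF qA.coder_hom_maps qA.coder_homog[OF gc(1)]]] by simp
    qed (use gc in auto)
    then show "eqv (tens TA S) (lin M_left (M_left (w1, (w2, p, v)))) (ftens (unit_vec w1) (D (w2, p, v)))"
      by (simp add: sq eqv_def)
  qed
  finally have "eqv S (lin ?g (lin coact_left (D (w, p, v)))) (lin ?g (\<Sum>(w1, w2)\<in>cuts w. ftens (unit_vec w1) (D (w2, p, v))))"
    by (rule eqv_lin[OF _ graft_left_rels])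
  then show ?thesis
    by (simp add: lin_lin lin_coact_left_section lin_sum lin_ftens case_prod_beta)
qed

lemma D_right:
  assumes g: "(w, p, v) \<in> gen S"
  shows "eqv S (D (w, p, v)) (\<Sum>(v1, v2)\<in>cuts v. lin (graft_right v2) (D (w, p, v1)))"
proof -
  let ?g = "\<lambda>(u, v). graft_right v u"
  have "eqv (tens S TC) (lin coact_right (D (w, p, v))) (lin M_right (lin coact_right (bP (w, p, v))))"
    unfolding D_def lin_lin
    using homogD(1)[OF bP_homog[OF g]] by (intro eqv_lin_cong bP_coact_right)
  also have "eqv (tens S TC) \<dots> (lin M_right (lin M_right (coact_right (w, p, v))))"
    by (rule eqv_lin[OF bP_coact_right[OF g] M_right_rels])
  also have "\<dots> = (\<Sum>(v1, v2)\<in>cuts v. lin M_right (M_right ((w, p, v1), v2)))"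
    by (simp add: coact_right_eq lin_sum case_prod_beta)
  also have "eqv (tens S TC) \<dots> (\<Sum>(v1, v2)\<in>cuts v. ftens (D (w, p, v1)) (unit_vec v2))"
  proof (rule eqv_sum_cuts)
    fix v1 v2 assume c: "(v1, v2) \<in> cuts v"
    note gc = gen_S_cut_right[OF g c]
    have sq: "lin M_right (M_right ((w, p, v1), v2)) =
        ftens (unit_vec (w, p, v1)) (lin (coder bC) (coder bC v2)) + ftens (D (w, p, v1)) (unit_vec v2)"
      unfolding M_right_def D_def
      by (rule tensor_derivation_square) (use homogD(4)[OF qC.coder_homog[OF gc(2)]] in simp)
    have "ftens (unit_vec (w, p, v1)) (lin (coder bC) (coder bC v2)) \<in> rels (tens S TC)"
    proof (rule ftens_rels_right[OF homogeneous_rels_Ts _ coderC_square[OF gc(2)]])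
      fix x assume "x \<in> keys (lin (coder bC) (coder bC v2))"
      then show "src TC x = fst v2"
        using homogD(2)[OF hom_maps_homog_lin[OF qC.coder_hom_maps qC.coder_homog[OF gc(2)]]] by simp
    qed (use gc in auto)
    then show "eqv (tens S TC) (lin M_right (M_right ((w, p, v1), v2))) (ftens (D (w, p, v1)) (unit_vec v2))"
      by (simp add: sq eqv_def)
  qed
  finally have "eqv S (lin ?g (lin coact_right (D (w, p, v)))) (lin ?g (\<Sum>(v1, v2)\<in>cuts v. ftens (D (w, p, v1)) (unit_vec v2)))"
    by (rule eqv_lin[OF _ graft_right_rels])
  then show ?thesis
    by (simp add: lin_lin lin_coact_right_section lin_sum lin_ftens case_prod_beta)
qed

text \<open>As the coaction equations of \<open>D\<close> have no correction terms, grafting from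
  both sides writes \<open>D\<close> as the sum of its own components inserted between outer pieces,
  and inserting a relation gives a relation.\<close>

lemma flat_iff:
  "flat scA ObA A scC ObC C scP P bP \<longleftrightarrow> (\<forall>g\<in>gen S. lin pr010 (D g) \<in> rels sP)"
proof -
  have fl: "flat scA ObA A scC ObC C scP P bP \<longleftrightarrow> (\<forall>g\<in>gen S. D g \<in> rels S)"
    by (simp add: flat_def Let_def eq_on_def gcomp_def D_def)
  show ?thesis
    unfolding fl
  proof (intro iffI ballI)
    fix g assume *: "\<forall>g\<in>gen S. lin pr010 (D g) \<in> rels sP" "g \<in> gen S"
    obtain w p v where e: "g = (w, p, v)" by (metis surj_pair)
    have g: "(w, p, v) \<in> gen S" using * e by simp
    have "eqv S (D (w, p, v)) (\<Sum>(w1, w2)\<in>cuts w. lin (graft_left w1) (D (w2, p, v)))"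
      by (rule D_left[OF g])
    also have "eqv S \<dots> (\<Sum>(w1, w2)\<in>cuts w. 0)"
    proof (rule eqv_sum_cuts)
      fix w1 w2 assume c: "(w1, w2) \<in> cuts w"
      note gc = gen_S_cut_left[OF g c]
      let ?q = "\<Sum>(v1, v2)\<in>cuts v. lin (graft_right v2) (D (w2, p, v1))"
        and ?d = "path_deg w2 + ldeg p + path_deg v + 2"
      have "homog S (path_tgt w1) (path_tgt v) ?d ?q"
      proof (rule homog_sum_cuts)
        fix v1 v2 assume c: "(v1, v2) \<in> cuts v"
        note gd = gen_S_cut_right[OF gc(3) c]
        show "homog S (path_tgt w1) (path_tgt v) ?d (lin (graft_right v2) (D (w2, p, v1)))"
          using lin_graft_right_homog[OF gd(2), folded gd(4)] D_homog[OF gd(3)] gc(4) gd(4) cuts_tgt[OF c] cuts_deg[OF c]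
          by (fastforce simp: add_ac)
      qed
      then have "eqv S (lin (graft_left w1) (D (w2, p, v))) (lin (graft_left w1) ?q)"
        using lin_graft_left_eqv[OF gc(1) D_right[OF gc(3)]] D_homog[OF gc(3)] gc(4) by simp
      also have "\<dots> = (\<Sum>(v1, v2)\<in>cuts v. lin (graft_left w1) (lin (graft_right v2) (D (w2, p, v1))))"
        by (simp add: lin_sum case_prod_beta)
      also have "eqv S \<dots> (\<Sum>(v1, v2)\<in>cuts v. 0)"
      proof (rule eqv_sum_cuts)
        fix v1 v2 assume c: "(v1, v2) \<in> cuts v"
        note gd = gen_S_cut_right[OF gc(3) c]
        have "lin (graft_left w1) (lin (graft_right v2) (D (w2, p, v1))) =
            lin (insert_letter w1 v2) (lin pr010 (D (w2, p, v1)))"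
          using D_homog[OF gd(3)] gc(4) gd(4) by (intro graft_left_right) auto
        also have "\<dots> \<in> rels S"
          by (rule insert_letter_rels[OF gc(1) gd(2)]) (use * gd in blast)
        finally show "eqv S (lin (graft_left w1) (lin (graft_right v2) (D (w2, p, v1)))) 0"
          by (simp add: eqv_0_iff)
      qed
      finally show "eqv S (lin (graft_left w1) (D (w2, p, v))) 0" by simp
    qed
    finally show "D g \<in> rels S" by (simp add: e eqv_0_iff)
  qed (simp add: pr010_rels)
qed

lemma \<beta>_square: "lin pr010 (D g) = lin \<beta> (bP g)"
  by (simp add: D_def lin_lin \<beta>_def[abs_def])

end

section \<open>The dg category of complexes\<close>

lemma module_hom_scale:
  assumes "module sc" shows "module (hom_scale sc)"
proof -
  interpret module sc by fact
  show ?thesis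
    by standard (auto simp: hom_scale_def fun_eq_iff scale_right_distrib scale_left_distrib)
qed

text \<open>Here \<open>n\<close> is the degree of a letter of the suspension, so the map itself has
  degree \<open>n + 1\<close>; the same shift occurs in \<open>hom_comp\<close>.\<close>

definition hom_diff :: "('k::comm_ring_1 \<Rightarrow> 'p::ab_group_add \<Rightarrow> 'p) \<Rightarrow> 'p cpx \<Rightarrow> 'p cpx \<Rightarrow> int \<Rightarrow>
    (int \<Rightarrow> 'p \<Rightarrow> 'p) \<Rightarrow> (int \<Rightarrow> 'p \<Rightarrow> 'p)" where
  "hom_diff sc M N n f = (\<lambda>i x. snd N (i + (n + 1)) (f i x) - sc (ksgn (n + 1)) (f (i + 1) (snd M i x)))"

definition hom_comp :: "int \<Rightarrow> (int \<Rightarrow> 'p \<Rightarrow> 'p) \<Rightarrow> (int \<Rightarrow> 'p \<Rightarrow> 'p) \<Rightarrow> (int \<Rightarrow> 'p \<Rightarrow> 'p)" where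
  "hom_comp n f g = (\<lambda>i x. g (i + (n + 1)) (f i x))"

lemma Ck_b_1: "Ck_b sc 1 (X, [l]) =
    unit_vec (Letter (lsrc l) (ldeg l + 1) (hom_diff sc (lsrc l) (ltgt l) (ldeg l) (lelt l)) (ltgt l))"
proof (cases l)
  case (Letter M n f N)
  obtain M0 dM N0 dN where "M = (M0, dM)" "N = (N0, dN)" by (metis surj_pair)
  then show ?thesis
    by (simp add: Letter Ck_b_def gcomp_def s_inv_def s_map_def hom_diff_def add_ac)
qed

text \<open>The minus sign belongs to the inverse of \<open>s \<otimes> s\<close>, and
  \<open>ksgn (ldeg m)\<close> comes from moving the degree 1 map \<open>s\<^sup>-\<^sup>1\<close>
  past the second letter.\<close>

lemma Ck_b_2: "Ck_b sc 2 (X, [l, m]) = fscale (- ksgn (ldeg m))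
    (unit_vec (Letter (lsrc l) (ldeg l + ldeg m + 1) (hom_comp (ldeg l) (lelt l) (lelt m)) (ltgt m)))"
proof -
  obtain M n f N where l: "l = Letter M n f N" by (cases l)
  obtain M' n' f' N' where m: "m = Letter M' n' f' N'" by (cases m)
  have "- (fscale c x) = fscale (- c) x" for c :: 'b and x :: "'c \<Rightarrow>\<^sub>0 'b"
    by simp
  then show ?thesis
    by (simp add: l m Ck_b_def gcomp_def ss_inv_def tmap_apply s_inv_def s_map_def hom_comp_def
        lin_minus lin_fscale add_ac)
qed

lemma Ck_b_other: "n \<noteq> 1 \<Longrightarrow> n \<noteq> 2 \<Longrightarrow> Ck_b sc n w = 0"
  by (simp add: Ck_b_def)

locale scalar_module = module sc
  for sc :: "'k::comm_ring_1 \<Rightarrow> 'p::ab_group_add \<Rightarrow> 'p"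
begin

abbreviation "hsc \<equiv> hom_scale sc"

lemma complexesD:
  assumes "M \<in> complexes sc"
  shows "subspace (fst M i)" "snd M \<in> gr_hom sc (fst M) (fst M) 1"
    "x \<in> fst M i \<Longrightarrow> snd M (i + 1) (snd M i x) = 0"
  using assms by (auto simp: complexes_def)

lemma gr_homD:
  assumes "f \<in> gr_hom sc M N n"
  shows "x \<in> M i \<Longrightarrow> f i x \<in> N (i + n)"
    "x \<in> M i \<Longrightarrow> y \<in> M i \<Longrightarrow> f i (x + y) = f i x + f i y"
    "x \<in> M i \<Longrightarrow> f i (sc c x) = sc c (f i x)"
    "x \<notin> M i \<Longrightarrow> f i x = 0"
  using assms by (auto simp: gr_hom_def)

lemma gr_hom_zero:
  assumes "f \<in> gr_hom sc M N n" "subspace (M i)"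
  shows "f i 0 = 0"
  using gr_homD(3)[OF assms(1) subspace_0[OF assms(2)], of 0] by simp

text \<open>True for every \<open>x\<close>, even outside the domain: there the value is 0, which
  lies in any submodule. This lets composites be treated without case distinctions.\<close>

lemma gr_hom_mem:
  assumes "f \<in> gr_hom sc M N n" "subspace (N (i + n))"
  shows "f i x \<in> N (i + n)"
  using gr_homD(1,4)[OF assms(1)] subspace_0[OF assms(2)] by metis

lemma hom_diff_mem:
  assumes M: "M \<in> complexes sc" and N: "N \<in> complexes sc" and f: "f \<in> gr_hom sc (fst M) (fst N) (n + 1)"
  shows "hom_diff sc M N n f \<in> gr_hom sc (fst M) (fst N) (n + 1 + 1)"
proof -
  note Md = complexesD(2)[OF M] and Nd = complexesD(2)[OF N]
  have a: "snd M i x \<in> fst M (i + 1)" "f i x \<in> fst N (i + (n + 1))" for i x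
    using gr_hom_mem[OF Md complexesD(1)[OF M]] gr_hom_mem[OF f complexesD(1)[OF N]] by auto
  have b: "snd N i x \<in> fst N (i + 1)" for i x
    using gr_hom_mem[OF Nd complexesD(1)[OF N]] by auto
  have c: "f (i + 1) (snd M i x) \<in> fst N (i + (n + 1) + 1)" for i x
    using a(2)[of "i + 1"] by (simp add: add_ac)
  have d: "hom_diff sc M N n f i x \<in> fst N (i + (n + 1 + 1))" for i x
    unfolding hom_diff_def
    using subspace_diff[OF complexesD(1)[OF N] b subspace_scale[OF complexesD(1)[OF N] c]]
    by (simp add: add.assoc)
  show ?thesis
    unfolding gr_hom_def
  proof (intro CollectI allI conjI ballI impI)
    fix i x assume x: "x \<in> fst M i"
    show "hom_diff sc M N n f i x \<in> fst N (i + (n + 1 + 1))" by (rule d)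
    {
      fix y assume y: "y \<in> fst M i"
      show "hom_diff sc M N n f i (x + y) = hom_diff sc M N n f i x + hom_diff sc M N n f i y"
        by (simp add: hom_diff_def gr_homD(2)[OF f x y] gr_homD(2)[OF Nd a(2) a(2)]
            gr_homD(2)[OF Md x y] gr_homD(2)[OF f a(1) a(1)] scale_right_distrib)
    }
    fix c show "hom_diff sc M N n f i (sc c x) = sc c (hom_diff sc M N n f i x)"
      by (simp add: hom_diff_def gr_homD(3)[OF f x] gr_homD(3)[OF Nd a(2)]
            gr_homD(3)[OF Md x] gr_homD(3)[OF f a(1)] scale_right_diff_distrib mult.commute)
  next
    fix i x assume x: "x \<notin> fst M i"
    show "hom_diff sc M N n f i x = 0"
      by (simp add: hom_diff_def gr_homD(4)[OF f x] gr_homD(4)[OF Md x]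
          gr_hom_zero[OF Nd complexesD(1)[OF N]] gr_hom_zero[OF f complexesD(1)[OF M]])
  qed
qed

lemma hom_comp_mem:
  assumes L: "L \<in> complexes sc" and M: "M \<in> complexes sc" and N: "N \<in> complexes sc"
    and f: "f \<in> gr_hom sc (fst L) (fst M) (n + 1)" and g: "g \<in> gr_hom sc (fst M) (fst N) (m + 1)"
  shows "hom_comp n f g \<in> gr_hom sc (fst L) (fst N) (n + m + 1 + 1)"
proof -
  have a: "f i x \<in> fst M (i + (n + 1))" for i x
    using gr_hom_mem[OF f complexesD(1)[OF M]] by auto
  have b: "g (i + (n + 1)) (f i x) \<in> fst N (i + (n + m + 1 + 1))" for i x
    using gr_homD(1)[OF g a[of i x]] by (simp add: add_ac)
  show ?thesis
    unfolding gr_hom_def hom_comp_def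
    using b by (auto simp: gr_homD(2)[OF f] gr_homD(2)[OF g a a] gr_homD(3)[OF f] gr_homD(3)[OF g a]
        gr_homD(4)[OF f] gr_hom_zero[OF g complexesD(1)[OF M]])
qed

lemma module_hom: "module (hsc)"
  by (rule module_hom_scale[OF module_axioms])

lemma subspace_gr_hom:
  assumes "M \<in> complexes sc" "N \<in> complexes sc"
  shows "module.subspace (hsc) (gr_hom sc (fst M) (fst N) n)"
proof -
  interpret hs: module hsc by (rule module_hom)
  note N = complexesD(1)[OF assms(2)]
  show ?thesis
    unfolding hs.subspace_def gr_hom_def
    by (auto simp: hom_scale_def subspace_0[OF N] subspace_add[OF N] subspace_scale[OF N]
        scale_right_distrib mult.commute add_ac)
qed

lemma graded_span_Ck: "graded_span (hsc) (complexes sc) (complexes sc) (Ck sc)"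
  unfolding graded_span_def Ck_def using module_hom subspace_gr_hom by auto

lemma hom_diff_comb:
  assumes "N \<in> complexes sc" "f \<in> gr_hom sc M' (fst N) (n + 1)" "g \<in> gr_hom sc M' (fst N) (n + 1)"
  shows "hom_diff sc M N n (hsc c f + hsc d g) =
    hsc c (hom_diff sc M N n f) + hsc d (hom_diff sc M N n g)"
proof (intro ext)
  fix i x
  note dN = gr_homD(2,3)[OF complexesD(2)[OF assms(1)]]
  have fg: "f i x \<in> fst N (i + (n + 1))" "g i x \<in> fst N (i + (n + 1))"
    using gr_hom_mem[OF assms(2)] gr_hom_mem[OF assms(3)] complexesD(1)[OF assms(1)] by auto
  then have "sc c (f i x) \<in> fst N (i + (n + 1))" "sc d (g i x) \<in> fst N (i + (n + 1))"
    using subspace_scale[OF complexesD(1)[OF assms(1)]] by auto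
  then show "hom_diff sc M N n (hsc c f + hsc d g) i x =
      (hsc c (hom_diff sc M N n f) + hsc d (hom_diff sc M N n g)) i x"
    using fg by (simp add: hom_diff_def hom_scale_def dN scale_right_distrib scale_right_diff_distrib mult.commute)
qed

text \<open>In contrast to linearity in the second map, which is pointwise, this one uses that
  \<open>g\<close> is additive and homogeneous on the middle complex.\<close>

lemma hom_comp_comb_left:
  assumes "M \<in> complexes sc" "f \<in> gr_hom sc L (fst M) (n + 1)" "f' \<in> gr_hom sc L (fst M) (n + 1)"
    "g \<in> gr_hom sc (fst M) N m"
  shows "hom_comp n (hsc c f + hsc d f') g =
    hsc c (hom_comp n f g) + hsc d (hom_comp n f' g)"
proof (intro ext)
  fix i x
  have fg: "f i x \<in> fst M (i + (n + 1))" "f' i x \<in> fst M (i + (n + 1))"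
    using gr_hom_mem[OF assms(2)] gr_hom_mem[OF assms(3)] complexesD(1)[OF assms(1)] by auto
  then have "sc c (f i x) \<in> fst M (i + (n + 1))" "sc d (f' i x) \<in> fst M (i + (n + 1))"
    using subspace_scale[OF complexesD(1)[OF assms(1)]] by auto
  then show "hom_comp n (hsc c f + hsc d f') g i x =
      (hsc c (hom_comp n f g) + hsc d (hom_comp n f' g)) i x"
    using fg by (simp add: hom_comp_def hom_scale_def gr_homD(2,3)[OF assms(4)])
qed

lemma hom_comp_comb_right:
  "hom_comp n f (hsc c g + hsc d g') =
    hsc c (hom_comp n f g) + hsc d (hom_comp n f g')"
  by (simp add: hom_comp_def hom_scale_def fun_eq_iff)

lemma letter_Ck_iff: "l \<in> letters (complexes sc) (complexes sc) (shift (Ck sc)) \<longleftrightarrow>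
    lsrc l \<in> complexes sc \<and> ltgt l \<in> complexes sc \<and>
    lelt l \<in> gr_hom sc (fst (lsrc l)) (fst (ltgt l)) (ldeg l + 1)"
  by (auto simp: letters_iff shift_def Ck_def)

lemma comb_rel_hom_diff:
  assumes "k \<in> gen (sCk sc)" "l \<in> gen (sCk sc)" "m \<in> gen (sCk sc)" "comb_rel (sCk sc) c d k l m"
  shows "hom_diff sc (lsrc m) (ltgt m) (ldeg m) (lelt m) =
    hsc c (hom_diff sc (lsrc m) (ltgt m) (ldeg m) (lelt k)) +
    hsc d (hom_diff sc (lsrc m) (ltgt m) (ldeg m) (lelt l))"
proof -
  interpret hs: module hsc by (rule module_hom)
  note a = comb_rel_suspD[OF assms(4)]
  show ?thesis
    unfolding hs.comb_rel_lelt[OF assms(4)]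
    by (rule hom_diff_comb[of _ _ "fst (lsrc m)"]) (use assms(1-3) in \<open>auto simp: letter_Ck_iff a\<close>)
qed

lemma comb_rel_hom_comp:
  assumes g: "(k, k') \<in> gen (tens (sCk sc) (sCk sc))" "(l, l') \<in> gen (tens (sCk sc) (sCk sc))"
      "(m, m') \<in> gen (tens (sCk sc) (sCk sc))"
    and r: "comb_rel (tens (sCk sc) (sCk sc)) c d (k, k') (l, l') (m, m')"
  shows "hom_comp (ldeg m) (lelt m) (lelt m') =
      hsc c (hom_comp (ldeg m) (lelt k) (lelt k')) + hsc d (hom_comp (ldeg m) (lelt l) (lelt l'))"
    and "lsrc k = lsrc m" "ldeg k = ldeg m" "ldeg k' = ldeg m'" "ltgt k' = ltgt m'"
      "lsrc l = lsrc m" "ldeg l = ldeg m" "ldeg l' = ldeg m'" "ltgt l' = ltgt m'"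
proof -
  interpret hs: module hsc by (rule module_hom)
  consider (1) "comb_rel (sCk sc) c d k l m" "k' = m'" "l' = m'" | (2) "comb_rel (sCk sc) c d k' l' m'" "k = m" "l = m"
    using r by (auto simp: comb_rel_tens)
  then have "hom_comp (ldeg m) (lelt m) (lelt m') =
      hsc c (hom_comp (ldeg m) (lelt k) (lelt k')) + hsc d (hom_comp (ldeg m) (lelt l) (lelt l')) \<and>
    lsrc k = lsrc m \<and> ldeg k = ldeg m \<and> ldeg k' = ldeg m' \<and> ltgt k' = ltgt m' \<and>
    lsrc l = lsrc m \<and> ldeg l = ldeg m \<and> ldeg l' = ldeg m' \<and> ltgt l' = ltgt m'"
  proof cases
    case 1
    note a = comb_rel_suspD[OF 1(1)]
    have "hom_comp (ldeg m) (lelt m) (lelt m') =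
        hsc c (hom_comp (ldeg m) (lelt k) (lelt m')) + hsc d (hom_comp (ldeg m) (lelt l) (lelt m'))"
      unfolding hs.comb_rel_lelt[OF 1(1)]
      by (rule hom_comp_comb_left[of "ltgt m" _ "fst (lsrc m)" _ _ _ "fst (ltgt m')" "ldeg m' + 1"])
        (use g in \<open>auto simp: gen_tens letter_Ck_iff a\<close>)
    then show ?thesis using 1 a by simp
  next
    case 2
    then show ?thesis
      using hs.comb_rel_lelt[OF 2(1)] comb_rel_suspD[OF 2(1)] by (simp add: hom_comp_comb_right)
  qed
  then show "hom_comp (ldeg m) (lelt m) (lelt m') =
      hsc c (hom_comp (ldeg m) (lelt k) (lelt k')) + hsc d (hom_comp (ldeg m) (lelt l) (lelt l'))"
    "lsrc k = lsrc m" "ldeg k = ldeg m" "ldeg k' = ldeg m'" "ltgt k' = ltgt m'"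
    "lsrc l = lsrc m" "ldeg l = ldeg m" "ldeg l' = ldeg m'" "ltgt l' = ltgt m'" by blast+
qed

lemma Ck_b_1_hom_maps:
  "Ck_b sc 1 \<in> hom_maps (Ts_pow {1} (hsc) (complexes sc) (Ck sc)) (sCk sc) id id 1"
    (is "_ \<in> hom_maps ?T _ _ _ _")
proof -
  let ?D = "\<lambda>l. Letter (lsrc l) (ldeg l + 1) (hom_diff sc (lsrc l) (ltgt l) (ldeg l) (lelt l)) (ltgt l)"
  have g: "w \<in> gen ?T \<longleftrightarrow> (\<exists>l. w = (lsrc l, [l]) \<and> l \<in> gen (sCk sc))" for w
    by (cases w) (auto simp: Ts_sel letters_iff length_Suc_conv)
  have D: "?D l \<in> gen (sCk sc)" if "l \<in> gen (sCk sc)" for l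
    using that hom_diff_mem by (simp add: letter_Ck_iff)
  have "lin (Ck_b sc 1) r \<in> rels (sCk sc)" if "r \<in> rels ?T" for r
  proof (rule lin_rels[OF _ that])
    fix c d u v w assume *: "u \<in> gen ?T" "v \<in> gen ?T" "w \<in> gen ?T" "comb_rel ?T c d u v w"
    obtain k l m where e: "u = (lsrc k, [k])" "v = (lsrc l, [l])" "w = (lsrc m, [m])"
      and kl: "k \<in> gen (sCk sc)" "l \<in> gen (sCk sc)" "m \<in> gen (sCk sc)"
      using *(1-3) unfolding g by blast
    have r: "comb_rel (sCk sc) c d k l m"
      using *(4) unfolding comb_rel_Ts e by (auto simp: Cons_eq_append_conv)
    note a = comb_rel_suspD[OF r]
    show "Ck_b sc 1 w - fscale c (Ck_b sc 1 u) - fscale d (Ck_b sc 1 v) \<in> rels (sCk sc)"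
      unfolding e Ck_b_1 comb_rel_hom_diff[OF kl r] a
      by (rule comb_letters_rels[OF graded_span_Ck])
        (use D[OF kl(1)] D[OF kl(2)] in \<open>simp_all add: letter_Ck_iff a Ck_def\<close>)
  qed
  moreover have "homog (sCk sc) (src ?T w) (tgt ?T w) (dgr ?T w + 1) (Ck_b sc 1 w)" if w: "w \<in> gen ?T" for w
  proof -
    obtain l where e: "w = (lsrc l, [l])" "l \<in> gen (sCk sc)" using w g by blast
    then show ?thesis
      unfolding e(1) Ck_b_1 using homog_unit[OF D[OF e(2)]] by (simp add: path_deg_def)
  qed
  ultimately show ?thesis unfolding hom_maps_def homog_def by (simp del: One_nat_def)
qed

lemma Ck_b_2_hom_maps:
  "Ck_b sc 2 \<in> hom_maps (Ts_pow {2} (hsc) (complexes sc) (Ck sc)) (sCk sc) id id 1"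
    (is "_ \<in> hom_maps ?T _ _ _ _")
proof -
  let ?D = "\<lambda>l m. Letter (lsrc l) (ldeg l + ldeg m + 1) (hom_comp (ldeg l) (lelt l) (lelt m)) (ltgt m)"
  have g: "w \<in> gen ?T \<longleftrightarrow> (\<exists>l m. w = (lsrc l, [l, m]) \<and> l \<in> gen (sCk sc) \<and> m \<in> gen (sCk sc) \<and> ltgt l = lsrc m)" for w
    by (cases w) (auto simp: Ts_sel letters_iff length_Suc_conv numeral_2_eq_2)
  have D: "?D l m \<in> gen (sCk sc)" if "l \<in> gen (sCk sc)" "m \<in> gen (sCk sc)" "ltgt l = lsrc m" for l m
    using that hom_comp_mem[of "lsrc l" "lsrc m" "ltgt m" "lelt l" "ldeg l" "lelt m" "ldeg m"]
    by (simp add: letter_Ck_iff)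
  have "lin (Ck_b sc 2) r \<in> rels (sCk sc)" if "r \<in> rels ?T" for r
  proof (rule lin_rels[OF _ that])
    fix c d u v w assume *: "u \<in> gen ?T" "v \<in> gen ?T" "w \<in> gen ?T" "comb_rel ?T c d u v w"
    obtain k k' l l' m m' where e: "u = (lsrc k, [k, k'])" "v = (lsrc l, [l, l'])" "w = (lsrc m, [m, m'])"
      and kl: "k \<in> gen (sCk sc)" "l \<in> gen (sCk sc)" "m \<in> gen (sCk sc)"
        "k' \<in> gen (sCk sc)" "l' \<in> gen (sCk sc)" "m' \<in> gen (sCk sc)"
        "ltgt k = lsrc k'" "ltgt l = lsrc l'" "ltgt m = lsrc m'"
      using *(1-3) unfolding g by blast
    have "comb_rel (tens (sCk sc) (sCk sc)) c d (k, k') (l, l') (m, m')"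
      using *(4) unfolding comb_rel_Ts e by (auto simp: Cons_eq_append_conv comb_rel_tens)
    then have h: "hom_comp (ldeg m) (lelt m) (lelt m') =
        hsc c (hom_comp (ldeg m) (lelt k) (lelt k')) + hsc d (hom_comp (ldeg m) (lelt l) (lelt l'))"
      and a: "lsrc k = lsrc m" "ldeg k = ldeg m" "ldeg k' = ldeg m'" "ltgt k' = ltgt m'"
        "lsrc l = lsrc m" "ldeg l = ldeg m" "ldeg l' = ldeg m'" "ltgt l' = ltgt m'"
      using comb_rel_hom_comp[of k k' l l' m m' c d] kl by (simp_all add: gen_tens)
    have "unit_vec (?D m m') - fscale c (unit_vec (?D k k')) - fscale d (unit_vec (?D l l')) \<in> rels (sCk sc)"
      unfolding h a
      by (rule comb_letters_rels[OF graded_span_Ck])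
        (use D[OF kl(1,4,7)] D[OF kl(2,5,8)] in \<open>simp_all add: letter_Ck_iff a Ck_def\<close>)
    from rels_scale[OF this, of "- ksgn (ldeg m')"]
    show "Ck_b sc 2 w - fscale c (Ck_b sc 2 u) - fscale d (Ck_b sc 2 v) \<in> rels (sCk sc)"
      unfolding e Ck_b_2
      by (simp only: a fscale_right_diff_distrib fscale_fscale mult.commute)
  qed
  moreover have "homog (sCk sc) (src ?T w) (tgt ?T w) (dgr ?T w + 1) (Ck_b sc 2 w)" if w: "w \<in> gen ?T" for w
  proof -
    obtain l m where e: "w = (lsrc l, [l, m])" "l \<in> gen (sCk sc)" "m \<in> gen (sCk sc)" "ltgt l = lsrc m"
      using w g by blast
    then show ?thesis
      unfolding e(1) Ck_b_2 using homog_unit[OF D[OF e(2-4)]]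
      by (intro homog_fscale) (simp add: path_deg_def)
  qed
  ultimately show ?thesis unfolding hom_maps_def homog_def by simp
qed

text \<open>Supplies the coderivation property and compatibility with relations on the target side
  of \<open>\<phi>\<close>.\<close>

sublocale qCk: quiver_maps hsc "complexes sc" "Ck sc" "Ck_b sc"
proof
  fix n :: nat assume "n \<ge> 1"
  consider "n = 1" | "n = 2" | "n \<noteq> 1" "n \<noteq> 2" by blast
  then show "Ck_b sc n \<in> hom_maps (Ts_pow {n} (hsc) (complexes sc) (Ck sc)) (sCk sc) id id 1"
  proof cases
    case 3
    then have "Ck_b sc n = (\<lambda>w. 0)" by (simp add: fun_eq_iff Ck_b_other)
    then show ?thesis by (simp add: hom_maps_def)
  qed (simp_all only: Ck_b_1_hom_maps Ck_b_2_hom_maps)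
qed

end

section \<open>Reversal of paths\<close>

lemma flip_letter_sel [simp]: "lsrc (flip_letter l) = ltgt l" "ltgt (flip_letter l) = lsrc l"
    "ldeg (flip_letter l) = ldeg l" "flip_letter (flip_letter l) = l" "lelt (flip_letter l) = lelt l"
  by (cases l; simp)+

definition flip_path :: "('o, 'a) path \<Rightarrow> ('o, 'a) path" where
  "flip_path w = (path_tgt w, rev (map flip_letter (snd w)))"

text \<open>The exponent of the sign of a full reversal. It is a sum over unordered pairs of
  factors, hence unchanged when the word is reversed.\<close>

definition koszul_exp :: "('s, 't, 'a) letter list \<Rightarrow> int" where
  "koszul_exp ls = (\<Sum>j<length ls. \<Sum>i<j. ldeg (ls ! i) * ldeg (ls ! j))"

definition gam_sign :: "('o, 'a) path \<Rightarrow> 'k::comm_ring_1" where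
  "gam_sign w = ksgn (int (length (snd w)) + koszul_exp (snd w))"

lemma gam_eq: "gam w = fscale (gam_sign w) (unit_vec (flip_path w))"
  by (cases w) (simp add: gam_def gam_sign_def koszul_exp_def flip_path_def)

lemma koszul_exp_Nil [simp]: "koszul_exp [] = 0"
  by (simp add: koszul_exp_def)

lemma koszul_exp_snoc: "koszul_exp (ls @ [l]) = koszul_exp ls + sum_list (map ldeg ls) * ldeg l"
proof -
  have "(\<Sum>j<length ls. \<Sum>i<j. ldeg ((ls @ [l]) ! i) * ldeg ((ls @ [l]) ! j)) = koszul_exp ls"
    unfolding koszul_exp_def by (intro sum.cong refl) (auto simp: nth_append)
  moreover have "(\<Sum>i<length ls. ldeg ((ls @ [l]) ! i)) = sum_list (map ldeg ls)"
    by (simp add: sum_list_sum_nth atLeast0LessThan nth_append)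
  ultimately show ?thesis
    by (simp add: koszul_exp_def sum_distrib_right[symmetric])
qed

lemma koszul_exp_append:
  "koszul_exp (a @ b) = koszul_exp a + koszul_exp b + sum_list (map ldeg a) * sum_list (map ldeg b)"
proof (induction b rule: rev_induct)
  case (snoc l b)
  then show ?case
    using koszul_exp_snoc[of "a @ b" l] koszul_exp_snoc[of b l] by (simp add: algebra_simps)
qed simp

lemma koszul_exp_rev: "koszul_exp (rev (map flip_letter ls)) = koszul_exp ls"
proof (induction ls)
  case (Cons l ls)
  have "koszul_exp [l] = 0" using koszul_exp_snoc[of "[]" l] by simp
  then have "koszul_exp (l # ls) = koszul_exp ls + ldeg l * sum_list (map ldeg ls)"
    using koszul_exp_append[of "[l]" ls] by simp
  moreover have "sum_list (map ldeg (rev (map flip_letter ls))) = sum_list (map ldeg ls)"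
    by (simp add: rev_map[symmetric] sum_list_rev comp_def)
  ultimately show ?case
    using Cons koszul_exp_snoc[of "rev (map flip_letter ls)" "flip_letter l"] by simp
qed simp

lemma gam_sign_flip [simp]: "gam_sign (flip_path w) = gam_sign w"
  by (simp add: gam_sign_def flip_path_def koszul_exp_rev)

lemma gam_sign_square: "gam_sign w * gam_sign w = (1 :: 'k::comm_ring_1)"
  by (simp add: gam_sign_def)

text \<open>Reversing a concatenation means reversing both pieces and exchanging them; the exchange
  contributes the last factor, while the signs from the lengths multiply.\<close>

lemma gam_sign_cuts:
  assumes "(w1, w2) \<in> cuts w"
  shows "gam_sign w = gam_sign w1 * gam_sign w2 * (ksgn (path_deg w1 * path_deg w2) :: 'k::comm_ring_1)"
proof -
  have "snd w = snd w1 @ snd w2" using assms by (simp add: cuts_iff)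
  then show ?thesis
    unfolding gam_sign_def path_deg_def ksgn_add[symmetric]
    by (intro arg_cong[where f = ksgn]) (simp add: koszul_exp_append)
qed

lemma flip_path_is_path:
  "is_path X ls \<Longrightarrow> is_path (path_tgt (X, ls)) (rev (map flip_letter ls)) \<and>
     path_tgt (path_tgt (X, ls), rev (map flip_letter ls)) = X"
  by (induction ls arbitrary: X) auto

lemma flip_path_props:
  assumes "is_path (fst w) (snd w)"
  shows "is_path (fst (flip_path w)) (snd (flip_path w))" "path_tgt (flip_path w) = fst w"
    "fst (flip_path w) = path_tgt w" "flip_path (flip_path w) = w" "path_deg (flip_path w) = path_deg w"
proof -
  obtain X ls where w: "w = (X, ls)" by force
  show t: "is_path (fst (flip_path w)) (snd (flip_path w))" "path_tgt (flip_path w) = fst w"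
    "fst (flip_path w) = path_tgt w"
    using assms flip_path_is_path[of X ls] by (auto simp: w flip_path_def)
  show "flip_path (flip_path w) = w"
    using t(2) by (simp add: flip_path_def w rev_map comp_def)
  show "path_deg (flip_path w) = path_deg w"
    by (simp add: flip_path_def w path_deg_def rev_map[symmetric] sum_list_rev comp_def)
qed

lemma opp_opp [simp]: "opp (opp A) = A"
  by (simp add: opp_def fun_eq_iff)

lemma gen_is_path: "w \<in> gen (Ts sc Ob A) \<Longrightarrow> is_path (fst w) (snd w)"
  by (auto simp: Ts_sel)

lemma flip_path_gen:
  assumes "w \<in> gen (Ts sc Ob A)"
  shows "flip_path w \<in> gen (Ts sc Ob (opp A))"
proof -
  have "path_tgt w \<in> Ob" using assms by (cases w) (auto simp: Ts_sel intro: path_tgt_mem)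
  moreover have "set (snd (flip_path w)) \<subseteq> letters Ob Ob (shift (opp A))"
    using assms by (cases w) (auto simp: Ts_sel flip_path_def letters_iff shift_def opp_def subset_iff)
  ultimately show ?thesis
    using flip_path_props(1)[OF gen_is_path[OF assms]] by (simp add: Ts_sel flip_path_def)
qed

lemma cuts_flip:
  assumes "is_path (fst w) (snd w)" "(w1, w2) \<in> cuts w"
  shows "(flip_path w2, flip_path w1) \<in> cuts (flip_path w)"
    "is_path (fst w1) (snd w1)" "is_path (fst w2) (snd w2)"
proof -
  have s: "snd w = snd w1 @ snd w2" "fst w1 = fst w" "fst w2 = path_tgt w1"
    using assms(2) by (auto simp: cuts_iff)
  show p: "is_path (fst w1) (snd w1)" "is_path (fst w2) (snd w2)"
    using assms(1) s by (cases w; cases w1; cases w2; auto)+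
  show "(flip_path w2, flip_path w1) \<in> cuts (flip_path w)"
    using flip_path_props(2,3)[OF p(2)] s cuts_tgt[OF assms(2)] by (simp add: cuts_iff flip_path_def)
qed

text \<open>Reversal is a bijection between the cuts of a path and those of its reverse, and it
  interchanges the two pieces.\<close>

lemma sum_cuts_flip:
  assumes "is_path (fst w) (snd w)"
  shows "(\<Sum>(x1, x2)\<in>cuts (flip_path w). f x1 x2) = (\<Sum>(w1, w2)\<in>cuts w. f (flip_path w2) (flip_path w1))"
proof (rule sum.reindex_bij_witness[where i = "\<lambda>(w1, w2). (flip_path w2, flip_path w1)"
      and j = "\<lambda>(w1, w2). (flip_path w2, flip_path w1)"])
  fix x assume x: "x \<in> cuts (flip_path w)"
  obtain x1 x2 where e: "x = (x1, x2)" by (metis surj_pair)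
  note c = cuts_flip[OF flip_path_props(1)[OF assms] x[unfolded e]]
  show "(case case x of (w1, w2) \<Rightarrow> (flip_path w2, flip_path w1) of (w1, w2) \<Rightarrow> (flip_path w2, flip_path w1)) = x"
    using c(2,3) by (simp add: e flip_path_props)
  show "(case x of (w1, w2) \<Rightarrow> (flip_path w2, flip_path w1)) \<in> cuts w"
    using c(1) assms by (simp add: e flip_path_props)
  show "(case case x of (w1, w2) \<Rightarrow> (flip_path w2, flip_path w1) of
      (w1, w2) \<Rightarrow> f (flip_path w2) (flip_path w1)) = (case x of (x1, x2) \<Rightarrow> f x1 x2)"
    using c(2,3) by (simp add: e flip_path_props)
next
  fix y assume y: "y \<in> cuts w"
  obtain y1 y2 where e: "y = (y1, y2)" by (metis surj_pair)
  note c = cuts_flip[OF assms y[unfolded e]]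
  show "(case case y of (w1, w2) \<Rightarrow> (flip_path w2, flip_path w1) of (w1, w2) \<Rightarrow> (flip_path w2, flip_path w1)) = y"
    using c(2,3) by (simp add: e flip_path_props)
  show "(case y of (w1, w2) \<Rightarrow> (flip_path w2, flip_path w1)) \<in> cuts (flip_path w)"
    using c(1) by (simp add: e)
qed


section \<open>Coalgebra homomorphisms to the tensor coalgebra\<close>

lemma pr1_hom_maps: "pr1 \<in> hom_maps (Ts sc Ob A) (susp sc Ob Ob A) id id 0"
proof -
  let ?T = "Ts sc Ob A" and ?s = "susp sc Ob Ob A"
  have one: "length (us @ [k] @ vs) = 1 \<longleftrightarrow> us = [] \<and> vs = []" for us vs and k :: "('a, 'a, 'b) letter"
    by auto
  have "lin pr1 r \<in> rels ?s" if "r \<in> rels ?T" for r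
  proof (rule lin_rels[OF _ that])
    fix c d u v w assume *: "u \<in> gen ?T" "v \<in> gen ?T" "w \<in> gen ?T" "comb_rel ?T c d u v w"
    then obtain X us vs k l m where e: "comb_rel ?s c d k l m" "u = (X, us @ [k] @ vs)" "v = (X, us @ [l] @ vs)" "w = (X, us @ [m] @ vs)"
      unfolding comb_rel_Ts by blast
    have "unit_vec m - fscale c (unit_vec k) - fscale d (unit_vec l) \<in> rels ?s"
      using * e by (intro comb_rel_rels) (auto simp: Ts_sel)
    then show "pr1 w - fscale c (pr1 u) - fscale d (pr1 v) \<in> rels ?s"
      unfolding pr1_def e snd_conv one by (cases "us = []") auto
  qed
  moreover have "homog ?s (src ?T w) (tgt ?T w) (dgr ?T w + 0) (pr1 w)" if w: "w \<in> gen ?T" for w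
    using w by (cases w) (auto simp: pr1_def homog_def Ts_sel length_Suc_conv path_deg_def)
  ultimately show ?thesis unfolding hom_maps_def homog_def by simp
qed

definition cons_path :: "(('o, 'o, 'a) letter \<times> ('o, 'a) path, ('o, 'a) path, 'k::comm_ring_1) gmap" where
  "cons_path = (\<lambda>(l, w). unit_vec (lsrc l, l # snd w))"

lemma cons_path_rels:
  assumes "r \<in> rels (tens (susp sc Ob Ob A) (Ts sc Ob A))"
  shows "lin cons_path r \<in> rels (Ts sc Ob A)"
proof -
  let ?T = "Ts sc Ob A" and ?s = "susp sc Ob Ob A"
  have g: "(lsrc l, l # snd w) \<in> gen ?T" if "(l, w) \<in> gen (tens ?s ?T)" for l w
    using that by (cases w) (auto simp: gen_tens Ts_sel letters_iff)
  show ?thesis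
  proof (rule lin_rels[OF _ assms])
    fix c d x y z assume *: "x \<in> gen (tens ?s ?T)" "y \<in> gen (tens ?s ?T)" "z \<in> gen (tens ?s ?T)"
      "comb_rel (tens ?s ?T) c d x y z"
    obtain k u l v m w where e: "x = (k, u)" "y = (l, v)" "z = (m, w)" by (metis surj_pair)
    have "comb_rel ?T c d (lsrc k, k # snd u) (lsrc l, l # snd v) (lsrc m, m # snd w)"
    proof -
      consider "comb_rel ?s c d k l m" "u = w" "v = w" | "k = m" "l = m" "comb_rel ?T c d u v w"
        using *(4) by (auto simp: e comb_rel_tens)
      then show ?thesis
      proof cases
        case 1
        then show ?thesis
          using comb_rel_TsI[OF 1(1), of UNIV "lsrc m" "[]" "snd w"] comb_rel_suspD(1,4)[OF 1(1)] by simp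
      next
        case 2
        then obtain X us vs k' l' m' where f: "comb_rel ?s c d k' l' m'"
          "u = (X, us @ [k'] @ vs)" "v = (X, us @ [l'] @ vs)" "w = (X, us @ [m'] @ vs)"
          unfolding comb_rel_Ts by blast
        show ?thesis using comb_rel_TsI[OF f(1), of UNIV "lsrc m" "m # us" vs] 2 by (simp add: f)
      qed
    qed
    then show "cons_path z - fscale c (cons_path x) - fscale d (cons_path y) \<in> rels ?T"
      unfolding e cons_path_def prod.case using * by (intro comb_rel_rels g) (auto simp: e)
  qed
qed

text \<open>\<open>pr\<^sub>1 \<otimes> 1\<close> followed by concatenation. After the cut it is the
  identity on nonempty paths, because exactly one cut has a first piece of length 1. Of the first
  tensor factor it sees only the part of length 1, which is what brings in
  \<open>pr1\<close>.\<close>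

definition join1 :: "(('o, 'a) path \<times> ('o, 'a) path \<Rightarrow>\<^sub>0 'k::comm_ring_1) \<Rightarrow> (('o, 'a) path \<Rightarrow>\<^sub>0 'k)" where
  "join1 p = lin cons_path (lin (tmap path_deg 0 pr1 idm) p)"

lemma join1_rels: "r \<in> rels (tens (Ts sc Ob A) (Ts sc Ob A)) \<Longrightarrow> join1 r \<in> rels (Ts sc Ob A)"
  unfolding join1_def
  by (intro cons_path_rels tmap_rels[OF homogeneous_rels_Ts homogeneous_rels_Ts homogeneous_rels_susp
        homogeneous_rels_Ts pr1_hom_maps idm_hom_maps]) auto

lemma join1_lin: "join1 (lin f p) = lin (\<lambda>x. join1 (f x)) p"
  by (simp add: join1_def lin_lin)

lemma join1_cut:
  assumes "x \<in> gen (Ts sc Ob A)" "snd x \<noteq> []"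
  shows "join1 (cut x) = (unit_vec x :: _ \<Rightarrow>\<^sub>0 'k::comm_ring_1)"
proof -
  obtain l ls where x: "x = (lsrc l, l # ls)"
    using assms by (cases x; cases "snd x") (auto simp: Ts_sel)
  let ?f = "\<lambda>(a, b). if length a = 1 then unit_vec (lsrc (hd a), hd a # b) else (0 :: _ \<Rightarrow>\<^sub>0 'k)"
  have "join1 (cut x) = (\<Sum>y\<in>splits (l # ls). ?f y)"
    by (simp add: join1_def x cut_eq sum_cuts lin_sum case_prod_beta)
      (rule sum.cong; simp add: tmap_apply pr1_def lin_ftens cons_path_def case_prod_beta)
  also have "\<dots> = (\<Sum>y\<in>{([l], ls)}. ?f y)"
  proof (rule sum.mono_neutral_right[OF finite_splits])
    show "{([l], ls)} \<subseteq> splits (l # ls)" by (simp add: splits_def)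
    show "\<forall>y\<in>splits (l # ls) - {([l], ls)}. ?f y = 0"
    proof
      fix y assume y: "y \<in> splits (l # ls) - {([l], ls)}"
      obtain a b where e: "y = (a, b)" by (metis surj_pair)
      have "length a \<noteq> 1" using y by (cases a) (auto simp: e splits_def)
      then show "?f y = 0" by (simp add: e)
    qed
  qed
  finally show ?thesis by (simp add: x)
qed

lemma join1_cut_lin:
  assumes "\<And>x. x \<in> keys q \<Longrightarrow> x \<in> gen (Ts sc Ob A) \<and> snd x \<noteq> []"
  shows "join1 (lin cut q) = q"
proof -
  have "join1 (lin cut q) = lin idm q"
    unfolding join1_lin by (rule lin_cong) (use assms join1_cut in blast)
  then show ?thesis by simp
qed

lemma join1_ftens:
  assumes "homog T X Y d q" "dgr T = path_deg"
  shows "join1 (ftens p q) = lin cons_path (ftens (lin pr1 p) q)"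
proof -
  have "lin (tmap path_deg 0 pr1 idm) (ftens p q) = fscale (ksgn (d * 0)) (ftens (lin pr1 p) (lin idm q))"
    by (rule lin_tmap_ftens) (use homogD(4)[OF assms(1)] assms(2) in auto)
  then show ?thesis by (simp add: join1_def)
qed

text \<open>If \<open>t\<close> describes the comultiplication of \<open>f\<close>, the coderivation
  moves through \<open>f\<close> to the two pieces in turn. It is applied to \<open>\<Phi>\<close>
  in either variable, with the other one held fixed.\<close>

lemma (in quiver_maps) cut_lin_coder:
  assumes w: "w \<in> gen T" and f: "\<And>x. x \<in> gen T \<Longrightarrow> eqv U (lin cut (f x)) (lin t (cut x))"
  shows "eqv U (lin cut (lin f (coder b w))) (\<Sum>(w1, w2)\<in>cuts w. lin (\<lambda>x. t (w1, x)) (coder b w2) +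
    fscale (ksgn (path_deg w2)) (lin (\<lambda>x. t (x, w2)) (coder b w1)))"
proof -
  have "eqv U (lin cut (lin f (coder b w))) (lin (\<lambda>x. lin t (cut x)) (coder b w))"
    unfolding lin_lin by (rule eqv_lin_cong) (use f homogD(1)[OF coder_homog[OF w]] in blast)
  also have "\<dots> = lin t (lin (tensor_coder b) (cut w))"
    using cut_coder'[OF w] by (simp add: lin_lin[symmetric])
  also have "\<dots> = (\<Sum>(w1, w2)\<in>cuts w. lin (\<lambda>x. t (w1, x)) (coder b w2) +
      fscale (ksgn (path_deg w2)) (lin (\<lambda>x. t (x, w2)) (coder b w1)))"
    unfolding cut_eq lin_sum by (rule sum_cuts_cong') (simp add: tensor_coder_apply lin_add lin_fscale lin_ftens)
  finally show ?thesis .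
qed

lemma rels_sum_cuts2:
  "(\<And>w1 w2 v1 v2. (w1, w2) \<in> cuts w \<Longrightarrow> (v1, v2) \<in> cuts v \<Longrightarrow> f w1 w2 v1 v2 \<in> rels S) \<Longrightarrow>
    (\<Sum>(w1, w2)\<in>cuts w. \<Sum>(v1, v2)\<in>cuts v. f w1 w2 v1 v2) \<in> rels S"
  by (auto intro!: rels_sum)

lemma lin_sum_cuts2: "lin h (\<Sum>(w1, w2)\<in>cuts w. \<Sum>(v1, v2)\<in>cuts v. f w1 w2 v1 v2) =
    (\<Sum>(w1, w2)\<in>cuts w. \<Sum>(v1, v2)\<in>cuts v. lin h (f w1 w2 v1 v2))"
  by (simp add: lin_sum case_prod_beta)

lemma tensor_coder_ftens:
  assumes "homog T X Y d q" "dgr T = path_deg"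
  shows "lin (tensor_coder b) (ftens p q) =
    ftens p (lin (coder b) q) + fscale (ksgn d) (ftens (lin (coder b) p) q)"
proof -
  have d: "\<And>v. v \<in> keys q \<Longrightarrow> path_deg v = d"
    using homogD(4)[OF assms(1)] assms(2) by auto
  show ?thesis
    unfolding tensor_coder_def plus_fun_def lin_fun_add
    using lin_tmap_ftens[of q path_deg d 0 idm "coder b" p, OF d]
      lin_tmap_ftens[of q path_deg d 1 "coder b" idm p, OF d] by simp
qed

text \<open>The result has length 1 only if the block fed to \<open>b\<close> is the whole path. The
  empty path contains no block, whence the value 0.\<close>

lemma pr1_coder:
  assumes "is_path X ls"
  shows "lin pr1 (coder b (X, ls)) = (if ls = [] then 0 else b (length ls) (X, ls))"
proof -
  have t: "lin pr1 (coder_term b X (a, m, t)) =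
      (if a = [] \<and> t = [] then b (length m) (X, m) else 0)" for a m t
  proof -
    have "lin pr1 (coder_term b X (a, m, t)) = fscale (ksgn (path_deg (X, t)))
        (lin (\<lambda>l. pr1 (X, a @ [l] @ t)) (b (length m) (path_tgt (X, a), m)))"
      by (simp add: coder_term_def lin_fscale lin_lin)
    also have "(\<lambda>l. pr1 (X, a @ [l] @ t)) = (\<lambda>l. if a = [] \<and> t = [] then unit_vec l else 0)"
      by (auto simp: pr1_def)
    finally show ?thesis unfolding lin_if by simp
  qed
  have "lin pr1 (coder b (X, ls)) = (\<Sum>x\<in>triples ls. lin pr1 (coder_term b X x))"
    by (simp add: coder_eq lin_sum)
  also have "\<dots> = (\<Sum>x\<in>(if ls = [] then {} else {([], ls, [])}). lin pr1 (coder_term b X x))"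
    by (rule sum.mono_neutral_right[OF finite_triples]) (auto simp: triples_def t split: if_splits)
  finally show ?thesis by (simp add: t)
qed


section \<open>Functors of two arguments\<close>

locale augmented_hom = ainf_pair scA scC ObA A bA ObC C bC + scalar_module scP
  for scA :: "'k::comm_ring_1 \<Rightarrow> 'a::ab_group_add \<Rightarrow> 'a"
    and scC :: "'k \<Rightarrow> 'c::ab_group_add \<Rightarrow> 'c"
    and ObA :: "'o set" and A bA and ObC :: "'q set" and C bC
    and scP :: "'k \<Rightarrow> 'p::ab_group_add \<Rightarrow> 'p" +
  fixes \<phi>0 :: "'o \<times> 'q \<Rightarrow> 'p cpx"
    and \<phi> :: "(('o, 'a) path \<times> ('q, 'c) path, ('p cpx, int \<Rightarrow> 'p \<Rightarrow> 'p) path, 'k) gmap"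
  assumes hom: "aug_coalg_hom scA ObA A scC ObC C scP \<phi>0 \<phi>"
begin

abbreviation "TCk \<equiv> TsCk scP"
abbreviation "B \<equiv> box (Ts scA ObA (opp A)) TC"
abbreviation "bCk \<equiv> coder (Ck_b scP)"

definition "\<Phi> w v = lin (\<lambda>x. \<phi> (x, v)) (gam w)"

lemma \<Phi>_eq: "\<Phi> w v = fscale (gam_sign w) (\<phi> (flip_path w, v))"
  by (simp add: \<Phi>_def gam_eq lin_fscale)

lemma gen_B: "(x, v) \<in> gen B \<longleftrightarrow> x \<in> gen (Ts scA ObA (opp A)) \<and> v \<in> gen TC"
  by (simp add: box_def)

lemma \<phi>_hom_maps: "\<phi> \<in> hom_maps B TCk \<phi>0 \<phi>0 0"
  using hom by (simp add: aug_coalg_hom_def Let_def)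

lemma \<Phi>_homog:
  assumes "w \<in> gen TA" "v \<in> gen TC"
  shows "homog TCk (\<phi>0 (path_tgt w, fst v)) (\<phi>0 (fst w, path_tgt v)) (path_deg w + path_deg v) (\<Phi> w v)"
proof -
  have "(flip_path w, v) \<in> gen B" using assms flip_path_gen by (simp add: gen_B)
  from hom_maps_homog[OF \<phi>_hom_maps this] show ?thesis
    unfolding \<Phi>_eq using flip_path_props[OF gen_is_path[OF assms(1)]]
    by (intro homog_fscale) (simp add: box_def)
qed

lemma box_cut_eq: "box_cut (x, v) = (\<Sum>(x1, x2)\<in>cuts x. \<Sum>(v1, v2)\<in>cuts v.
    fscale (ksgn (path_deg x2 * path_deg v1)) (unit_vec ((x1, v1), (x2, v2))))"
  by (simp add: box_cut_def gcomp_def tmap_apply cut_eq ftens_sum_left ftens_sum_right lin_sum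
      case_prod_beta) (rule sum.swap)

lemma \<phi>_cut:
  assumes "(x, v) \<in> gen B"
  shows "eqv (tens TCk TCk) (lin cut (\<phi> (x, v))) (\<Sum>(x1, x2)\<in>cuts x. \<Sum>(v1, v2)\<in>cuts v.
    fscale (ksgn (path_deg x2 * path_deg v1)) (ftens (\<phi> (x1, v1)) (\<phi> (x2, v2))))"
proof -
  have "eqv (tens TCk TCk) (lin cut (\<phi> (x, v))) (lin (tmap box_deg 0 \<phi> \<phi>) (box_cut (x, v)))"
    using hom assms by (simp add: aug_coalg_hom_def Let_def eq_on_def gcomp_def eqv_def)
  then show ?thesis
    by (simp add: box_cut_eq lin_sum lin_fscale tmap_apply case_prod_beta)
qed

text \<open>The reversal by \<open>\<gamma>\<close> contributes the sign of exchanging \<open>w1\<close> and \<open>w2\<close>.\<close>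

definition \<sigma> :: "('o, 'a) path \<Rightarrow> ('o, 'a) path \<Rightarrow> ('q, 'c) path \<Rightarrow> 'k" where
  "\<sigma> w1 w2 v1 = ksgn (path_deg w1 * path_deg w2 + path_deg w1 * path_deg v1)"

text \<open>The order of the factors reflects contravariance in the first variable: after reversal
  the final piece \<open>w2\<close> comes first and is paired with the initial piece
  \<open>v1\<close>.\<close>

lemma \<Phi>_cut:
  assumes w: "w \<in> gen TA" and v: "v \<in> gen TC"
  shows "eqv (tens TCk TCk) (lin cut (\<Phi> w v)) (\<Sum>(w1, w2)\<in>cuts w. \<Sum>(v1, v2)\<in>cuts v.
    fscale (\<sigma> w1 w2 v1) (ftens (\<Phi> w2 v1) (\<Phi> w1 v2)))"
proof -
  have "(flip_path w, v) \<in> gen B" using assms flip_path_gen by (simp add: gen_B)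
  from eqv_fscale[OF \<phi>_cut[OF this], of "gam_sign w"]
  have "eqv (tens TCk TCk) (lin cut (\<Phi> w v)) (fscale (gam_sign w)
      (\<Sum>(w1, w2)\<in>cuts w. \<Sum>(v1, v2)\<in>cuts v. fscale (ksgn (path_deg (flip_path w1) * path_deg v1))
        (ftens (\<phi> (flip_path w2, v1)) (\<phi> (flip_path w1, v2)))))"
    by (simp add: \<Phi>_eq lin_fscale sum_cuts_flip[OF gen_is_path[OF w]])
  also have "fscale (gam_sign w)
      (\<Sum>(w1, w2)\<in>cuts w. \<Sum>(v1, v2)\<in>cuts v. fscale (ksgn (path_deg (flip_path w1) * path_deg v1))
        (ftens (\<phi> (flip_path w2, v1)) (\<phi> (flip_path w1, v2)))) =
      (\<Sum>(w1, w2)\<in>cuts w. \<Sum>(v1, v2)\<in>cuts v. fscale (\<sigma> w1 w2 v1) (ftens (\<Phi> w2 v1) (\<Phi> w1 v2)))"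
    unfolding fscale_sum_right
  proof (rule sum_cuts_cong', unfold prod.case)
    fix w1 w2 assume c: "(w1, w2) \<in> cuts w"
    have p: "path_deg (flip_path w1) = path_deg w1"
      using flip_path_props(5) cuts_flip(2)[OF gen_is_path[OF w] c] by blast
    show "fscale (gam_sign w) (\<Sum>(v1, v2)\<in>cuts v. fscale (ksgn (path_deg (flip_path w1) * path_deg v1))
        (ftens (\<phi> (flip_path w2, v1)) (\<phi> (flip_path w1, v2)))) =
      (\<Sum>(v1, v2)\<in>cuts v. fscale (\<sigma> w1 w2 v1) (ftens (\<Phi> w2 v1) (\<Phi> w1 v2)))"
      unfolding fscale_sum_right p
      by (intro sum.cong refl)
        (simp add: case_prod_beta \<Phi>_eq ftens_fscale_left ftens_fscale_right gam_sign_cuts[OF c] \<sigma>_def ksgn_add mult_ac)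
  qed
  finally show ?thesis .
qed

text \<open>Compatibility with counits, stated for the representative itself: the coefficient of an
  empty path is the value of the counit, which vanishes on nonempty arguments.\<close>

lemma \<phi>_nonempty:
  assumes g: "(x, v) \<in> gen B" and ne: "snd x \<noteq> [] \<or> snd v \<noteq> []" and y: "y \<in> keys (\<phi> (x, v))"
  shows "snd y \<noteq> []"
proof
  assume e: "snd y = []"
  have "lin counit (\<phi> (x, v)) = box_counit (x, v)"
    using hom g by (simp add: aug_coalg_hom_def Let_def gcomp_def)
  also have "box_counit (x, v) = 0"
    using ne by (auto simp: box_counit_def gcomp_def tmap_apply counit_def ftens_eq_lin)
  finally have 0: "Poly_Mapping.lookup (lin counit (\<phi> (x, v))) () = 0" by simp
  note h = hom_maps_homog[OF \<phi>_hom_maps g]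
  \<comment> \<open>All keys have the same source, so at most one of them is an empty path and
    nothing can cancel its coefficient.\<close>
  have "z = y" if "z \<in> keys (\<phi> (x, v))" "snd z = []" for z
    using homogD(2)[OF h that(1)] homogD(2)[OF h y] that e by (simp add: prod_eq_iff)
  then have "(\<Sum>z\<in>keys (\<phi> (x, v)). Poly_Mapping.lookup (fscale (Poly_Mapping.lookup (\<phi> (x, v)) z) (counit z)) ()) =
      (\<Sum>z\<in>{y}. Poly_Mapping.lookup (fscale (Poly_Mapping.lookup (\<phi> (x, v)) z) (counit z)) ())"
    using y by (intro sum.mono_neutral_right) (auto simp: counit_def)
  with 0 have "Poly_Mapping.lookup (\<phi> (x, v)) y = 0"
    by (simp add: lin_def lookup_sum counit_def e)
  with y show False by (simp add: in_keys_iff)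
qed

lemma \<Phi>_nonempty:
  assumes "w \<in> gen TA" "v \<in> gen TC" "snd w \<noteq> [] \<or> snd v \<noteq> []" "y \<in> keys (\<Phi> w v)"
  shows "snd y \<noteq> []"
proof (rule \<phi>_nonempty)
  show "(flip_path w, v) \<in> gen B" using assms flip_path_gen by (simp add: gen_B)
  show "snd (flip_path w) \<noteq> [] \<or> snd v \<noteq> []" using assms by (simp add: flip_path_def)
  show "y \<in> keys (\<phi> (flip_path w, v))"
    by (rule subsetD[OF keys_fscale assms(4)[unfolded \<Phi>_eq]])
qed

section \<open>The coderivation \<open>\<xi>\<close> and its vanishing\<close>

abbreviation "homog1 w v \<equiv>
  homog TCk (\<phi>0 (path_tgt w, fst v)) (\<phi>0 (fst w, path_tgt v)) (path_deg w + path_deg v + 1)"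

definition "\<Phi>b w v = lin bCk (\<Phi> w v)"
definition "\<Phi>A w v = fscale (ksgn (path_deg v)) (lin (\<lambda>x. \<Phi> x v) (coder bA w))"
definition "\<Phi>C w v = lin (\<lambda>x. \<Phi> w x) (coder bC v)"
definition "\<xi> w v = \<Phi>b w v - \<Phi>A w v - \<Phi>C w v"

lemma \<Phi>b_homog: "w \<in> gen TA \<Longrightarrow> v \<in> gen TC \<Longrightarrow>
    homog1 w v (\<Phi>b w v)"
  using hom_maps_homog_lin[OF qCk.coder_hom_maps \<Phi>_homog] by (simp add: \<Phi>b_def)

lemma \<Phi>A_homog:
  assumes w: "w \<in> gen TA" and v: "v \<in> gen TC"
  shows "homog1 w v (\<Phi>A w v)"
  unfolding \<Phi>A_def
proof (intro homog_fscale homog_lin)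
  fix x assume "x \<in> keys (coder bA w)"
  note x = homogD[OF qA.coder_homog[OF w] this]
  show "homog1 w v (\<Phi> x v)"
    using \<Phi>_homog[OF x(1) v] x(2-4) by (simp add: add_ac)
qed

lemma \<Phi>C_homog:
  assumes w: "w \<in> gen TA" and v: "v \<in> gen TC"
  shows "homog1 w v (\<Phi>C w v)"
  unfolding \<Phi>C_def
proof (rule homog_lin)
  fix x assume "x \<in> keys (coder bC v)"
  note x = homogD[OF qC.coder_homog[OF v] this]
  show "homog1 w v (\<Phi> w x)"
    using \<Phi>_homog[OF w x(1)] x(2-4) by (simp add: add_ac)
qed

lemma \<xi>_homog:
  assumes "w \<in> gen TA" "v \<in> gen TC"
  shows "homog1 w v (\<xi> w v)"
  unfolding \<xi>_def using assms by (intro homog_diff \<Phi>b_homog \<Phi>A_homog \<Phi>C_homog)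

text \<open>Needed because the left inverse of the cut loses empty paths. Coderivations never
  produce the empty path, and \<open>\<Phi>\<close> produces it from empty arguments only.\<close>

lemma \<xi>_nonempty:
  assumes w: "w \<in> gen TA" and v: "v \<in> gen TC" and y: "y \<in> keys (\<xi> w v)"
  shows "snd y \<noteq> []"
proof -
  have "y \<in> keys (\<Phi>b w v) \<union> keys (\<Phi>A w v) \<union> keys (\<Phi>C w v)"
    using y keys_diff[of "\<Phi>b w v - \<Phi>A w v" "\<Phi>C w v"] keys_diff[of "\<Phi>b w v" "\<Phi>A w v"] unfolding \<xi>_def by blast
  then consider x where "y \<in> keys (bCk x)"
    | x where "x \<in> keys (coder bA w)" "y \<in> keys (\<Phi> x v)"
    | x where "x \<in> keys (coder bC v)" "y \<in> keys (\<Phi> w x)"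
    using keys_lin[of bCk "\<Phi> w v"] keys_lin[of "\<lambda>x. \<Phi> x v" "coder bA w"] keys_lin[of "\<Phi> w" "coder bC v"]
      keys_fscale[of "ksgn (path_deg v)" "lin (\<lambda>x. \<Phi> x v) (coder bA w)"]
    unfolding \<Phi>b_def \<Phi>A_def \<Phi>C_def by blast
  then show ?thesis
  proof cases
    case 1
    then show ?thesis by (rule qCk.coder_nonempty)
  next
    case 2
    then show ?thesis
      using \<Phi>_nonempty[OF homogD(1)[OF qA.coder_homog[OF w]] v] qA.coder_nonempty by blast
  next
    case 3
    then show ?thesis
      using \<Phi>_nonempty[OF w homogD(1)[OF qC.coder_homog[OF v]]] qC.coder_nonempty by blast
  qed
qed

text \<open>\<open>f\<close> is a \<open>(\<Phi>, \<Phi>)\<close>-coderivation of degree 1 if \<open>lin cut (f w v)\<close> agrees with \<open>leibniz f w v\<close>.\<close>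

definition "leibniz f w v = (\<Sum>(w1, w2)\<in>cuts w. \<Sum>(v1, v2)\<in>cuts v. fscale (\<sigma> w1 w2 v1)
  (ftens (\<Phi> w2 v1) (f w1 v2) + fscale (ksgn (path_deg w1 + path_deg v2)) (ftens (f w2 v1) (\<Phi> w1 v2))))"

lemma \<Phi>b_leibniz:
  assumes w: "w \<in> gen TA" and v: "v \<in> gen TC"
  shows "eqv (tens TCk TCk) (lin cut (\<Phi>b w v)) (leibniz \<Phi>b w v)"
proof -
  have "lin cut (\<Phi>b w v) = lin (\<lambda>x. lin (tensor_coder (Ck_b scP)) (cut x)) (\<Phi> w v)"
    unfolding \<Phi>b_def lin_lin
    by (rule lin_cong) (use qCk.cut_coder' homogD(1)[OF \<Phi>_homog[OF w v]] in blast)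
  also have "\<dots> = lin (tensor_coder (Ck_b scP)) (lin cut (\<Phi> w v))"
    by (simp add: lin_lin)
  also have "eqv (tens TCk TCk) \<dots> (lin (tensor_coder (Ck_b scP)) (\<Sum>(w1, w2)\<in>cuts w. \<Sum>(v1, v2)\<in>cuts v.
    fscale (\<sigma> w1 w2 v1) (ftens (\<Phi> w2 v1) (\<Phi> w1 v2))))"
  proof (rule eqv_lin[OF \<Phi>_cut[OF w v]])
    fix r assume r: "r \<in> rels (tens TCk TCk)"
    note H = homogeneous_rels_Ts
    have "lin (tmap path_deg 0 idm bCk) r \<in> rels (tens TCk TCk)"
      by (rule tmap_rels[OF H H H H idm_hom_maps qCk.coder_hom_maps r]) simp
    moreover have "lin (tmap path_deg 1 bCk idm) r \<in> rels (tens TCk TCk)"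
      by (rule tmap_rels[OF H H H H qCk.coder_hom_maps idm_hom_maps r]) simp
    ultimately show "lin (tensor_coder (Ck_b scP)) r \<in> rels (tens TCk TCk)"
      unfolding tensor_coder_def plus_fun_def lin_fun_add by (rule rels_add)
  qed
  also have "lin (tensor_coder (Ck_b scP)) (\<Sum>(w1, w2)\<in>cuts w. \<Sum>(v1, v2)\<in>cuts v.
      fscale (\<sigma> w1 w2 v1) (ftens (\<Phi> w2 v1) (\<Phi> w1 v2))) = leibniz \<Phi>b w v"
    unfolding lin_sum_cuts2 leibniz_def
  proof (rule sum_cuts_cong2)
    fix w1 w2 v1 v2 assume "(w1, w2) \<in> cuts w" "(v1, v2) \<in> cuts v"
    then have g: "w1 \<in> gen TA" "v2 \<in> gen TC" using cuts_gen w v by blast+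
    show "lin (tensor_coder (Ck_b scP)) (fscale (\<sigma> w1 w2 v1) (ftens (\<Phi> w2 v1) (\<Phi> w1 v2))) =
       fscale (\<sigma> w1 w2 v1) (ftens (\<Phi> w2 v1) (\<Phi>b w1 v2) +
         fscale (ksgn (path_deg w1 + path_deg v2)) (ftens (\<Phi>b w2 v1) (\<Phi> w1 v2)))"
      unfolding lin_fscale by (subst tensor_coder_ftens[OF \<Phi>_homog[OF g]]) (simp_all add: \<Phi>b_def)
  qed
  finally show ?thesis .
qed

text \<open>The signs are the point. Raising the degree of \<open>w2\<close> by 1 changes
  \<open>\<sigma>\<close> by \<open>ksgn (path_deg w1)\<close>, raising that of \<open>w1\<close> by
  \<open>ksgn (path_deg w2 + path_deg v1)\<close>; with the prefactor
  \<open>ksgn (path_deg v)\<close> this leaves the Koszul signs of \<open>leibniz\<close>.\<close>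

lemma \<Phi>A_leibniz:
  assumes w: "w \<in> gen TA" and v: "v \<in> gen TC"
  shows "eqv (tens TCk TCk) (lin cut (\<Phi>A w v)) (leibniz \<Phi>A w v)"
proof -
  \<comment> \<open>Only the cuts of \<open>v\<close> are summed, so that \<open>t\<close> describes
    the comultiplication as a function of the first variable.\<close>
  define t where "t = (\<lambda>(w1, w2). \<Sum>(v1, v2)\<in>cuts v. fscale (\<sigma> w1 w2 v1) (ftens (\<Phi> w2 v1) (\<Phi> w1 v2)))"
  let ?A = "\<lambda>w v. lin (\<lambda>x. \<Phi> x v) (coder bA w)"
  have "eqv (tens TCk TCk) (lin cut (?A w v)) (\<Sum>(w1, w2)\<in>cuts w. lin (\<lambda>x. t (w1, x)) (coder bA w2) +
      fscale (ksgn (path_deg w2)) (lin (\<lambda>x. t (x, w2)) (coder bA w1)))"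
    by (rule qA.cut_lin_coder[OF w]) (use \<Phi>_cut v in \<open>simp add: t_def cut_eq lin_sum case_prod_beta\<close>)
  then have "eqv (tens TCk TCk) (lin cut (\<Phi>A w v)) (fscale (ksgn (path_deg v))
      (\<Sum>(w1, w2)\<in>cuts w. lin (\<lambda>x. t (w1, x)) (coder bA w2) +
      fscale (ksgn (path_deg w2)) (lin (\<lambda>x. t (x, w2)) (coder bA w1))))"
    unfolding \<Phi>A_def lin_fscale by (rule eqv_fscale)
  also have "\<dots> = leibniz \<Phi>A w v"
    unfolding leibniz_def fscale_sum_right
  proof (rule sum_cuts_cong', unfold prod.case)
    fix w1 w2 assume c: "(w1, w2) \<in> cuts w"
    note g = cuts_gen[OF c w]
    have s: "\<sigma> w1 x v1 = \<sigma> w1 w2 v1 * ksgn (path_deg w1)" if "x \<in> keys (coder bA w2)" for x v1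
      unfolding \<sigma>_def ksgn_add[symmetric] using homogD(4)[OF qA.coder_homog[OF g(2)] that]
      by (intro ksgn_cong) (auto simp: algebra_simps)
    have s': "\<sigma> x w2 v1 = \<sigma> w1 w2 v1 * ksgn (path_deg w2 + path_deg v1)" if "x \<in> keys (coder bA w1)" for x v1
      unfolding \<sigma>_def ksgn_add[symmetric] using homogD(4)[OF qA.coder_homog[OF g(1)] that]
      by (intro ksgn_cong) (auto simp: algebra_simps)
    have "lin (\<lambda>x. t (w1, x)) (coder bA w2) =
        lin (\<lambda>x. \<Sum>(v1, v2)\<in>cuts v. fscale (\<sigma> w1 w2 v1 * ksgn (path_deg w1)) (ftens (\<Phi> x v1) (\<Phi> w1 v2))) (coder bA w2)"
      by (rule lin_cong) (simp add: t_def s)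
    then have 1: "lin (\<lambda>x. t (w1, x)) (coder bA w2) =
        (\<Sum>(v1, v2)\<in>cuts v. fscale (\<sigma> w1 w2 v1 * ksgn (path_deg w1)) (ftens (?A w2 v1) (\<Phi> w1 v2)))"
      by (simp add: lin_fun_sum case_prod_beta lin_fun_scale ftens_eq_lin lin_lin)
    have "lin (\<lambda>x. t (x, w2)) (coder bA w1) =
        lin (\<lambda>x. \<Sum>(v1, v2)\<in>cuts v. fscale (\<sigma> w1 w2 v1 * ksgn (path_deg w2 + path_deg v1)) (ftens (\<Phi> w2 v1) (\<Phi> x v2))) (coder bA w1)"
      by (rule lin_cong) (simp add: t_def s')
    then have 2: "lin (\<lambda>x. t (x, w2)) (coder bA w1) =
        (\<Sum>(v1, v2)\<in>cuts v. fscale (\<sigma> w1 w2 v1 * ksgn (path_deg w2 + path_deg v1)) (ftens (\<Phi> w2 v1) (?A w1 v2)))"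
      by (simp add: lin_fun_sum case_prod_beta lin_fun_scale ftens_eq_lin lin_lin lin_swap[of _ "coder bA w1"])
    show "fscale (ksgn (path_deg v)) (lin (\<lambda>x. t (w1, x)) (coder bA w2) +
        fscale (ksgn (path_deg w2)) (lin (\<lambda>x. t (x, w2)) (coder bA w1))) =
      (\<Sum>(v1, v2)\<in>cuts v. fscale (\<sigma> w1 w2 v1) (ftens (\<Phi> w2 v1) (\<Phi>A w1 v2) +
        fscale (ksgn (path_deg w1 + path_deg v2)) (ftens (\<Phi>A w2 v1) (\<Phi> w1 v2))))"
      unfolding 1 2 fscale_sum_right sum.distrib[symmetric]
    proof (rule sum_cuts_cong', unfold prod.case)
      fix v1 v2 assume cv: "(v1, v2) \<in> cuts v"
      have a: "ksgn (path_deg v) * (\<sigma> w1 w2 v1 * ksgn (path_deg w1)) =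
          \<sigma> w1 w2 v1 * (ksgn (path_deg w1 + path_deg v2) * ksgn (path_deg v1))"
        and b: "ksgn (path_deg v) * (ksgn (path_deg w2) * (\<sigma> w1 w2 v1 * ksgn (path_deg w2 + path_deg v1))) =
          \<sigma> w1 w2 v1 * ksgn (path_deg v2)"
        unfolding \<sigma>_def ksgn_add[symmetric] using cuts_deg[OF cv] by (auto intro!: ksgn_cong)
      show "fscale (ksgn (path_deg v)) (fscale (\<sigma> w1 w2 v1 * ksgn (path_deg w1)) (ftens (?A w2 v1) (\<Phi> w1 v2)) +
          fscale (ksgn (path_deg w2)) (fscale (\<sigma> w1 w2 v1 * ksgn (path_deg w2 + path_deg v1)) (ftens (\<Phi> w2 v1) (?A w1 v2)))) =
        fscale (\<sigma> w1 w2 v1) (ftens (\<Phi> w2 v1) (\<Phi>A w1 v2) +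
          fscale (ksgn (path_deg w1 + path_deg v2)) (ftens (\<Phi>A w2 v1) (\<Phi> w1 v2)))"
        by (simp only: \<Phi>A_def fscale_right_distrib fscale_fscale ftens_fscale_left
            ftens_fscale_right a b add.commute)
    qed
  qed
  finally show ?thesis .
qed

lemma \<Phi>C_leibniz:
  assumes w: "w \<in> gen TA" and v: "v \<in> gen TC"
  shows "eqv (tens TCk TCk) (lin cut (\<Phi>C w v)) (leibniz \<Phi>C w v)"
proof -
  define t where "t = (\<lambda>(v1, v2). \<Sum>(w1, w2)\<in>cuts w. fscale (\<sigma> w1 w2 v1) (ftens (\<Phi> w2 v1) (\<Phi> w1 v2)))"
  have "eqv (tens TCk TCk) (lin cut (\<Phi>C w v)) (\<Sum>(v1, v2)\<in>cuts v. lin (\<lambda>x. t (v1, x)) (coder bC v2) +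
      fscale (ksgn (path_deg v2)) (lin (\<lambda>x. t (x, v2)) (coder bC v1)))"
    unfolding \<Phi>C_def
  proof (rule qC.cut_lin_coder[OF v])
    fix x assume x: "x \<in> gen TC"
    have "lin t (cut x) = (\<Sum>y\<in>cuts x. \<Sum>z\<in>cuts w. fscale (\<sigma> (fst z) (snd z) (fst y)) (ftens (\<Phi> (snd z) (fst y)) (\<Phi> (fst z) (snd y))))"
      by (simp add: cut_eq lin_sum t_def case_prod_beta)
    then show "eqv (tens TCk TCk) (lin cut (\<Phi> w x)) (lin t (cut x))"
      using \<Phi>_cut[OF w x] by (simp add: case_prod_beta) (subst sum.swap, simp)
  qed
  also have "\<dots> = (\<Sum>(v1, v2)\<in>cuts v. \<Sum>(w1, w2)\<in>cuts w. fscale (\<sigma> w1 w2 v1)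
      (ftens (\<Phi> w2 v1) (\<Phi>C w1 v2) + fscale (ksgn (path_deg w1 + path_deg v2)) (ftens (\<Phi>C w2 v1) (\<Phi> w1 v2))))"
  proof (rule sum_cuts_cong)
    fix v1 v2 assume c: "(v1, v2) \<in> cuts v"
    note g = cuts_gen[OF c v]
    have s: "\<sigma> w1 w2 x = \<sigma> w1 w2 v1 * ksgn (path_deg w1)" if "x \<in> keys (coder bC v1)" for x w1 w2
      unfolding \<sigma>_def ksgn_add[symmetric] using homogD(4)[OF qC.coder_homog[OF g(1)] that]
      by (intro ksgn_cong) (auto simp: algebra_simps)
    have 1: "lin (\<lambda>x. t (v1, x)) (coder bC v2) =
        (\<Sum>(w1, w2)\<in>cuts w. fscale (\<sigma> w1 w2 v1) (ftens (\<Phi> w2 v1) (\<Phi>C w1 v2)))"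
      by (simp add: t_def lin_fun_sum case_prod_beta lin_fun_scale \<Phi>C_def ftens_eq_lin lin_lin lin_swap[of _ "coder bC v2"])
    have "lin (\<lambda>x. t (x, v2)) (coder bC v1) =
        lin (\<lambda>x. \<Sum>(w1, w2)\<in>cuts w. fscale (\<sigma> w1 w2 v1 * ksgn (path_deg w1)) (ftens (\<Phi> w2 x) (\<Phi> w1 v2))) (coder bC v1)"
      by (rule lin_cong) (simp add: t_def s)
    then have 2: "lin (\<lambda>x. t (x, v2)) (coder bC v1) =
        (\<Sum>(w1, w2)\<in>cuts w. fscale (\<sigma> w1 w2 v1 * ksgn (path_deg w1)) (ftens (\<Phi>C w2 v1) (\<Phi> w1 v2)))"
      by (simp add: lin_fun_sum case_prod_beta lin_fun_scale \<Phi>C_def ftens_eq_lin lin_lin)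
    show "lin (\<lambda>x. t (v1, x)) (coder bC v2) + fscale (ksgn (path_deg v2)) (lin (\<lambda>x. t (x, v2)) (coder bC v1)) =
      (\<Sum>(w1, w2)\<in>cuts w. fscale (\<sigma> w1 w2 v1) (ftens (\<Phi> w2 v1) (\<Phi>C w1 v2) +
        fscale (ksgn (path_deg w1 + path_deg v2)) (ftens (\<Phi>C w2 v1) (\<Phi> w1 v2))))"
      unfolding 1 2 fscale_sum_right sum.distrib[symmetric]
      by (rule sum_cuts_cong') (simp add: fscale_right_distrib ksgn_add mult_ac)
  qed
  also have "\<dots> = leibniz \<Phi>C w v"
    unfolding leibniz_def case_prod_beta by (rule sum.swap)
  finally show ?thesis .
qed

lemma \<xi>_leibniz:
  assumes w: "w \<in> gen TA" and v: "v \<in> gen TC"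
  shows "eqv (tens TCk TCk) (lin cut (\<xi> w v)) (leibniz \<xi> w v)"
proof -
  have "leibniz \<xi> w v = leibniz \<Phi>b w v - leibniz \<Phi>A w v - leibniz \<Phi>C w v"
    by (simp add: leibniz_def \<xi>_def case_prod_beta ftens_diff_left ftens_diff_right
        fscale_right_diff_distrib fscale_right_distrib sum_subtractf sum.distrib)
  then show ?thesis
    unfolding \<xi>_def lin_diff by (simp add: eqv_diff \<Phi>b_leibniz \<Phi>A_leibniz \<Phi>C_leibniz w v)
qed

lemma \<Phi>_unit:
  assumes "w \<in> gen TA" "v \<in> gen TC" "snd w = []" "snd v = []"
  shows "lin pr1 (\<Phi> w v) \<in> rels (sCk scP)"
proof -
  have e: "w = (fst w, [])" "v = (fst v, [])" using assms by (auto simp: prod_eq_iff)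
  have "fst w \<in> ObA" "fst v \<in> ObC" using assms by (auto simp: Ts_sel)
  then have "lin pr1 (\<phi> ((fst w, []), (fst v, []))) \<in> rels (sCk scP)"
    using hom by (simp add: aug_coalg_hom_def Let_def gcomp_def)
  moreover have "flip_path w = (fst w, [])" by (subst e) (simp add: flip_path_def)
  ultimately show ?thesis
    using e(2) by (simp add: \<Phi>_eq lin_fscale free_module.subspace_scale)
qed

text \<open>Splitting off the first letter turns the Leibniz formula into an expression for
  \<open>\<xi>\<close>. Terms with \<open>\<xi>\<close> in the first factor vanish by the hypothesis
  on \<open>pr1\<close>. Terms with \<open>\<xi>\<close> in the second factor have shorter
  arguments, unless \<open>w2\<close> and \<open>v1\<close> are both empty; then
  \<open>\<phi>\<^sub>0\<^sub>0 = 0\<close> removes them.\<close>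

lemma \<xi>_rels:
  assumes pr1: "\<And>w v. w \<in> gen TA \<Longrightarrow> v \<in> gen TC \<Longrightarrow> lin pr1 (\<xi> w v) \<in> rels (sCk scP)"
    and "w \<in> gen TA" "v \<in> gen TC"
  shows "\<xi> w v \<in> rels TCk"
  using assms(2,3)
proof (induction "length (snd w) + length (snd v)" arbitrary: w v rule: less_induct)
  case less
  note w = less.prems(1) and v = less.prems(2)
  have "\<xi> w v = join1 (lin cut (\<xi> w v))"
    by (rule join1_cut_lin[symmetric]) (use \<xi>_nonempty[OF w v] homogD(1)[OF \<xi>_homog[OF w v]] in blast)
  also have "eqv TCk \<dots> (join1 (leibniz \<xi> w v))"
    using join1_rels[OF \<xi>_leibniz[OF w v, unfolded eqv_def]] by (simp add: eqv_def join1_def lin_diff)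
  also have "join1 (leibniz \<xi> w v) = (\<Sum>(w1, w2)\<in>cuts w. \<Sum>(v1, v2)\<in>cuts v.
    fscale (\<sigma> w1 w2 v1) (join1 (ftens (\<Phi> w2 v1) (\<xi> w1 v2)) +
      fscale (ksgn (path_deg w1 + path_deg v2)) (join1 (ftens (\<xi> w2 v1) (\<Phi> w1 v2)))))"
    by (simp add: leibniz_def join1_def lin_sum lin_add lin_fscale case_prod_beta)
  also have "eqv TCk \<dots> 0"
    unfolding eqv_0_iff
  proof (rule rels_sum_cuts2)
    fix w1 w2 v1 v2 assume cw: "(w1, w2) \<in> cuts w" and cv: "(v1, v2) \<in> cuts v"
    note g = cuts_gen[OF cw w] cuts_gen[OF cv v]
    have m: "path_tgt w1 = fst w2" "fst v2 = path_tgt v1" using cw cv by (simp_all add: cuts_iff)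
    have comp: "ftens p q \<in> rels (tens (susp (hom_scale scP) (complexes scP) (complexes scP) (Ck scP)) TCk)"
      if "p \<in> rels (sCk scP)" "homog (sCk scP) X Y i p" "homog TCk Y Z j q" for p q X Y Z i j
      by (rule ftens_rels_left[OF homogeneous_rels_susp _ that(1)])
        (use homogD[OF that(2)] homogD[OF that(3)] in auto)
    note h1 = hom_maps_homog_lin[OF pr1_hom_maps, unfolded id_apply]
    have 1: "join1 (ftens (\<Phi> w2 v1) (\<xi> w1 v2)) \<in> rels TCk"
    proof (cases "snd w2 = [] \<and> snd v1 = []")
      case True
      have "lin pr1 (\<Phi> w2 v1) \<in> rels (sCk scP)" using \<Phi>_unit[OF g(2,3)] True by blast
      from comp[OF this h1[OF \<Phi>_homog[OF g(2,3)]] \<xi>_homog[OF g(1,4), unfolded m]]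
      show ?thesis
        by (subst join1_ftens[OF \<xi>_homog[OF g(1,4)]]) (simp_all add: cons_path_rels)
    next
      case False
      moreover have "snd w = snd w1 @ snd w2" "snd v = snd v1 @ snd v2"
        using cw cv by (simp_all add: cuts_iff)
      ultimately have "length (snd w1) + length (snd v2) < length (snd w) + length (snd v)"
        by auto
      from less.hyps[OF this g(1,4)] have r: "\<xi> w1 v2 \<in> rels TCk" .
      have "ftens (\<Phi> w2 v1) (\<xi> w1 v2) \<in> rels (tens TCk TCk)"
        by (rule ftens_rels_right[OF homogeneous_rels_Ts _ r, of _ _ "\<phi>0 (path_tgt w1, fst v2)"])
          (use homogD[OF \<Phi>_homog[OF g(2,3)]] homogD[OF \<xi>_homog[OF g(1,4)]] m in auto)
      then show ?thesis by (rule join1_rels)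
    qed
    have 2: "join1 (ftens (\<xi> w2 v1) (\<Phi> w1 v2)) \<in> rels TCk"
      using comp[OF pr1[OF g(2,3)] h1[OF \<xi>_homog[OF g(2,3)]] \<Phi>_homog[OF g(1,4), unfolded m]]
      by (subst join1_ftens[OF \<Phi>_homog[OF g(1,4)]]) (simp_all add: cons_path_rels)
    show "fscale (\<sigma> w1 w2 v1) (join1 (ftens (\<Phi> w2 v1) (\<xi> w1 v2)) +
        fscale (ksgn (path_deg w1 + path_deg v2)) (join1 (ftens (\<xi> w2 v1) (\<Phi> w1 v2)))) \<in> rels TCk"
      by (intro rels_scale rels_add 1 2)
  qed
  finally show ?case by (simp add: eqv_0_iff)
qed

lemma functor_iff:
  "ainf_functor scA ObA A bA scC ObC C bC scP \<phi>0 \<phi> \<longleftrightarrow>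
     (\<forall>w\<in>gen TA. \<forall>v\<in>gen TC. lin pr1 (\<xi> w v) \<in> rels (sCk scP))"
proof -
  let ?f = "\<lambda>g. (\<phi> \<triangleright> bCk) g - ((tmap path_deg 1 (b_opp bA) idm + tmap path_deg 0 idm (coder bC)) \<triangleright> \<phi>) g"
  have f: "\<xi> w v = fscale (gam_sign w) (?f (flip_path w, v))" if w: "w \<in> gen TA" for w v
  proof -
    let ?A = "lin (\<lambda>x. \<Phi> x v) (coder bA w)"
    \<comment> \<open>\<open>b_opp\<close> is \<open>\<gamma>\<close>, then the coderivation, then
      \<open>\<gamma>\<close>. On a reversed path the first \<open>\<gamma>\<close> gives back
      \<open>w\<close> up to sign, and the last one is absorbed into \<open>\<Phi>\<close>.\<close>
    have "lin (\<lambda>x. \<phi> (x, v)) (b_opp bA (flip_path w)) = fscale (gam_sign w) ?A"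
      using flip_path_props(4)[OF gen_is_path[OF w]]
      by (simp add: b_opp_def gcomp_def gam_eq[of "flip_path w"] lin_fscale lin_lin \<Phi>_def[abs_def])
    then have "?f (flip_path w, v) = lin bCk (\<phi> (flip_path w, v)) -
        (fscale (ksgn (path_deg v)) (fscale (gam_sign w) ?A) + lin (\<lambda>x. \<phi> (flip_path w, x)) (coder bC v))"
      by (simp add: gcomp_def tmap_apply lin_add lin_fscale lin_ftens)
    then show ?thesis
      by (simp add: \<xi>_def \<Phi>b_def \<Phi>A_def \<Phi>C_def \<Phi>_eq[of w] lin_fscale lin_fun_scale fscale_right_diff_distrib
          fscale_right_distrib mult.left_commute[of _ "ksgn _"] gam_sign_square diff_diff_eq)
  qed
  have "ainf_functor scA ObA A bA scC ObC C bC scP \<phi>0 \<phi> \<longleftrightarrow> (\<forall>g\<in>gen B. ?f g \<in> rels TCk)"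
    using hom by (simp add: ainf_functor_def eq_on_def)
  also have "\<dots> \<longleftrightarrow> (\<forall>w\<in>gen TA. \<forall>v\<in>gen TC. \<xi> w v \<in> rels TCk)"
  proof (intro iffI ballI)
    fix w v assume *: "\<forall>g\<in>gen B. ?f g \<in> rels TCk" "w \<in> gen TA" "v \<in> gen TC"
    have "(flip_path w, v) \<in> gen B" using * flip_path_gen by (simp add: gen_B)
    with * show "\<xi> w v \<in> rels TCk"
      unfolding f[OF *(2)] by (intro rels_scale) blast
  next
    fix g assume *: "\<forall>w\<in>gen TA. \<forall>v\<in>gen TC. \<xi> w v \<in> rels TCk" "g \<in> gen B"
    obtain x v where e: "g = (x, v)" by (metis surj_pair)
    have x: "x \<in> gen (Ts scA ObA (opp A))" and v: "v \<in> gen TC" using *(2) by (simp_all add: e gen_B)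
    have w: "flip_path x \<in> gen TA" using flip_path_gen[OF x] by simp
    note ff = flip_path_props(4)[OF gen_is_path[OF x]]
    have "fscale (gam_sign x) (\<xi> (flip_path x) v) \<in> rels TCk"
      using * w v by (intro rels_scale) blast
    then show "?f g \<in> rels TCk"
      unfolding f[OF w] ff e by (simp add: gam_sign_square)
  qed
  also have "\<dots> \<longleftrightarrow> (\<forall>w\<in>gen TA. \<forall>v\<in>gen TC. lin pr1 (\<xi> w v) \<in> rels (sCk scP))"
    using \<xi>_rels hom_maps_rels[OF pr1_hom_maps] by blast
  finally show ?thesis .
qed

end

section \<open>The first component of the codifferential of complexes, evaluated as a graded
  map\<close>

context scalar_module
begin

lemma lext_apply: "lext (hsc) h q i x = lext sc (\<lambda>w. h w i x) q"
proof -
  have "(\<Sum>w\<in>W. f w) i x = (\<Sum>w\<in>W. f w i x)" for W and f :: "_ \<Rightarrow> int \<Rightarrow> 'p \<Rightarrow> 'p"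
    by (induction W rule: infinite_finite_induct) auto
  then show ?thesis by (simp add: lext_def hom_scale_def)
qed

lemma hom_diff_rels:
  assumes "r \<in> rels (sCk sc)"
  shows "lext (hsc) (\<lambda>l. hom_diff sc (lsrc l) (ltgt l) (ldeg l) (lelt l)) r = 0"
proof -
  interpret hs: module hsc by (rule module_hom)
  have "lext (hsc) (\<lambda>l. hom_diff sc (lsrc l) (ltgt l) (ldeg l) (lelt l)) r \<in> {0}"
  proof (rule hs.lext_rels[OF hs.subspace_single_0 _ assms])
    fix c d k l m assume *: "k \<in> gen (sCk sc)" "l \<in> gen (sCk sc)" "m \<in> gen (sCk sc)" "comb_rel (sCk sc) c d k l m"
    show "hom_diff sc (lsrc m) (ltgt m) (ldeg m) (lelt m) -
        hsc c (hom_diff sc (lsrc k) (ltgt k) (ldeg k) (lelt k)) -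
        hsc d (hom_diff sc (lsrc l) (ltgt l) (ldeg l) (lelt l)) \<in> {0}"
      unfolding comb_rel_hom_diff[OF *] comb_rel_suspD[OF *(4)] by simp
  qed
  then show ?thesis by simp
qed

text \<open>\<open>b\<^sub>2\<close> of the dg category with its sign, as an actual map instead of a
  letter, so that linear extension takes place in the module of graded maps.\<close>

definition comp_pair :: "'p cletter \<times> 'p cletter \<Rightarrow> int \<Rightarrow> 'p \<Rightarrow> 'p" where
  "comp_pair = (\<lambda>(l, m). hsc (- ksgn (ldeg m)) (hom_comp (ldeg l) (lelt l) (lelt m)))"

lemma comp_pair_rels:
  assumes "r \<in> rels (tens (sCk sc) (sCk sc))"
  shows "lext (hsc) comp_pair r = 0"
proof -
  interpret hs: module hsc by (rule module_hom)
  have "lext (hsc) comp_pair r \<in> {0}"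
  proof (rule hs.lext_rels[OF hs.subspace_single_0 _ assms])
    fix c d u v w assume *: "u \<in> gen (tens (sCk sc) (sCk sc))" "v \<in> gen (tens (sCk sc) (sCk sc))"
      "w \<in> gen (tens (sCk sc) (sCk sc))" "comb_rel (tens (sCk sc) (sCk sc)) c d u v w"
    obtain k k' l l' m m' where e: "u = (k, k')" "v = (l, l')" "w = (m, m')" by (metis surj_pair)
    note h = comb_rel_hom_comp[OF *[unfolded e]]
    show "comp_pair w - hsc c (comp_pair u) - hsc d (comp_pair v) \<in> {0}"
      by (simp add: comp_pair_def e h hs.scale_right_distrib mult.commute)
  qed
  then show ?thesis by simp
qed

definition comp_path :: "('p cpx, int \<Rightarrow> 'p \<Rightarrow> 'p) path \<Rightarrow> int \<Rightarrow> 'p \<Rightarrow> 'p" where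
  "comp_path x = (if length (snd x) = 2 then comp_pair (snd x ! 0, snd x ! 1) else 0)"

text \<open>In a dg category only \<open>b\<^sub>1\<close> and \<open>b\<^sub>2\<close> are nonzero,
  so only paths of length 1 and 2 contribute.\<close>

lemma realize_pr1_bCk:
  assumes q: "\<And>x. x \<in> keys q \<Longrightarrow> x \<in> gen (TsCk sc)"
  shows "realize (hsc) (lin pr1 (lin (coder (Ck_b sc)) q)) =
    lext (hsc) (\<lambda>l. hom_diff sc (lsrc l) (ltgt l) (ldeg l) (lelt l)) (lin pr1 q) +
    lext (hsc) comp_path q"
proof -
  interpret hs: module hsc by (rule module_hom)
  have r: "realize (hsc) (fscale c (unit_vec l)) = hsc c (lelt l)" for c and l :: "'p cletter"
    by (simp add: realize_eq_lext hs.lext_fscale)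
  let ?D = "\<lambda>l. hom_diff sc (lsrc l) (ltgt l) (ldeg l) (lelt l)"
  have "realize (hsc) (lin pr1 (coder (Ck_b sc) x)) = lext (hsc) ?D (pr1 x) + comp_path x"
    if x: "x \<in> gen (TsCk sc)" for x
  proof -
    obtain X ls where e: "x = (X, ls)" by (metis surj_pair)
    have p: "lin pr1 (coder (Ck_b sc) x) = (if ls = [] then 0 else Ck_b sc (length ls) (X, ls))"
      using pr1_coder[of X ls "Ck_b sc"] gen_is_path[OF x] by (simp add: e)
    consider "ls = []" | l where "ls = [l]" | l m where "ls = [l, m]" | "length ls \<noteq> 0" "length ls \<noteq> 1" "length ls \<noteq> 2"
      by (cases ls; cases "tl ls"; cases "tl (tl ls)"; auto)
    then show ?thesis
    proof cases
      case 1
      then show ?thesis unfolding p by (simp add: e pr1_def comp_path_def realize_def)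
    next
      case 2
      have "Ck_b sc (length ls) (X, ls) = Ck_b sc 1 (X, [l])" by (simp add: 2)
      then show ?thesis
        unfolding p Ck_b_1 using r[of 1] by (simp add: 2 e pr1_def comp_path_def)
    next
      case 3
      have "Ck_b sc (length ls) (X, ls) = Ck_b sc 2 (X, [l, m])" by (simp add: 3 numeral_2_eq_2)
      then have "realize (hsc) (Ck_b sc (length ls) (X, ls)) = comp_pair (l, m)"
        unfolding Ck_b_2 by (simp only: r comp_pair_def prod.case letter.sel)
      then show ?thesis
        unfolding p by (simp add: 3 e pr1_def comp_path_def)
    next
      case 4
      then show ?thesis
        unfolding p using Ck_b_other[of "length ls" sc "(X, ls)"] by (auto simp: e pr1_def comp_path_def realize_def)
    qed
  qed
  then have "realize (hsc) (lin pr1 (lin (coder (Ck_b sc)) q)) =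
      lext (hsc) (\<lambda>x. lext (hsc) ?D (pr1 x) + comp_path x) q"
    unfolding lin_lin hs.realize_lin using q by (intro hs.lext_cong) blast
  then show ?thesis by (simp add: hs.lext_fun_add hs.lext_lin)
qed

text \<open>The part of length 2 can be read off from the cut by
  \<open>pr\<^sub>1 \<otimes> pr\<^sub>1\<close>. In this form the homomorphism property of
  \<open>\<phi>\<close> becomes applicable to the term with \<open>m\<^sub>2\<close>.\<close>

lemma comp_path_cut:
  assumes "is_path (fst x) (snd x)"
  shows "lext (hsc) comp_pair (lin (tmap path_deg 0 pr1 pr1) (cut x)) = comp_path x"
proof -
  interpret hs: module hsc by (rule module_hom)
  obtain X ls where e: "x = (X, ls)" by (metis surj_pair)
  let ?f = "\<lambda>(a, b). if length a = 1 \<and> length b = 1 then comp_pair (hd a, hd b) else 0"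
  have *: "lext (hsc) comp_pair (tmap path_deg 0 pr1 pr1 ((X, a), (Y, b))) = ?f (a, b)" for Y a b
    by (simp add: tmap_apply pr1_def ftens_eq_lin)
  have "lext (hsc) comp_pair (lin (tmap path_deg 0 pr1 pr1) (cut x)) = (\<Sum>y\<in>splits ls. ?f y)"
    unfolding e cut_eq sum_cuts lin_sum hs.lext_sum by (rule sum.cong[OF refl], clarify) (simp add: * del: One_nat_def)
  also have "\<dots> = comp_path x"
  proof (cases "length ls = 2")
    case True
    then obtain l m where ls: "ls = [l, m]" by (auto simp: length_Suc_conv numeral_2_eq_2)
    have "(\<Sum>y\<in>splits ls. ?f y) = (\<Sum>y\<in>{([l], [m])}. ?f y)"
    proof (rule sum.mono_neutral_right[OF finite_splits])
      show "\<forall>y\<in>splits ls - {([l], [m])}. ?f y = 0"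
        by (auto simp: splits_def ls length_Suc_conv split: if_splits)
    qed (simp add: splits_def ls)
    then show ?thesis by (simp add: e ls comp_path_def)
  next
    case False
    have "(\<Sum>y\<in>splits ls. ?f y) = 0"
      by (rule sum.neutral) (use False in \<open>auto simp: splits_def\<close>)
    then show ?thesis using False by (simp add: e comp_path_def)
  qed
  finally show ?thesis .
qed

lemma comp_path_lin_cut:
  assumes q: "\<And>x. x \<in> keys q \<Longrightarrow> x \<in> gen (TsCk sc)"
  shows "lext (hsc) comp_path q = lext (hsc) comp_pair (lin (tmap path_deg 0 pr1 pr1) (lin cut q))"
proof -
  interpret hs: module hsc by (rule module_hom)
  have "lext (hsc) comp_path q =
      lext (hsc) (\<lambda>x. lext (hsc) comp_pair (lin (tmap path_deg 0 pr1 pr1) (cut x))) q"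
    by (rule hs.lext_cong) (use comp_path_cut gen_is_path q in metis)
  then show ?thesis by (simp add: hs.lext_lin)
qed

end

section \<open>The correspondence\<close>

lemma neg_ksgn: "- ksgn n = (ksgn (n + 1) :: 'k::comm_ring_1)"
  by (simp add: ksgn_def)

locale connection_correspondence =
  bicomodule_connection scA scC ObA A bA ObC C bC scP P bP +
  augmented_hom scA scC ObA A bA ObC C bC scP \<phi>0 \<phi>
  for scA :: "'k::comm_ring_1 \<Rightarrow> 'a::ab_group_add \<Rightarrow> 'a"
    and scC :: "'k \<Rightarrow> 'c::ab_group_add \<Rightarrow> 'c"
    and ObA :: "'o set" and A bA and ObC :: "'q set" and C bC
    and scP :: "'k \<Rightarrow> 'p::ab_group_add \<Rightarrow> 'p" and P bP \<phi>0 \<phi> +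
  assumes corr: "corresponds scA ObA A scC ObC C scP P bP \<phi>0 \<phi>"
begin

lemma gen_ends:
  assumes "w \<in> gen (Ts sc Ob M)"
  shows "fst w \<in> Ob" "path_tgt w \<in> Ob"
  using assms by (cases w; auto simp: Ts_sel intro: path_tgt_mem)+

lemma \<phi>0_eq: "X \<in> ObA \<Longrightarrow> Z \<in> ObC \<Longrightarrow> \<phi>0 (X, Z) = (P X Z, dP scP P bP X Z)"
  using corr by (simp add: corresponds_def)

lemma \<phi>0_complex: "X \<in> ObA \<Longrightarrow> Z \<in> ObC \<Longrightarrow> \<phi>0 (X, Z) \<in> complexes scP"
  using hom by (auto simp: aug_coalg_hom_def Let_def)

definition "\<delta> X Z = dP scP P bP X Z"
definition "\<beta>v g = realize scP (\<beta> g)"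
text \<open>The component of \<open>\<phi>\<close> at the reversal of \<open>w\<close> and at
  \<open>v\<close>, including the sign of \<open>\<gamma>\<close>, as a graded map
  \<open>P(path_tgt w, fst v) \<rightarrow> P(fst w, path_tgt v)\<close>.\<close>

definition "G w v = realize hsc (lin pr1 (\<Phi> w v))"

lemma G_homog:
  assumes "w \<in> gen TA" "v \<in> gen TC"
  shows "homog (sCk scP) (\<phi>0 (path_tgt w, fst v)) (\<phi>0 (fst w, path_tgt v)) (path_deg w + path_deg v) (lin pr1 (\<Phi> w v))"
  using hom_maps_homog_lin[OF pr1_hom_maps \<Phi>_homog[OF assms]] by simp

lemma G_mem:
  assumes "w \<in> gen TA" "v \<in> gen TC"
  shows "G w v \<in> gr_hom scP (P (path_tgt w) (fst v)) (P (fst w) (path_tgt v)) (path_deg w + path_deg v + 1)"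
  using realize_mem[OF graded_span_Ck _ _ G_homog[OF assms]] gen_ends[OF assms(1)] gen_ends[OF assms(2)]
  by (simp add: \<phi>0_complex G_def) (simp add: Ck_def \<phi>0_eq)

lemma G_eqv:
  assumes "w \<in> gen TA" "v \<in> gen TC"
  shows "eqv (sCk scP) (lin pr1 (\<Phi> w v)) (unit_vec (Letter (\<phi>0 (path_tgt w, fst v))
    (path_deg w + path_deg v) (G w v) (\<phi>0 (fst w, path_tgt v))))"
  unfolding G_def
  by (rule eqv_unit_realize[OF graded_span_Ck _ _ G_homog[OF assms]])
    (use gen_ends[OF assms(1)] gen_ends[OF assms(2)] in \<open>simp_all add: \<phi>0_complex\<close>)

lemma G_unit:
  assumes "w \<in> gen TA" "v \<in> gen TC" "snd w = []" "snd v = []"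
  shows "G w v = 0"
  using realize_rels[OF module_hom \<Phi>_unit[OF assms]] by (simp add: G_def)

lemma \<beta>v_mem:
  assumes "(w, p, v) \<in> gen S"
  shows "\<beta>v (w, p, v) \<in> P (fst w) (path_tgt v) (path_deg w + ldeg p + path_deg v + 1 + 1)"
  unfolding \<beta>v_def
  by (rule realize_mem[OF spanP _ _ \<beta>_homog[OF assms]])
    (use assms gen_ends(1)[of w scA ObA A] gen_ends(2)[of v scC ObC C] in \<open>simp_all add: gen_S\<close>)

lemma \<beta>v_rels:
  assumes "r \<in> rels S"
  shows "lext scP \<beta>v r = 0"
proof -
  have "lext scP \<beta>v r = realize scP (lin pr010 (lin bP r))"
    by (simp add: \<beta>v_def[abs_def] \<beta>_def lin_lin realize_lin)
  also have "\<dots> = 0"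
    by (rule realize_rels[OF module_axioms pr010_rels[OF hom_maps_rels[OF bP_hom_maps assms]]])
  finally show ?thesis .
qed

lemma \<beta>v_eqv: "eqv S p q \<Longrightarrow> lext scP \<beta>v p = lext scP \<beta>v q"
  using \<beta>v_rels[of "p - q"] by (simp add: eqv_def lext_diff)

lemma letter_mem: "p \<in> gen sP \<Longrightarrow> lelt p \<in> P (lsrc p) (ltgt p) (ldeg p + 1)"
  by (simp add: letters_iff shift_def)

text \<open>The component with \<open>k = n = 0\<close> is the differential of the complex. A letter
  of degree \<open>ldeg p\<close> of \<open>sP\<close> carries an element of degree
  \<open>ldeg p + 1\<close> of \<open>P\<close>, hence the index.\<close>

lemma \<beta>v_unit:
  assumes p: "p \<in> gen sP"
  shows "\<beta>v ((lsrc p, []), p, (ltgt p, [])) = \<delta> (lsrc p) (ltgt p) (ldeg p + 1) (lelt p)"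
proof -
  obtain X n x Z where e: "p = Letter X n x Z" by (cases p)
  have x: "x \<in> P X Z (n + 1)" using letter_mem[OF p] by (simp add: e)
  have "\<delta> X Z (n + 1) x = realize scP (lin s_inv (b00 bP (Letter X n x Z)))"
    using x by (simp add: \<delta>_def dP_def gcomp_def s_map_def)
  also have "\<dots> = realize scP (b00 bP (Letter X n x Z))"
  proof -
    have "realize scP (s_inv l) = lelt l" for l :: "('o, 'q, 'p) letter"
      by (cases l) (simp add: s_inv_def realize_eq_lext)
    then show ?thesis by (simp add: realize_lin) (simp add: realize_eq_lext)
  qed
  finally show ?thesis by (simp add: e \<beta>v_def \<beta>_def b00_def gcomp_def)
qed

text \<open>The object map of a coalgebra homomorphism takes values in complexes, and the
  correspondence identifies their differential with \<open>\<delta>\<close>.\<close>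

lemma \<delta>_square:
  assumes p: "p \<in> gen sP"
  shows "\<delta> (lsrc p) (ltgt p) (ldeg p + 1 + 1) (\<delta> (lsrc p) (ltgt p) (ldeg p + 1) (lelt p)) = 0"
proof -
  have o: "lsrc p \<in> ObA" "ltgt p \<in> ObC" using p by (auto simp: letters_iff)
  show ?thesis
    using complexesD(3)[OF \<phi>0_complex[OF o], of "lelt p" "ldeg p + 1"] letter_mem[OF p] by (simp add: \<phi>0_eq[OF o] \<delta>_def)
qed

text \<open>The sign collected in \<open>conn_of_hom\<close> from \<open>c\<close> and \<open>(s \<otimes> s)\<^sup>-\<^sup>1\<close>.\<close>

definition \<rho> :: "('o, 'a) path \<Rightarrow> ('q, 'c) path \<Rightarrow> int \<Rightarrow> 'k" where
  "\<rho> w v n = ksgn (path_deg w * n + path_deg w + path_deg v + 1)"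

lemma conn_of_hom_eq:
  assumes w: "w \<in> gen TA" and v: "v \<in> gen TC"
  shows "realize scP (conn_of_hom \<phi> (w, p, v)) = scP (\<rho> w v (ldeg p)) (G w v (ldeg p + 1) (lelt p))"
proof -
  let ?q = "lin pr1 (\<Phi> w v)" and ?E = "evm (fst w) (path_tgt v)"
  have 1: "lin (tmap box_deg 0 idm (\<phi> \<triangleright> pr1)) (ftens (unit_vec p) (ftens (gam w) (unit_vec v))) = ftens (unit_vec p) ?q"
    by (simp add: lin_ftens tmap_apply gcomp_def \<Phi>_def lin_lin ftens_unit_left)
  have "conn_of_hom \<phi> (w, p, v) = fscale (ksgn (path_deg w * ldeg p))
      (lin s_map (lin ?E (lin ss_inv (ftens (unit_vec p) ?q))))"
    by (simp add: conn_of_hom_def gcomp_def c_map_def lin_fscale tmap_apply 1)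
  moreover have "realize scP (lin s_map (lin ?E (lin ss_inv (ftens (unit_vec p) q)))) =
      lext scP (\<lambda>l. scP (- ksgn (ldeg l)) (lelt l (ldeg p + 1) (lelt p))) q" for q :: "'p cletter \<Rightarrow>\<^sub>0 'k"
  proof -
    have "realize scP (lin s_map (lin ?E (ss_inv (p, l)))) = scP (- ksgn (ldeg l)) (lelt l (ldeg p + 1) (lelt p))"
      for l :: "'p cletter"
    proof (cases p)
      case (Letter X n x Z)
      obtain M m f N where l: "l = Letter M m f N" by (cases l)
      show ?thesis
        by (simp add: Letter l ss_inv_def tmap_apply s_inv_def s_map_def lin_minus lin_fscale
            realize_eq_lext lext_minus lext_fscale)
    qed
    then show ?thesis by (simp add: lin_ftens lin_lin realize_lin)
  qed
  \<comment> \<open>As \<open>\<phi>\<close> has degree 0, every letter occurring here has the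
    degree of the arguments, so the sign is constant and can be pulled out.\<close>
  moreover have "lext scP (\<lambda>l. scP (- ksgn (ldeg l)) (lelt l (ldeg p + 1) (lelt p))) ?q =
      lext scP (\<lambda>l. scP (- ksgn (path_deg w + path_deg v)) (lelt l (ldeg p + 1) (lelt p))) ?q"
    by (rule lext_cong) (use homogD(4)[OF G_homog[OF w v]] in simp)
  moreover have "\<dots> = scP (- ksgn (path_deg w + path_deg v)) (G w v (ldeg p + 1) (lelt p))"
    by (simp only: lext_fun_scale G_def realize_eq_lext lext_apply)
  ultimately have "realize scP (conn_of_hom \<phi> (w, p, v)) =
      scP (ksgn (path_deg w * ldeg p)) (scP (- ksgn (path_deg w + path_deg v)) (G w v (ldeg p + 1) (lelt p)))"
    by (simp add: realize_eq_lext lext_fscale)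
  then show ?thesis by (simp add: \<rho>_def neg_ksgn flip: ksgn_add) (simp add: add_ac)
qed

text \<open>\<open>G\<close> vanishes on empty arguments, so the differential can be written as an
  extra summand. One formula then holds for all \<open>(k,n)\<close>, and products of components can
  be expanded without distinguishing cases.\<close>

lemma \<beta>v_eq:
  assumes g: "(w, p, v) \<in> gen S"
  shows "\<beta>v (w, p, v) = scP (\<rho> w v (ldeg p)) (G w v (ldeg p + 1) (lelt p)) +
    (if snd w = [] \<and> snd v = [] then \<delta> (lsrc p) (ltgt p) (ldeg p + 1) (lelt p) else 0)"
proof (cases "snd w = [] \<and> snd v = []")
  case True
  have p: "p \<in> gen sP" and o: "w \<in> gen TA" "v \<in> gen TC" using g by (auto simp: gen_S)
  have "w = (lsrc p, [])" "v = (ltgt p, [])"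
    using g True by (cases w; cases v; auto simp: gen_S)+
  then show ?thesis using \<beta>v_unit[OF p] G_unit[OF o] True by simp
next
  case False
  have o: "w \<in> gen TA" "v \<in> gen TC" using g by (auto simp: gen_S)
  have "eqv sP (\<beta> (w, p, v)) (conn_of_hom \<phi> (w, p, v))"
    using corr g False
    by (cases w; cases v) (auto simp: corresponds_def eq_on_def eqv_def \<beta>_def gcomp_def)
  from realize_eqv[OF module_axioms this] show ?thesis
    unfolding conn_of_hom_eq[OF o] if_not_P[OF False] by (simp add: \<beta>v_def)
qed

section \<open>Comparison of the components of the squared connection with those of
  \<open>\<xi>\<close>\<close>

definition "K g = realize scP (lin \<beta> (bP g))"

text \<open>Applies \<open>\<beta>\<close> to the explicit form of the connection. The inner
  component is replaced by the single letter carrying its value, to which the outer component can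
  then be applied.\<close>

lemma K_eq:
  assumes g: "(w, p, v) \<in> gen S"
  shows "K (w, p, v) = (\<Sum>(w1, w2)\<in>cuts w. \<Sum>(v1, v2)\<in>cuts v. scP (ksgn (path_deg v2))
      (\<beta>v (w1, Letter (fst w2) (path_deg w2 + ldeg p + path_deg v1 + 1) (\<beta>v (w2, p, v1)) (path_tgt v1), v2))) +
    scP (ksgn (ldeg p + path_deg v)) (lext scP (\<lambda>x. \<beta>v (x, p, v)) (coder bA w)) +
    lext scP (\<lambda>x. \<beta>v (w, p, x)) (coder bC v)"
proof -
  have "K (w, p, v) = lext scP \<beta>v (bP (w, p, v))"
    by (simp add: K_def realize_lin \<beta>v_def[abs_def])
  also have "\<dots> = lext scP \<beta>v ((\<Sum>(w1, w2)\<in>cuts w. \<Sum>(v1, v2)\<in>cuts v.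
      fscale (ksgn (path_deg v2)) (lin (insert_letter w1 v2) (\<beta> (w2, p, v1)))) +
    fscale (ksgn (ldeg p + path_deg v)) (lin (\<lambda>w'. unit_vec (w', p, v)) (coder bA w)) +
    lin (\<lambda>v'. unit_vec (w, p, v')) (coder bC v))"
    by (rule \<beta>v_eqv[OF bP_formula[OF g]])
  also have "\<dots> = (\<Sum>(w1, w2)\<in>cuts w. \<Sum>(v1, v2)\<in>cuts v.
      scP (ksgn (path_deg v2)) (lext scP \<beta>v (lin (insert_letter w1 v2) (\<beta> (w2, p, v1))))) +
    scP (ksgn (ldeg p + path_deg v)) (lext scP (\<lambda>x. \<beta>v (x, p, v)) (coder bA w)) +
    lext scP (\<lambda>x. \<beta>v (w, p, x)) (coder bC v)"
    by (simp add: lext_add lext_sum lext_fscale case_prod_beta) (simp add: lext_lin)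
  also have "(\<Sum>(w1, w2)\<in>cuts w. \<Sum>(v1, v2)\<in>cuts v.
      scP (ksgn (path_deg v2)) (lext scP \<beta>v (lin (insert_letter w1 v2) (\<beta> (w2, p, v1))))) =
    (\<Sum>(w1, w2)\<in>cuts w. \<Sum>(v1, v2)\<in>cuts v. scP (ksgn (path_deg v2))
      (\<beta>v (w1, Letter (fst w2) (path_deg w2 + ldeg p + path_deg v1 + 1) (\<beta>v (w2, p, v1)) (path_tgt v1), v2)))"
  proof (rule sum_cuts_cong2)
    fix w1 w2 v1 v2 assume cw: "(w1, w2) \<in> cuts w" and cv: "(v1, v2) \<in> cuts v"
    note gw = gen_S_cut_left[OF g cw]
    note gv = gen_S_cut_right[OF gw(3) cv]
    let ?L = "Letter (fst w2) (path_deg w2 + ldeg p + path_deg v1 + 1) (\<beta>v (w2, p, v1)) (path_tgt v1)"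
    have o: "fst w2 \<in> ObA" "path_tgt v1 \<in> ObC" using gen_ends gw(2) gv(1) by blast+
    have "eqv sP (\<beta> (w2, p, v1)) (unit_vec ?L)"
      unfolding \<beta>v_def by (rule eqv_unit_realize[OF spanP o \<beta>_homog[OF gv(3)]])
    then have "eqv S (lin (insert_letter w1 v2) (\<beta> (w2, p, v1))) (lin (insert_letter w1 v2) (unit_vec ?L))"
      by (rule eqv_lin) (rule insert_letter_rels[OF gw(1) gv(2)])
    also have "lin (insert_letter w1 v2) (unit_vec ?L) = unit_vec (w1, ?L, v2)"
      using gw(4) gv(4) by (simp add: insert_letter_def)
    finally have "lext scP \<beta>v (lin (insert_letter w1 v2) (\<beta> (w2, p, v1))) = \<beta>v (w1, ?L, v2)"
      using \<beta>v_eqv by fastforce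
    then show "scP (ksgn (path_deg v2)) (lext scP \<beta>v (lin (insert_letter w1 v2) (\<beta> (w2, p, v1)))) =
        scP (ksgn (path_deg v2)) (\<beta>v (w1, ?L, v2))"
      by (simp only:)
  qed
  finally show ?thesis .
qed

definition "\<Xi> w v = realize hsc (lin pr1 (\<xi> w v))"
definition "GA w v = lext hsc (\<lambda>x. G x v) (coder bA w)"
definition "GC w v = lext hsc (\<lambda>x. G w x) (coder bC v)"

text \<open>The first summand is the term of \<open>m\<^sub>1\<close>, the double sum is that of
  \<open>m\<^sub>2\<close>, and the last two come from the codifferentials of the source.\<close>

lemma \<Xi>_eq:
  assumes w: "w \<in> gen TA" and v: "v \<in> gen TC"
  shows "\<Xi> w v = hom_diff scP (\<phi>0 (path_tgt w, fst v)) (\<phi>0 (fst w, path_tgt v)) (path_deg w + path_deg v) (G w v) +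
    (\<Sum>(w1, w2)\<in>cuts w. \<Sum>(v1, v2)\<in>cuts v. hsc (\<sigma> w1 w2 v1) (hsc (- ksgn (path_deg w1 + path_deg v2))
      (hom_comp (path_deg w2 + path_deg v1) (G w2 v1) (G w1 v2)))) -
    hsc (ksgn (path_deg v)) (GA w v) - GC w v"
proof -
  interpret hs: module hsc by (rule module_hom)
  note gk = homogD(1)[OF \<Phi>_homog[OF w v]]
  let ?D = "\<lambda>l :: 'p cletter. hom_diff scP (lsrc l) (ltgt l) (ldeg l) (lelt l)"
  have "realize hsc (lin pr1 (\<Phi>A w v)) = hsc (ksgn (path_deg v)) (GA w v)" "realize hsc (lin pr1 (\<Phi>C w v)) = GC w v"
    by (simp_all add: \<Phi>A_def \<Phi>C_def lin_fscale lin_lin hs.realize_fscale hs.realize_lin GA_def GC_def G_def)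
  moreover have "lext hsc ?D (lin pr1 (\<Phi> w v)) =
      hom_diff scP (\<phi>0 (path_tgt w, fst v)) (\<phi>0 (fst w, path_tgt v)) (path_deg w + path_deg v) (G w v)"
    using hom_diff_rels[OF G_eqv[OF w v, unfolded eqv_def]] by (simp add: hs.lext_diff)
  moreover have "lext hsc comp_path (\<Phi> w v) =
    (\<Sum>(w1, w2)\<in>cuts w. \<Sum>(v1, v2)\<in>cuts v. hsc (\<sigma> w1 w2 v1) (hsc (- ksgn (path_deg w1 + path_deg v2))
      (hom_comp (path_deg w2 + path_deg v1) (G w2 v1) (G w1 v2))))"
  proof -
    let ?t = "tmap path_deg 0 pr1 pr1"
    have t: "eqv (tens (sCk scP) (sCk scP)) (lin ?t p) (lin ?t q)" if "eqv (tens TCk TCk) p q" for p q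
      by (rule eqv_lin[OF that])
        (rule tmap_rels[OF homogeneous_rels_Ts homogeneous_rels_Ts homogeneous_rels_susp homogeneous_rels_susp
            pr1_hom_maps pr1_hom_maps], auto)
    have c: "lext hsc comp_pair p = lext hsc comp_pair q" if "eqv (tens (sCk scP) (sCk scP)) p q" for p q
      using comp_pair_rels[OF that[unfolded eqv_def]] by (simp add: hs.lext_diff)
    have "lext hsc comp_path (\<Phi> w v) = lext hsc comp_pair (lin ?t (lin cut (\<Phi> w v)))"
      by (rule comp_path_lin_cut) (rule gk)
    also have "\<dots> = lext hsc comp_pair (lin ?t (\<Sum>(w1, w2)\<in>cuts w. \<Sum>(v1, v2)\<in>cuts v.
        fscale (\<sigma> w1 w2 v1) (ftens (\<Phi> w2 v1) (\<Phi> w1 v2))))"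
      by (intro c t \<Phi>_cut w v)
    also have "\<dots> = (\<Sum>(w1, w2)\<in>cuts w. \<Sum>(v1, v2)\<in>cuts v.
        hsc (\<sigma> w1 w2 v1) (lext hsc comp_pair (lin ?t (ftens (\<Phi> w2 v1) (\<Phi> w1 v2)))))"
      by (simp add: lin_sum lin_fscale hs.lext_sum hs.lext_fscale case_prod_beta)
    also have "\<dots> = (\<Sum>(w1, w2)\<in>cuts w. \<Sum>(v1, v2)\<in>cuts v. hsc (\<sigma> w1 w2 v1) (hsc (- ksgn (path_deg w1 + path_deg v2))
      (hom_comp (path_deg w2 + path_deg v1) (G w2 v1) (G w1 v2))))"
    proof (rule sum_cuts_cong2)
      fix w1 w2 v1 v2 assume cw: "(w1, w2) \<in> cuts w" and cv: "(v1, v2) \<in> cuts v"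
      note g = cuts_gen[OF cw w] cuts_gen[OF cv v]
      have m: "path_tgt w1 = fst w2" "fst v2 = path_tgt v1" using cw cv by (simp_all add: cuts_iff)
      let ?p = "lin pr1 (\<Phi> w2 v1)" and ?q = "lin pr1 (\<Phi> w1 v2)"
      \<comment> \<open>Each factor is congruent to the one letter carrying its realization.
        Exchanging the factors one at a time keeps the difference a relation of the tensor product,
        and on a pair of letters \<open>comp_pair\<close> can be computed.\<close>
      let ?l = "Letter (\<phi>0 (path_tgt w2, fst v1)) (path_deg w2 + path_deg v1) (G w2 v1) (\<phi>0 (fst w2, path_tgt v1))"
      let ?m = "Letter (\<phi>0 (fst w2, path_tgt v1)) (path_deg w1 + path_deg v2) (G w1 v2) (\<phi>0 (fst w1, path_tgt v2))"
      note hp = G_homog[OF g(2,3)] and hq = G_homog[OF g(1,4), unfolded m]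
      have ep: "eqv (sCk scP) ?p (unit_vec ?l)" and eq: "eqv (sCk scP) ?q (unit_vec ?m)"
        using G_eqv[OF g(2,3)] G_eqv[OF g(1,4)] by (simp_all add: m)
      have hl: "homog (sCk scP) (\<phi>0 (path_tgt w2, fst v1)) (\<phi>0 (fst w2, path_tgt v1)) (path_deg w2 + path_deg v1) (unit_vec ?l)"
        using G_mem[OF g(2,3)] gen_ends[OF g(2)] gen_ends[OF g(3)]
        by (simp add: homog_def letter_Ck_iff \<phi>0_complex) (simp add: \<phi>0_eq)
      have hd: "homog (sCk scP) (\<phi>0 (path_tgt w2, fst v1)) (\<phi>0 (fst w2, path_tgt v1)) (path_deg w2 + path_deg v1) (?p - unit_vec ?l)"
        by (rule homog_diff[OF hp hl])
      have "ftens (?p - unit_vec ?l) ?q \<in> rels (tens (sCk scP) (sCk scP))"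
        by (rule ftens_rels_left[OF homogeneous_rels_susp _ ep[unfolded eqv_def]])
          (use homogD[OF hd] homogD[OF hq] in auto)
      then have 1: "eqv (tens (sCk scP) (sCk scP)) (ftens ?p ?q) (ftens (unit_vec ?l) ?q)"
        by (simp add: eqv_def ftens_diff_left)
      have hm: "homog (sCk scP) (\<phi>0 (fst w2, path_tgt v1)) (\<phi>0 (fst w1, path_tgt v2)) (path_deg w1 + path_deg v2) (unit_vec ?m)"
        using G_mem[OF g(1,4)] gen_ends[OF g(1)] gen_ends[OF g(4)]
        by (simp add: homog_def letter_Ck_iff \<phi>0_complex flip: m) (simp add: \<phi>0_eq)
      have hd': "homog (sCk scP) (\<phi>0 (fst w2, path_tgt v1)) (\<phi>0 (fst w1, path_tgt v2)) (path_deg w1 + path_deg v2) (?q - unit_vec ?m)"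
        by (rule homog_diff[OF hq hm])
      have "ftens (unit_vec ?l) (?q - unit_vec ?m) \<in> rels (tens (sCk scP) (sCk scP))"
        by (rule ftens_rels_right[OF homogeneous_rels_susp _ eq[unfolded eqv_def]])
          (use homogD[OF hd'] homogD[OF hl] in auto)
      then have 2: "eqv (tens (sCk scP) (sCk scP)) (ftens (unit_vec ?l) ?q) (unit_vec (?l, ?m))"
        by (simp add: eqv_def ftens_diff_right)
      have "lin ?t (ftens (\<Phi> w2 v1) (\<Phi> w1 v2)) = fscale (ksgn ((path_deg w1 + path_deg v2) * 0)) (ftens ?p ?q)"
        by (rule lin_tmap_ftens) (use homogD(4)[OF \<Phi>_homog[OF g(1,4)]] in simp)
      then have "lext hsc comp_pair (lin ?t (ftens (\<Phi> w2 v1) (\<Phi> w1 v2))) = comp_pair (?l, ?m)"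
        using c[OF eqv_trans[OF 1 2]] by simp
      also have "\<dots> = hsc (- ksgn (path_deg w1 + path_deg v2)) (hom_comp (path_deg w2 + path_deg v1) (G w2 v1) (G w1 v2))"
        by (simp only: comp_pair_def prod.case letter.sel)
      finally show "hsc (\<sigma> w1 w2 v1) (lext hsc comp_pair (lin ?t (ftens (\<Phi> w2 v1) (\<Phi> w1 v2)))) =
          hsc (\<sigma> w1 w2 v1) (hsc (- ksgn (path_deg w1 + path_deg v2))
          (hom_comp (path_deg w2 + path_deg v1) (G w2 v1) (G w1 v2)))"
        by (simp only:)
    qed
    finally show ?thesis .
  qed
  moreover have "\<Xi> w v = realize hsc (lin pr1 (\<Phi>b w v)) - realize hsc (lin pr1 (\<Phi>A w v)) -
      realize hsc (lin pr1 (\<Phi>C w v))"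
    by (simp add: \<Xi>_def \<xi>_def lin_diff realize_eq_lext hs.lext_diff)
  moreover have "realize hsc (lin pr1 (\<Phi>b w v)) = lext hsc ?D (lin pr1 (\<Phi> w v)) + lext hsc comp_path (\<Phi> w v)"
    unfolding \<Phi>b_def by (rule realize_pr1_bCk) (rule gk)
  ultimately show ?thesis by (simp only:)
qed

text \<open>The paths produced by a coderivation are nonempty, so the summand with the differential
  is absent; their degree is higher by 1, which changes \<open>\<rho>\<close> by a constant
  sign.\<close>

lemma lext_\<beta>v_coderA:
  assumes g: "(w, p, v) \<in> gen S"
  shows "lext scP (\<lambda>y. \<beta>v (y, p, v)) (coder bA w) =
    scP (ksgn (path_deg w * ldeg p + ldeg p + path_deg w + path_deg v)) (GA w v (ldeg p + 1) (lelt p))"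
proof -
  have w: "w \<in> gen TA" using g by (simp add: gen_S)
  have "lext scP (\<lambda>y. \<beta>v (y, p, v)) (coder bA w) = lext scP (\<lambda>y.
      scP (ksgn (path_deg w * ldeg p + ldeg p + path_deg w + path_deg v)) (G y v (ldeg p + 1) (lelt p))) (coder bA w)"
  proof (rule lext_cong)
    fix y assume y: "y \<in> keys (coder bA w)"
    note h = homogD[OF qA.coder_homog[OF w] y]
    have gy: "(y, p, v) \<in> gen S" using g h by (simp add: gen_S)
    have "\<rho> y v (ldeg p) = ksgn (path_deg w * ldeg p + ldeg p + path_deg w + path_deg v)"
      unfolding \<rho>_def using h(4) by (intro ksgn_cong) (simp add: algebra_simps)
    then show "\<beta>v (y, p, v) = scP (ksgn (path_deg w * ldeg p + ldeg p + path_deg w + path_deg v)) (G y v (ldeg p + 1) (lelt p))"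
      unfolding \<beta>v_eq[OF gy] using qA.coder_nonempty[OF y] by simp
  qed
  then show ?thesis by (simp add: lext_fun_scale GA_def lext_apply)
qed

lemma lext_\<beta>v_coderC:
  assumes g: "(w, p, v) \<in> gen S"
  shows "lext scP (\<lambda>y. \<beta>v (w, p, y)) (coder bC v) =
    scP (ksgn (path_deg w * ldeg p + path_deg w + path_deg v)) (GC w v (ldeg p + 1) (lelt p))"
proof -
  have v: "v \<in> gen TC" using g by (simp add: gen_S)
  have "lext scP (\<lambda>y. \<beta>v (w, p, y)) (coder bC v) = lext scP (\<lambda>y.
      scP (ksgn (path_deg w * ldeg p + path_deg w + path_deg v)) (G w y (ldeg p + 1) (lelt p))) (coder bC v)"
  proof (rule lext_cong)
    fix y assume y: "y \<in> keys (coder bC v)"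
    note h = homogD[OF qC.coder_homog[OF v] y]
    have gy: "(w, p, y) \<in> gen S" using g h by (simp add: gen_S)
    have "\<rho> w y (ldeg p) = ksgn (path_deg w * ldeg p + path_deg w + path_deg v)"
      unfolding \<rho>_def using h(4) by (intro ksgn_cong) (simp add: algebra_simps)
    then show "\<beta>v (w, p, y) = scP (ksgn (path_deg w * ldeg p + path_deg w + path_deg v)) (G w y (ldeg p + 1) (lelt p))"
      unfolding \<beta>v_eq[OF gy] using qC.coder_nonempty[OF y] by simp
  qed
  then show ?thesis by (simp add: lext_fun_scale GC_def lext_apply)
qed

text \<open>Inner and outer component are each a sum of \<open>G\<close> and possibly the
  differential. The product of two \<open>G\<close> gives \<open>m\<^sub>2\<close>, the two mixed
  products give the halves of \<open>m\<^sub>1\<close>, and the differential squares to zero. The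
  mixed terms are written with tests on the pieces so that the sums over cuts collapse.\<close>

lemma \<beta>v_\<beta>v:
  assumes g: "(w, p, v) \<in> gen S" and cw: "(w1, w2) \<in> cuts w" and cv: "(v1, v2) \<in> cuts v"
  shows "scP (ksgn (path_deg v2))
      (\<beta>v (w1, Letter (fst w2) (path_deg w2 + ldeg p + path_deg v1 + 1) (\<beta>v (w2, p, v1)) (path_tgt v1), v2)) =
    scP (\<rho> w v (ldeg p)) (scP (\<sigma> w1 w2 v1) (scP (- ksgn (path_deg w1 + path_deg v2))
      (hom_comp (path_deg w2 + path_deg v1) (G w2 v1) (G w1 v2) (ldeg p + 1) (lelt p)))) +
    ((if w2 = (path_tgt w1, []) then if v1 = (fst v2, []) then
       scP (ksgn (path_deg v2)) (scP (\<rho> w1 v2 (ldeg p + 1))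
         (G w1 v2 (ldeg p + 1 + 1) (\<delta> (path_tgt w1) (fst v2) (ldeg p + 1) (lelt p)))) else 0 else 0) +
     (if w1 = (fst w2, []) then if v2 = (path_tgt v1, []) then
       \<delta> (fst w2) (path_tgt v1) (path_deg w2 + ldeg p + path_deg v1 + 1 + 1)
         (scP (\<rho> w2 v1 (ldeg p)) (G w2 v1 (ldeg p + 1) (lelt p))) else 0 else 0))"
proof -
  let ?n = "ldeg p" and ?x = "lelt p"
  let ?n1 = "path_deg w2 + ?n + path_deg v1 + 1"
  let ?L = "Letter (fst w2) ?n1 (\<beta>v (w2, p, v1)) (path_tgt v1)"
  let ?M = "P (fst w2) (path_tgt v1)"
  note gw = gen_S_cut_left[OF g cw]
  note gv = gen_S_cut_right[OF gw(3) cv]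
  have o: "fst w2 \<in> ObA" "path_tgt v1 \<in> ObC"
    using gen_ends(1)[OF gw(2)] gen_ends(2)[OF gv(1)] by simp_all
  have p: "p \<in> gen sP" "path_tgt w2 = lsrc p" "ltgt p = fst v1" using gv(3) by (auto simp: gen_S)
  have x: "?x \<in> P (lsrc p) (ltgt p) (?n + 1)" by (rule letter_mem[OF p(1)])
  have op: "lsrc p \<in> ObA" "ltgt p \<in> ObC" using p(1) by (auto simp: letters_iff)
  have cM: "(?M, \<delta> (fst w2) (path_tgt v1)) \<in> complexes scP"
    using \<phi>0_complex[OF o] by (simp add: \<phi>0_eq[OF o] \<delta>_def)
  have \<delta>M: "\<delta> (fst w2) (path_tgt v1) \<in> gr_hom scP ?M ?M 1"
    using complexesD(2)[OF cM] by simp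
  have sub: "subspace (?M i)" for i using complexesD(1)[OF cM] by simp
  have gL: "(w1, ?L, v2) \<in> gen S"
    using gw gv o \<beta>v_mem[OF gv(3)] by (simp add: gen_S letters_iff shift_def)
  have G1: "G w1 v2 \<in> gr_hom scP ?M (P (fst w1) (path_tgt v2)) (path_deg w1 + path_deg v2 + 1)"
    using G_mem[OF gw(1) gv(2)] gw(4) gv(4) by simp
  \<comment> \<open>\<open>u1\<close> means that the outer component is
    \<open>b\<^sup>P\<^sub>0\<^sub>0\<close>, \<open>u2\<close> that the inner one is.\<close>
  define u1 where "u1 \<longleftrightarrow> snd w1 = [] \<and> snd v2 = []"
  define u2 where "u2 \<longleftrightarrow> snd w2 = [] \<and> snd v1 = []"
  have u1: "u1 \<longleftrightarrow> w1 = (fst w2, []) \<and> v2 = (path_tgt v1, [])"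
    using cw cv by (cases w1; cases w2; cases v1; cases v2) (auto simp: u1_def cuts_iff)
  have u2: "u2 \<longleftrightarrow> w2 = (path_tgt w1, []) \<and> v1 = (fst v2, [])"
    using cw cv by (cases w1; cases w2; cases v1; cases v2) (auto simp: u2_def cuts_iff)
  have u2': "fst w2 = lsrc p \<and> path_tgt v1 = ltgt p \<and> path_tgt w1 = lsrc p \<and> fst v2 = ltgt p \<and> path_deg w2 = 0 \<and> path_deg v1 = 0" if u2
    using that p gw(4) gv(4) by (cases w2; cases v1) (auto simp: u2_def)
  define a where "a = scP (\<rho> w2 v1 ?n) (G w2 v1 (?n + 1) ?x)"
  define d where "d = (if u2 then \<delta> (lsrc p) (ltgt p) (?n + 1) ?x else 0)"
  have y: "\<beta>v (w2, p, v1) = a + d"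
    unfolding \<beta>v_eq[OF gv(3)] a_def d_def u2_def ..
  have G2: "G w2 v1 (?n + 1) ?x \<in> ?M (?n1 + 1)"
    using gr_homD(1)[OF G_mem[OF gw(2) gv(1)], of ?x "?n + 1"] x p by (simp add: add_ac)
  have a: "a \<in> ?M (?n1 + 1)" unfolding a_def by (rule subspace_scale[OF sub G2])
  have d: "d \<in> ?M (?n1 + 1)"
  proof (cases u2)
    case True
    have "\<delta> (lsrc p) (ltgt p) (?n + 1) ?x \<in> P (lsrc p) (ltgt p) (?n + 1 + 1)"
      using gr_homD(1)[OF \<delta>M, of ?x "?n + 1"] x u2'[OF True] by simp
    then show ?thesis using True u2'[OF True] by (simp add: d_def)
  qed (simp add: d_def subspace_0[OF sub])
  \<comment> \<open>This disposes of the product of two differentials.\<close>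
  have \<delta>d: "\<delta> (fst w2) (path_tgt v1) (?n1 + 1) d = 0"
  proof (cases u2)
    case True
    then show ?thesis using \<delta>_square[OF p(1)] u2'[OF True] by (simp add: d_def)
  qed (use gr_hom_zero[OF \<delta>M sub] in \<open>simp add: d_def\<close>)
  have "\<beta>v (w1, ?L, v2) = scP (\<rho> w1 v2 ?n1) (G w1 v2 (?n1 + 1) (a + d)) +
      (if u1 then \<delta> (fst w2) (path_tgt v1) (?n1 + 1) (a + d) else 0)"
    using \<beta>v_eq[OF gL] by (simp only: letter.sel u1_def y)
  also have "\<dots> = scP (\<rho> w1 v2 ?n1) (G w1 v2 (?n1 + 1) a) + scP (\<rho> w1 v2 ?n1) (G w1 v2 (?n1 + 1) d) +
      (if u1 then \<delta> (fst w2) (path_tgt v1) (?n1 + 1) a else 0)"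
    using gr_homD(2)[OF G1 a d] gr_homD(2)[OF \<delta>M a d] \<delta>d by (simp add: scale_right_distrib)
  finally have "scP (ksgn (path_deg v2)) (\<beta>v (w1, ?L, v2)) =
      scP (ksgn (path_deg v2)) (scP (\<rho> w1 v2 ?n1) (G w1 v2 (?n1 + 1) a)) +
      (scP (ksgn (path_deg v2)) (scP (\<rho> w1 v2 ?n1) (G w1 v2 (?n1 + 1) d)) +
      scP (ksgn (path_deg v2)) (if u1 then \<delta> (fst w2) (path_tgt v1) (?n1 + 1) a else 0))"
    by (simp only: scale_right_distrib add.assoc)
  moreover have "scP (ksgn (path_deg v2)) (scP (\<rho> w1 v2 ?n1) (G w1 v2 (?n1 + 1) a)) =
      scP (\<rho> w v ?n) (scP (\<sigma> w1 w2 v1) (scP (- ksgn (path_deg w1 + path_deg v2))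
      (hom_comp (path_deg w2 + path_deg v1) (G w2 v1) (G w1 v2) (?n + 1) ?x)))"
  proof -
    have "G w1 v2 (?n1 + 1) a = scP (\<rho> w2 v1 ?n) (hom_comp (path_deg w2 + path_deg v1) (G w2 v1) (G w1 v2) (?n + 1) ?x)"
      unfolding a_def using gr_homD(3)[OF G1 G2] by (simp add: hom_comp_def add_ac)
    \<comment> \<open>The outer \<open>\<rho>\<close> is taken at the degree \<open>?n1\<close> of
      the inner value; the product of \<open>path_deg w1\<close> with its part
      \<open>path_deg w2 + path_deg v1\<close> is the exponent of \<open>\<sigma>\<close>.\<close>
    moreover have "ksgn (path_deg v2) * (\<rho> w1 v2 ?n1 * \<rho> w2 v1 ?n) =
        \<rho> w v ?n * (\<sigma> w1 w2 v1 * (- ksgn (path_deg w1 + path_deg v2)))"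
      unfolding \<rho>_def \<sigma>_def neg_ksgn ksgn_add[symmetric] cuts_deg[OF cw] cuts_deg[OF cv]
      by (intro ksgn_cong) auto
    ultimately show ?thesis by (simp only: scale_scale)
  qed
  moreover have "scP (ksgn (path_deg v2)) (scP (\<rho> w1 v2 ?n1) (G w1 v2 (?n1 + 1) d)) =
      (if w2 = (path_tgt w1, []) then if v1 = (fst v2, []) then
       scP (ksgn (path_deg v2)) (scP (\<rho> w1 v2 (?n + 1))
         (G w1 v2 (?n + 1 + 1) (\<delta> (path_tgt w1) (fst v2) (?n + 1) ?x))) else 0 else 0)"
  proof (cases u2)
    case True
    then have "d = \<delta> (path_tgt w1) (fst v2) (?n + 1) ?x" "?n1 = ?n + 1" using u2'[OF True] by (simp_all add: d_def)
    then show ?thesis using True[unfolded u2] by (simp only: if_True simp_thms)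
  next
    case False
    have "d = 0" using False by (simp add: d_def)
    moreover have "G w1 v2 (?n1 + 1) 0 = 0" by (rule gr_hom_zero[OF G1 sub])
    ultimately show ?thesis using False[unfolded u2] by auto
  qed
  moreover have "scP (ksgn (path_deg v2)) (if u1 then \<delta> (fst w2) (path_tgt v1) (?n1 + 1) a else 0) =
      (if w1 = (fst w2, []) then if v2 = (path_tgt v1, []) then
       \<delta> (fst w2) (path_tgt v1) (?n1 + 1) a else 0 else 0)"
    using u1 by auto
  ultimately show ?thesis by (simp only: a_def)
qed

text \<open>The adjunction between component maps on \<open>P\<close> and maps of complexes, at the
  level of the two obstructions: both sides consist of the same terms, and one overall sign
  \<open>\<rho>\<close> accounts for all differences.\<close>

lemma K_eq_\<Xi>:
  assumes g: "(w, p, v) \<in> gen S"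
  shows "K (w, p, v) = scP (\<rho> w v (ldeg p)) (\<Xi> w v (ldeg p + 1) (lelt p))"
proof -
  let ?n = "ldeg p" and ?x = "lelt p" and ?R = "\<rho> w v (ldeg p)"
  have w: "w \<in> gen TA" and v: "v \<in> gen TC" and e: "path_tgt w = lsrc p" "ltgt p = fst v" and p: "p \<in> gen sP"
    using g by (auto simp: gen_S)
  note o = gen_ends[OF w] gen_ends[OF v]
  let ?t = "\<lambda>w1 w2 v1 v2. scP (\<sigma> w1 w2 v1) (scP (- ksgn (path_deg w1 + path_deg v2))
      (hom_comp (path_deg w2 + path_deg v1) (G w2 v1) (G w1 v2) (?n + 1) ?x))"
  let ?a = "\<lambda>w1 w2 v1 v2. if w2 = (path_tgt w1, []) then if v1 = (fst v2, []) then
       scP (ksgn (path_deg v2)) (scP (\<rho> w1 v2 (?n + 1))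
         (G w1 v2 (?n + 1 + 1) (\<delta> (path_tgt w1) (fst v2) (?n + 1) ?x))) else 0 else 0"
  let ?b = "\<lambda>w1 w2 v1 v2. if w1 = (fst w2, []) then if v2 = (path_tgt v1, []) then
       \<delta> (fst w2) (path_tgt v1) (path_deg w2 + ?n + path_deg v1 + 1 + 1)
         (scP (\<rho> w2 v1 ?n) (G w2 v1 (?n + 1) ?x)) else 0 else 0"
  let ?S = "\<lambda>f. \<Sum>(w1, w2)\<in>cuts w. \<Sum>(v1, v2)\<in>cuts v. f w1 w2 v1 v2"
  have split: "?S (\<lambda>w1 w2 v1 v2. scP r (f w1 w2 v1 v2) + (h w1 w2 v1 v2 + k w1 w2 v1 v2)) =
      scP r (?S f) + (?S h + ?S k)" for r and f h k :: "_ \<Rightarrow> _ \<Rightarrow> _ \<Rightarrow> _ \<Rightarrow> 'p"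
    by (simp add: sum.distrib scale_sum_right case_prod_beta)
  have pull: "(\<Sum>y\<in>W. if Q then f y else 0) = (if Q then sum f W else 0)" for Q and W and f :: "_ \<Rightarrow> 'p"
    by simp
  have "(\<Sum>(w1, w2)\<in>cuts w. \<Sum>(v1, v2)\<in>cuts v. scP (ksgn (path_deg v2))
      (\<beta>v (w1, Letter (fst w2) (path_deg w2 + ?n + path_deg v1 + 1) (\<beta>v (w2, p, v1)) (path_tgt v1), v2))) =
    ?S (\<lambda>w1 w2 v1 v2. scP ?R (?t w1 w2 v1 v2) + (?a w1 w2 v1 v2 + ?b w1 w2 v1 v2))"
    by (intro sum_cuts_cong2 \<beta>v_\<beta>v g)
  also have "\<dots> = scP ?R (?S ?t) + (?S ?a + ?S ?b)"
    by (rule split)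
  also have "?S ?a = scP (ksgn (path_deg v)) (scP (\<rho> w v (?n + 1)) (G w v (?n + 1 + 1) (\<delta> (path_tgt w) (fst v) (?n + 1) ?x)))"
  proof -
    have "?S ?a = (\<Sum>(w1, w2)\<in>cuts w. if w2 = (path_tgt w1, []) then
        (\<Sum>(v1, v2)\<in>cuts v. if v1 = (fst v2, []) then
       scP (ksgn (path_deg v2)) (scP (\<rho> w1 v2 (?n + 1))
         (G w1 v2 (?n + 1 + 1) (\<delta> (path_tgt w1) (fst v2) (?n + 1) ?x))) else 0) else 0)"
      unfolding case_prod_beta pull ..
    then show ?thesis by (simp only: sum_cuts_left_Nil sum_cuts_right_Nil)
  qed
  also have "?S ?b = \<delta> (fst w) (path_tgt v) (path_deg w + ?n + path_deg v + 1 + 1) (scP ?R (G w v (?n + 1) ?x))"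
  proof -
    have "?S ?b = (\<Sum>(w1, w2)\<in>cuts w. if w1 = (fst w2, []) then
        (\<Sum>(v1, v2)\<in>cuts v. if v2 = (path_tgt v1, []) then
       \<delta> (fst w2) (path_tgt v1) (path_deg w2 + ?n + path_deg v1 + 1 + 1)
         (scP (\<rho> w2 v1 ?n) (G w2 v1 (?n + 1) ?x)) else 0) else 0)"
      unfolding case_prod_beta pull ..
    then show ?thesis by (simp only: sum_cuts_left_Nil sum_cuts_right_Nil)
  qed
  finally have K: "K (w, p, v) = scP ?R (?S ?t) +
      (scP (ksgn (path_deg v)) (scP (\<rho> w v (?n + 1)) (G w v (?n + 1 + 1) (\<delta> (path_tgt w) (fst v) (?n + 1) ?x))) +
       \<delta> (fst w) (path_tgt v) (path_deg w + ?n + path_deg v + 1 + 1) (scP ?R (G w v (?n + 1) ?x))) +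
      scP (ksgn (?n + path_deg v)) (scP (ksgn (path_deg w * ?n + ?n + path_deg w + path_deg v)) (GA w v (?n + 1) ?x)) +
      scP (ksgn (path_deg w * ?n + path_deg w + path_deg v)) (GC w v (?n + 1) ?x)"
    unfolding K_eq[OF g] lext_\<beta>v_coderA[OF g] lext_\<beta>v_coderC[OF g] by (simp only:)
  have app: "(\<Sum>y\<in>W. f y) i z = (\<Sum>y\<in>W. f y i z)" for W i z and f :: "_ \<Rightarrow> int \<Rightarrow> 'p \<Rightarrow> 'p"
    by (induction W rule: infinite_finite_induct) auto
  have sc_app: "hsc r f i z = scP r (f i z)" for r f i z by (simp add: hom_scale_def)
  have \<Xi>: "\<Xi> w v (?n + 1) ?x = (\<delta> (fst w) (path_tgt v) (path_deg w + ?n + path_deg v + 1 + 1) (G w v (?n + 1) ?x) -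
      scP (ksgn (path_deg w + path_deg v + 1)) (G w v (?n + 1 + 1) (\<delta> (path_tgt w) (fst v) (?n + 1) ?x))) + ?S ?t -
      scP (ksgn (path_deg v)) (GA w v (?n + 1) ?x) - GC w v (?n + 1) ?x"
  proof -
    have "hom_diff scP (\<phi>0 (path_tgt w, fst v)) (\<phi>0 (fst w, path_tgt v)) (path_deg w + path_deg v) (G w v) (?n + 1) ?x =
      \<delta> (fst w) (path_tgt v) (path_deg w + ?n + path_deg v + 1 + 1) (G w v (?n + 1) ?x) -
      scP (ksgn (path_deg w + path_deg v + 1)) (G w v (?n + 1 + 1) (\<delta> (path_tgt w) (fst v) (?n + 1) ?x))"
      using o by (simp add: hom_diff_def \<phi>0_eq \<delta>_def add_ac)
    moreover have "(\<Sum>(w1, w2)\<in>cuts w. \<Sum>(v1, v2)\<in>cuts v. hsc (\<sigma> w1 w2 v1) (hsc (- ksgn (path_deg w1 + path_deg v2))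
        (hom_comp (path_deg w2 + path_deg v1) (G w2 v1) (G w1 v2)))) (?n + 1) ?x = ?S ?t"
      by (simp only: case_prod_beta' app sc_app)
    ultimately show ?thesis
      unfolding \<Xi>_eq[OF w v] by (simp only: plus_fun_apply minus_apply sc_app)
  qed
  have x: "?x \<in> P (path_tgt w) (fst v) (?n + 1)" using letter_mem[OF p] by (simp add: e)
  have "\<delta> (fst w) (path_tgt v) \<in> gr_hom scP (P (fst w) (path_tgt v)) (P (fst w) (path_tgt v)) 1"
    using complexesD(2)[OF \<phi>0_complex[OF o(1,4)]] by (simp add: \<phi>0_eq[OF o(1,4)] \<delta>_def)
  from gr_homD(3)[OF this, of "G w v (?n + 1) ?x" "path_deg w + ?n + path_deg v + 1 + 1" ?R]
  have \<delta>: "\<delta> (fst w) (path_tgt v) (path_deg w + ?n + path_deg v + 1 + 1) (scP ?R (G w v (?n + 1) ?x)) =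
      scP ?R (\<delta> (fst w) (path_tgt v) (path_deg w + ?n + path_deg v + 1 + 1) (G w v (?n + 1) ?x))"
    using gr_homD(1)[OF G_mem[OF w v] x] by (simp add: add_ac)
  \<comment> \<open>The signs of the second half of \<open>m\<^sub>1\<close> and of the terms with
    \<open>b\<^sup>A\<close> and \<open>b\<^sup>C\<close>. Each is \<open>- \<rho>\<close> times the
    sign of the corresponding term of \<open>\<Xi>\<close>, which is subtracted there.\<close>
  have s1: "ksgn (path_deg v) * \<rho> w v (?n + 1) = - (?R * ksgn (path_deg w + path_deg v + 1))"
    unfolding \<rho>_def ksgn_add[symmetric] neg_ksgn by (intro ksgn_cong) auto
  have s2: "ksgn (?n + path_deg v) * ksgn (path_deg w * ?n + ?n + path_deg w + path_deg v) = - (?R * ksgn (path_deg v))"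
    unfolding \<rho>_def ksgn_add[symmetric] neg_ksgn by (intro ksgn_cong) auto
  have s3: "ksgn (path_deg w * ?n + path_deg w + path_deg v) = - ?R"
    unfolding \<rho>_def neg_ksgn by (intro ksgn_cong) auto
  show ?thesis
    unfolding K \<Xi> \<delta> scale_scale s1 s2 s3
    by (simp add: scale_right_distrib scale_right_diff_distrib)
qed

lemma flat_iff_K: "flat scA ObA A scC ObC C scP P bP \<longleftrightarrow> (\<forall>g\<in>gen S. K g = 0)"
proof -
  have "lin pr010 (D g) \<in> rels sP \<longleftrightarrow> K g = 0" if g: "g \<in> gen S" for g
  proof -
    obtain w p v where e: "g = (w, p, v)" by (metis surj_pair)
    have g': "(w, p, v) \<in> gen S" using g e by simp
    then have "fst w \<in> ObA" "path_tgt v \<in> ObC"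
      using gen_ends(1)[of w scA ObA A] gen_ends(2)[of v scC ObC C] by (simp_all add: gen_S)
    from rels_iff_realize[OF spanP this pr010_homog[OF D_homog[OF g']]]
    show ?thesis by (simp add: e K_def \<beta>_square)
  qed
  then show ?thesis unfolding flat_iff by blast
qed

lemma functor_iff_\<Xi>:
  "ainf_functor scA ObA A bA scC ObC C bC scP \<phi>0 \<phi> \<longleftrightarrow> (\<forall>w\<in>gen TA. \<forall>v\<in>gen TC. \<Xi> w v = 0)"
proof -
  have "lin pr1 (\<xi> w v) \<in> rels (sCk scP) \<longleftrightarrow> \<Xi> w v = 0" if w: "w \<in> gen TA" and v: "v \<in> gen TC" for w v
    unfolding \<Xi>_def
    by (rule rels_iff_realize[OF graded_span_Ck _ _ hom_maps_homog_lin[OF pr1_hom_maps \<xi>_homog[OF w v]]])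
      (use gen_ends[OF w] gen_ends[OF v] in \<open>simp_all add: \<phi>0_complex\<close>)
  then show ?thesis unfolding functor_iff by blast
qed

text \<open>For the implication from flatness, \<open>K\<close> has to determine the map
  \<open>\<Xi> w v\<close>: every element of its domain is carried by some letter, and
  \<open>\<rho>\<close> squares to 1.\<close>

lemma flat_iff_functor:
  "flat scA ObA A scC ObC C scP P bP \<longleftrightarrow> ainf_functor scA ObA A bA scC ObC C bC scP \<phi>0 \<phi>"
  unfolding flat_iff_K functor_iff_\<Xi>
proof (intro iffI ballI)
  fix g assume *: "\<forall>w\<in>gen TA. \<forall>v\<in>gen TC. \<Xi> w v = 0" "g \<in> gen S"
  obtain w p v where e: "g = (w, p, v)" by (metis surj_pair)
  show "K g = 0" using * K_eq_\<Xi>[of w p v] by (auto simp: e gen_S)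
next
  fix w v assume *: "\<forall>g\<in>gen S. K g = 0" and w: "w \<in> gen TA" and v: "v \<in> gen TC"
  note o = gen_ends[OF w] gen_ends[OF v]
  have "\<Xi> w v \<in> Ck scP (\<phi>0 (path_tgt w, fst v)) (\<phi>0 (fst w, path_tgt v)) (path_deg w + path_deg v + 1 + 1)"
    unfolding \<Xi>_def
    using realize_mem[OF graded_span_Ck \<phi>0_complex[OF o(2,3)] \<phi>0_complex[OF o(1,4)]]
      hom_maps_homog_lin[OF pr1_hom_maps \<xi>_homog[OF w v]] by fastforce
  then have m: "\<Xi> w v \<in> gr_hom scP (P (path_tgt w) (fst v)) (P (fst w) (path_tgt v)) (path_deg w + path_deg v + 1 + 1)"
    by (simp add: Ck_def \<phi>0_eq o)
  \<comment> \<open>Graded maps are extended by zero outside the submodules, so only arguments in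
    \<open>P\<close> need a letter.\<close>
  have "\<Xi> w v i x = 0" for i x
  proof (cases "x \<in> P (path_tgt w) (fst v) i")
    case True
    \<comment> \<open>The degree \<open>i - 1\<close> undoes the shift by the suspension.\<close>
    let ?p = "Letter (path_tgt w) (i - 1) x (fst v)"
    have g: "(w, ?p, v) \<in> gen S" using True w v o by (simp add: gen_S letters_iff shift_def)
    have "scP (\<rho> w v (i - 1)) (\<Xi> w v i x) = 0" using K_eq_\<Xi>[OF g] * g by simp
    then have "scP (\<rho> w v (i - 1) * \<rho> w v (i - 1)) (\<Xi> w v i x) = 0"
      by (metis scale_scale scale_zero_right)
    then show ?thesis by (simp add: \<rho>_def)
  qed (rule gr_homD(4)[OF m])
  then show "\<Xi> w v = 0" by (simp add: fun_eq_iff)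
qed

end

theorem proposition5p2:
  fixes scA :: "'k::comm_ring_1 \<Rightarrow> 'a::ab_group_add \<Rightarrow> 'a"
    and scC :: "'k \<Rightarrow> 'c::ab_group_add \<Rightarrow> 'c"
    and scP :: "'k \<Rightarrow> 'p::ab_group_add \<Rightarrow> 'p"
    and ObA :: "'o set" and A :: "'o \<Rightarrow> 'o \<Rightarrow> int \<Rightarrow> 'a set"
    and bA :: "nat \<Rightarrow> (('o, 'a) path, ('o, 'o, 'a) letter, 'k) gmap"
    and ObC :: "'q set" and C :: "'q \<Rightarrow> 'q \<Rightarrow> int \<Rightarrow> 'c set"
    and bC :: "nat \<Rightarrow> (('q, 'c) path, ('q, 'q, 'c) letter, 'k) gmap"
    and P :: "'o \<Rightarrow> 'q \<Rightarrow> int \<Rightarrow> 'p set"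
    and bP :: "(('o, 'a, 'p, 'q, 'c) bipath, ('o, 'a, 'p, 'q, 'c) bipath, 'k) gmap"
    and \<phi>0 :: "'o \<times> 'q \<Rightarrow> 'p cpx"
    and \<phi> :: "(('o, 'a) path \<times> ('q, 'c) path, ('p cpx, int \<Rightarrow> 'p \<Rightarrow> 'p) path, 'k) gmap"
  assumes A: "ainf_category scA ObA A bA"
    and C: "ainf_category scC ObC C bC"
    and P: "graded_span scP ObA ObC P"
    and conn: "connection scA ObA A bA scC ObC C bC scP P bP"
    and b00: "eq_on (gen (susp scP ObA ObC P)) (susp scP ObA ObC P) (b00 bP \<triangleright> b00 bP) 0"
    and hom: "aug_coalg_hom scA ObA A scC ObC C scP \<phi>0 \<phi>"
    and corr: "corresponds scA ObA A scC ObC C scP P bP \<phi>0 \<phi>"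
  shows "flat scA ObA A scC ObC C scP P bP \<longleftrightarrow>
    ainf_functor scA ObA A bA scC ObC C bC scP \<phi>0 \<phi>"
proof -
  interpret connection_correspondence scA scC ObA A bA ObC C bC scP P bP \<phi>0 \<phi>
    using P by (intro connection_correspondence.intro bicomodule_connection.intro augmented_hom.intro
        ainf_pair.intro scalar_module.intro bicomodule_connection_axioms.intro augmented_hom_axioms.intro
        connection_correspondence_axioms.intro A C P conn hom corr) (simp add: graded_span_def)
  show ?thesis by (rule flat_iff_functor)
qed

end
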